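(* Let $\mathbb{X}$ be a Banach space with a basis. Assume that $\ell_2$ is isomorphic to a complemented subspace of $\mathbb{X}$ and that at least one of $c_0$ and $\ell_1$ is isomorphic to a complemented subspace of $\mathbb{X}$. Then $\mathbb{X}$ has an almost greedy basis $\mathcal{B}$ with $\phi_m[\mathcal{B}]\approx m^{1/2}$ for $m\in\mathbb{N}$ and $L_m[\mathcal{B}]\approx\log m$ for $m\ge2$.
   Context: Banach spaces are real or complex and bases are Schauder bases. Let $\mathcal{B}=(\mathbf{x}_n)_{n=1}^\infty$ be a basis of $\mathbb{X}$ with coordinate functionals $(\mathbf{x}_n^* )_{n=1}^\infty$. For $A\subseteq\mathbb{N}$, the coordinate projection is $S_A[\mathcal{B}](f)=\sum_{n\in A}\mathbf{x}_n^*(f)\,\mathbf{x}_n$ (when well defined), and $\operatorname{supp}(f)=\{n:\mathbf{x}_n^*(f)\neq0\}$. The basis is almost greedy if there is a constant $C$ such that $\|f-S_A[\mathcal{B}](f)\|\le C\|f-S_B[\mathcal{B}](f)\|$ whenever $f\in\mathbb{X}$, $A,B\subseteq\mathbb{N}$, $|B|\le|A|<\infty$, and $|\mathbf{x}_j^*(f)|\le|\mathbf{x}_k^*(f)|$ for all $j\in\mathbb{N}\setminus A$ and $k\in A$. The fundamental function is $\phi_m[\mathcal{B}]=\sup_{|A|\le m}\|\sum_{j\in A}\mathbf{x}_j\|$. The w-conditionality constants are $$L_m[\mathcal{B}]=\sup\left\{\frac{\|S_A[\mathcal{B}](f)\|}{\|f\|}: f\ne0,\ \max(\operatorname{supp}(f))\le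 m,\ A\subseteq\mathbb{N}\right\}.$$ For families of nonnegative reals, $\alpha_i\lesssim\beta_i$ means there is a constant $C$ with $\alpha_i\le C\beta_i$ for all $i$, and $\alpha_i\approx\beta_i$ means $\alpha_i\lesssim\beta_i$ and $\beta_i\lesssim\alpha_i$. *)

theory Defs
  imports "HOL-Analysis.Analysis"
begin

text \<open>
  A Banach space over the scalar field \<open>'k\<close>. The sort of \<open>'k\<close> admits exactly
  \<open>real\<close> and \<open>complex\<close> up to isometric isomorphism (Frobenius), so statements about this
  locale are statements about real and complex Banach spaces. The type \<open>'a\<close> carries the
  underlying real Banach space; \<open>scl\<close> extends its real scalar multiplication to \<open>'k\<close>.
\<close>

locale banach_space_over = vector_space scl
  for scl :: "'k::{real_normed_field,euclidean_space} \<Rightarrow> 'a::banach \<Rightarrow> 'a" +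
  assumes scale_of_real: "scl (of_real r) x = r *\<^sub>R x"
    and norm_scale: "norm (scl c x) = norm c * norm x"

lemma banach_space_over_real: "banach_space_over (scaleR :: real \<Rightarrow> 'a::banach \<Rightarrow> 'a)"
  by unfold_locales (simp_all add: algebra_simps)

lemma banach_space_over_complex: "banach_space_over ((*) :: complex \<Rightarrow> complex \<Rightarrow> complex)"
  by unfold_locales (simp_all add: algebra_simps norm_mult scaleR_conv_of_real)


subsection \<open>Sequence spaces and complemented subspaces\<close>

definition lp_space :: "real \<Rightarrow> (nat \<Rightarrow> 'k::real_normed_field) set" where
  "lp_space p = {a. summable (\<lambda>n. norm (a n) powr p)}"

definition lp_norm :: "real \<Rightarrow> (nat \<Rightarrow> 'k::real_normed_field) \<Rightarrow> real" where
  "lp_norm p a = (\<Sum>n. norm (a n) powr p) powr (1 / p)"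

definition c0_space :: "(nat \<Rightarrow> 'k::real_normed_field) set" where
  "c0_space = {a. a \<longlonglongrightarrow> 0}"

definition sup_norm :: "(nat \<Rightarrow> 'k::real_normed_field) \<Rightarrow> real" where
  "sup_norm a = (SUP n. norm (a n))"

definition complemented_subspace ::
  "('k::{real_normed_field,euclidean_space} \<Rightarrow> 'a::banach \<Rightarrow> 'a) \<Rightarrow> 'a set \<Rightarrow> bool" where
  "complemented_subspace scl Y \<longleftrightarrow>
     (\<exists>P. bounded_linear P \<and> (\<forall>c f. P (scl c f) = scl c (P f)) \<and>
          (\<forall>f. P (P f) = P f) \<and> range P = Y)"

text \<open>\<open>V\<close> is a sequence space with norm \<open>N\<close> and \<open>Y\<close> a subspace of the Banach space.\<close>

definition seq_space_isomorphic ::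
  "('k::{real_normed_field,euclidean_space} \<Rightarrow> 'a::banach \<Rightarrow> 'a) \<Rightarrow>
   (nat \<Rightarrow> 'k) set \<Rightarrow> ((nat \<Rightarrow> 'k) \<Rightarrow> real) \<Rightarrow> 'a set \<Rightarrow> bool" where
  "seq_space_isomorphic scl V N Y \<longleftrightarrow>
     (\<exists>T. bij_betw T V Y \<and>
          (\<forall>a\<in>V. \<forall>b\<in>V. T (\<lambda>n. a n + b n) = T a + T b) \<and>
          (\<forall>c. \<forall>a\<in>V. T (\<lambda>n. c * a n) = scl c (T a)) \<and>
          (\<exists>C. \<forall>a\<in>V. norm (T a) \<le> C * N a) \<and>
          (\<exists>C. \<forall>a\<in>V. N a \<le> C * norm (T a)))"

definition isomorphic_to_complemented ::
  "('k::{real_normed_field,euclidean_space} \<Rightarrow> 'a::banach \<Rightarrow> 'a) \<Rightarrow>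
   (nat \<Rightarrow> 'k) set \<Rightarrow> ((nat \<Rightarrow> 'k) \<Rightarrow> real) \<Rightarrow> bool" where
  "isomorphic_to_complemented scl V N \<longleftrightarrow>
     (\<exists>Y. complemented_subspace scl Y \<and> seq_space_isomorphic scl V N Y)"


subsection \<open>Bases\<close>

text \<open>
  Sequences are indexed from \<open>0\<close>: \<open>x n\<close> is the vector usually called $x_{n+1}$.
\<close>

definition schauder_basis ::
  "('k::{real_normed_field,euclidean_space} \<Rightarrow> 'a::banach \<Rightarrow> 'a) \<Rightarrow> (nat \<Rightarrow> 'a) \<Rightarrow> bool" where
  "schauder_basis scl x \<longleftrightarrow> (\<forall>f. \<exists>!a. (\<lambda>n. scl (a n) (x n)) sums f)"

definition coord ::
  "('k::{real_normed_field,euclidean_space} \<Rightarrow> 'a::banach \<Rightarrow> 'a) \<Rightarrow> (nat \<Rightarrow> 'a) \<Rightarrow> nat \<Rightarrow> 'a \<Rightarrow> 'k"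
  where
  "coord scl x n f = (THE a. (\<lambda>n. scl (a n) (x n)) sums f) n"

definition supp ::
  "('k::{real_normed_field,euclidean_space} \<Rightarrow> 'a::banach \<Rightarrow> 'a) \<Rightarrow> (nat \<Rightarrow> 'a) \<Rightarrow> 'a \<Rightarrow> nat set"
  where
  "supp scl x f = {n. coord scl x n f \<noteq> 0}"

text \<open>
  Below, only applied when \<open>A\<close> is finite or \<open>f\<close> has finite support; then the sum has
  finitely many nonzero terms.
\<close>

definition coord_proj ::
  "('k::{real_normed_field,euclidean_space} \<Rightarrow> 'a::banach \<Rightarrow> 'a) \<Rightarrow> (nat \<Rightarrow> 'a) \<Rightarrow>
   nat set \<Rightarrow> 'a \<Rightarrow> 'a" where
  "coord_proj scl x A f = (\<Sum>\<^sub>\<infinity>n\<in>A. scl (coord scl x n f) (x n))"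

definition almost_greedy ::
  "('k::{real_normed_field,euclidean_space} \<Rightarrow> 'a::banach \<Rightarrow> 'a) \<Rightarrow> (nat \<Rightarrow> 'a) \<Rightarrow> bool" where
  "almost_greedy scl x \<longleftrightarrow>
     (\<exists>C. \<forall>f A B. finite A \<and> finite B \<and> card B \<le> card A \<and>
        (\<forall>j\<in>-A. \<forall>k\<in>A. norm (coord scl x j f) \<le> norm (coord scl x k f)) \<longrightarrow>
        norm (f - coord_proj scl x A f) \<le> C * norm (f - coord_proj scl x B f))"

text \<open>
  The suprema are taken in \<open>ennreal\<close>, where they exist without boundedness
  assumptions and an infinite supremum is genuinely infinite.
\<close>

definition fundamental_function :: "(nat \<Rightarrow> 'a::banach) \<Rightarrow> nat \<Rightarrow> ennreal" where
  "fundamental_function x m =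
     (SUP A\<in>{A. finite A \<and> card A \<le> m}. ennreal (norm (\<Sum>j\<in>A. x j)))"

text \<open>
  Because indices start at \<open>0\<close>, the condition $\max(\mathrm{supp}(f)) \le m$ of the
  one-based convention reads \<open>supp f \<subseteq> {..<m}\<close>.
\<close>

definition conditionality_const ::
  "('k::{real_normed_field,euclidean_space} \<Rightarrow> 'a::banach \<Rightarrow> 'a) \<Rightarrow> (nat \<Rightarrow> 'a) \<Rightarrow> nat \<Rightarrow> ennreal"
  where
  "conditionality_const scl x m =
     (SUP (f, A)\<in>{(f, A). f \<noteq> 0 \<and> supp scl x f \<subseteq> {..<m}}.
        ennreal (norm (coord_proj scl x A f) / norm f))"


subsection \<open>Comparison of families\<close>

text \<open>The constant is a finite real, so a bound by a finite family forces finiteness.\<close>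

definition lesssim_on :: "'i set \<Rightarrow> ('i \<Rightarrow> ennreal) \<Rightarrow> ('i \<Rightarrow> ennreal) \<Rightarrow> bool" where
  "lesssim_on I \<alpha> \<beta> \<longleftrightarrow> (\<exists>C::real. \<forall>i\<in>I. \<alpha> i \<le> ennreal C * \<beta> i)"

definition approx_on :: "'i set \<Rightarrow> ('i \<Rightarrow> ennreal) \<Rightarrow> ('i \<Rightarrow> ennreal) \<Rightarrow> bool" where
  "approx_on I \<alpha> \<beta> \<longleftrightarrow> lesssim_on I \<alpha> \<beta> \<and> lesssim_on I \<beta> \<alpha>"

end

theory Submission
  imports Defs
begin

text \<open>
  This is the method of Dilworth, Kalton and Kutzarova. Splitting off \<open>c\<^sub>0\<close> or \<open>\<ell>\<^sub>1\<close> and using that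
  these spaces are isomorphic to their squares, \<open>X\<close> is isomorphic to \<open>X \<oplus> c\<^sub>0\<close> or \<open>X \<oplus> \<ell>\<^sub>1\<close>, hence has a basis
  \<open>w\<close> that is as conditional as possible: projections of unit vectors in the span of \<open>k\<close> basis elements
  have norms of order \<open>k\<close>. Likewise \<open>X\<close> is isomorphic to \<open>X \<oplus> \<ell>\<^sub>2\<close>. The orthonormal basis of \<open>\<ell>\<^sub>2\<close> is cut
  into groups of length \<open>4\<^sup>n - 1\<close>; together with \<open>w\<^sub>n\<close> the \<open>n\<close>-th group forms a block of length \<open>4\<^sup>n\<close>, and in
  each block one passes to a new basis by a reflection that turns \<open>w\<^sub>n\<close> into the normalized constant
  vector. Thus the coordinates of a vector in a block consist of their average, seen by \<open>w\<^sub>n\<close>, and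
  of the deviation \<open>q\<close> from the average, seen by \<open>\<ell>\<^sub>2\<close>. Because the lengths grow exponentially, the norm
  lies between those of weak \<open>\<ell>\<^sub>2\<close> and of the Lorentz space \<open>\<ell>\<^sub>2\<^sub>,\<^sub>1\<close>, which gives democracy with fundamental
  function of order \<open>m\<^sup>1\<^sup>/\<^sup>2\<close>, and the first \<open>m\<close> elements meet only about \<open>ln m\<close> blocks, which gives
  the conditionality constants.
\<close>

subsection \<open>Operators, functionals and the basis constant\<close>

text \<open>Direct sums are never formed: \<open>split_off\<close> exhibits X as the sum of a copy
  of itself and a sequence space inside X, by moving the coordinates of the complemented copy onto a
  subsequence and using the positions so freed. The obstacle is that the vectors \<open>w n\<close>
  have to be as conditional as possible, so only bounds for the vectors, their coordinates and their
  initial partial sums are available. Their share in a general sum is therefore estimated by the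
  triangle inequality alone, which puts the weight \<open>1 / 2 ^ n\<close> on the coordinates of
  block \<open>n\<close>. Length \<open>4 ^ n\<close> makes \<open>2 ^ n\<close> comparable with the
  square root of the position: over \<open>m\<close> indices the weights sum to order
  \<open>sqrt m\<close>, yet over one block they form a unit vector. For greedy projections this
  alone would lose a factor \<open>ln m\<close>. The loss is avoided by cutting at a block
  determined by the smallest retained coordinate: before it complete blocks are kept and the small
  coordinates are subtracted, after it the block averages are too small to matter.\<close>

context banach_space_over
begin

text \<open>\<open>bounded_linear\<close> knows only real scalars; the second conjunct adds
  linearity over \<open>'k\<close>.\<close>

definition linop :: "('a \<Rightarrow> 'a) \<Rightarrow> bool" where
  "linop F \<longleftrightarrow> bounded_linear F \<and> (\<forall>c f. F (scl c f) = scl c (F f))"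

definition linfun :: "('a \<Rightarrow> 'k) \<Rightarrow> bool" where
  "linfun \<phi> \<longleftrightarrow> bounded_linear \<phi> \<and> (\<forall>c f. \<phi> (scl c f) = c * \<phi> f)"

lemma bounded_linear_scale: "bounded_linear (\<lambda>c. scl c y)"
proof (rule bounded_linear_intro[where K = "norm y"])
  show "scl (r *\<^sub>R c) y = r *\<^sub>R scl c y" for r c
    by (metis scale_of_real scale_scale scaleR_conv_of_real)
qed (simp_all add: scale_left_distrib norm_scale)

lemma scale_scaleR: "scl c (r *\<^sub>R f) = r *\<^sub>R scl c f"
  by (metis scale_of_real scale_left_commute)

lemma bounded_linear_scale_right: "bounded_linear (scl c)"
  by (rule bounded_linear_intro[where K = "norm c"])
    (simp_all add: scale_right_distrib norm_scale scale_scaleR mult.commute)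

lemma linopI:
  assumes "\<And>f g. F (f + g) = F f + F g" "\<And>c f. F (scl c f) = scl c (F f)"
    "\<And>f. norm (F f) \<le> K * norm f"
  shows "linop F"
proof -
  have "F (r *\<^sub>R x) = r *\<^sub>R F x" for r x
    by (metis assms(2) scale_of_real)
  then show ?thesis
    unfolding linop_def using assms
    by (auto intro!: bounded_linear_intro[where K = K] simp: mult.commute)
qed

lemma linfunI:
  assumes "\<And>f g. \<phi> (f + g) = \<phi> f + \<phi> g" "\<And>c f. \<phi> (scl c f) = c * \<phi> f"
    "\<And>f. norm (\<phi> f) \<le> K * norm f"
  shows "linfun \<phi>"
proof -
  have "\<phi> (r *\<^sub>R x) = r *\<^sub>R \<phi> x" for r x
    by (metis assms(2) scale_of_real scaleR_conv_of_real)
  then show ?thesis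
    unfolding linfun_def using assms
    by (auto intro!: bounded_linear_intro[where K = K] simp: mult.commute)
qed

lemma
  assumes "linop F"
  shows linop_add: "F (f + g) = F f + F g"
    and linop_diff: "F (f - g) = F f - F g"
    and linop_scale: "F (scl c f) = scl c (F f)"
    and linop_sum: "F (sum h I) = (\<Sum>i\<in>I. F (h i))"
    and linop_bounded_linear: "bounded_linear F"
proof -
  interpret F: bounded_linear F using assms by (simp add: linop_def)
  show "F (f + g) = F f + F g" "F (f - g) = F f - F g" "F (sum h I) = (\<Sum>i\<in>I. F (h i))"
    "bounded_linear F"
    by (simp_all add: F.add F.diff F.sum F.bounded_linear_axioms)
  show "F (scl c f) = scl c (F f)" using assms by (simp add: linop_def)
qed

lemma
  assumes "linfun \<phi>"
  shows linfun_diff: "\<phi> (f - g) = \<phi> f - \<phi> g"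
    and linfun_scale: "\<phi> (scl c f) = c * \<phi> f"
    and linfun_zero: "\<phi> 0 = 0"
    and linfun_sum: "\<phi> (sum h I) = (\<Sum>i\<in>I. \<phi> (h i))"
    and linfun_bounded_linear: "bounded_linear \<phi>"
proof -
  interpret F: bounded_linear \<phi> using assms by (simp add: linfun_def)
  show "\<phi> (f - g) = \<phi> f - \<phi> g" "\<phi> 0 = 0" "\<phi> (sum h I) = (\<Sum>i\<in>I. \<phi> (h i))"
    "bounded_linear \<phi>"
    by (simp_all add: F.diff F.zero F.sum F.bounded_linear_axioms)
  show "\<phi> (scl c f) = c * \<phi> f" using assms by (simp add: linfun_def)
qed

lemma linop_bound:
  assumes "linop F" obtains K where "K > 0" "\<And>f. norm (F f) \<le> K * norm f"
  using bounded_linear.pos_bounded[OF linop_bounded_linear[OF assms]] by (auto simp: mult.commute)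

lemma linfun_compose: "linfun \<phi> \<Longrightarrow> linop F \<Longrightarrow> linfun (\<lambda>f. \<phi> (F f))"
  by (simp add: linfun_def linop_def bounded_linear_compose)

section \<open>Coordinates of a Schauder basis and the basis constant\<close>

lemma coord_eqI:
  assumes "schauder_basis scl y" "(\<lambda>n. scl (a n) (y n)) sums f"
  shows "coord scl y n f = a n"
proof -
  have "\<exists>!a. (\<lambda>n. scl (a n) (y n)) sums f" using assms(1) by (simp add: schauder_basis_def)
  then have "(THE a. (\<lambda>n. scl (a n) (y n)) sums f) = a" using assms(2)
    by (rule the1_equality[where P = "\<lambda>a. (\<lambda>n. scl (a n) (y n)) sums f"])
  then show ?thesis by (simp add: coord_def)
qed

lemma coord_sums:
  assumes "schauder_basis scl y"
  shows "(\<lambda>n. scl (coord scl y n f) (y n)) sums f"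
proof -
  have "\<exists>!a. (\<lambda>n. scl (a n) (y n)) sums f" using assms by (simp add: schauder_basis_def)
  then have "(\<lambda>n. scl ((THE a. (\<lambda>n. scl (a n) (y n)) sums f) n) (y n)) sums f" by (rule theI')
  then show ?thesis by (simp add: coord_def)
qed

lemma coord_add:
  assumes "schauder_basis scl y"
  shows "coord scl y n (f + g) = coord scl y n f + coord scl y n g"
proof (rule coord_eqI[OF assms])
  show "(\<lambda>n. scl (coord scl y n f + coord scl y n g) (y n)) sums (f + g)"
    using sums_add[OF coord_sums[OF assms, of f] coord_sums[OF assms, of g]]
    by (simp add: scale_left_distrib)
qed

lemma coord_scale:
  assumes "schauder_basis scl y"
  shows "coord scl y n (scl c f) = c * coord scl y n f"
proof (rule coord_eqI[OF assms])
  show "(\<lambda>n. scl (c * coord scl y n f) (y n)) sums (scl c f)"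
    using bounded_linear.sums[OF bounded_linear_scale_right[of c] coord_sums[OF assms, of f]]
    by simp
qed

lemma basis_nonzero:
  assumes "schauder_basis scl y" shows "y n \<noteq> 0"
proof
  assume 0: "y n = 0"
  have "(\<lambda>m. scl (if m = n then 1 else 0) (y m)) sums 0"
  proof -
    have "(\<lambda>m. scl (if m = n then 1 else 0) (y m)) = (\<lambda>m. 0)" using 0 by auto
    then show ?thesis by simp
  qed
  then have "coord scl y n 0 = 1"
    using coord_eqI[OF assms, of "\<lambda>m. if m = n then 1 else 0" 0 n] by simp
  moreover have "(\<lambda>m. scl 0 (y m)) sums 0" by simp
  then have "coord scl y n 0 = 0" using coord_eqI[OF assms, of "\<lambda>m. 0" 0 n] by simp
  ultimately show False by simp
qed

lemma coord_basis:
  assumes "schauder_basis scl y" shows "coord scl y n (y m) = (if n = m then 1 else 0)"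
proof (rule coord_eqI[OF assms])
  have "(\<lambda>n. if n = m then y n else 0) sums (y m)" by (rule sums_single)
  then show "(\<lambda>n. scl (if n = m then 1 else 0) (y n)) sums (y m)"
    by (rule back_subst[where P = "\<lambda>s. s sums (y m)"]) auto
qed

text \<open>Uniqueness comes from continuity: applying \<open>c n\<close> termwise to any expansion
  of \<open>f\<close> leaves only its \<open>n\<close>-th coefficient.\<close>

lemma schauder_basisI:
  assumes "\<And>n. linfun (c n)" "\<And>n m. c n (x m) = (if n = m then 1 else 0)"
    and "\<And>f. (\<lambda>n. scl (c n f) (x n)) sums f"
  shows "schauder_basis scl x" "\<And>n f. coord scl x n f = c n f"
proof -
  show basis: "schauder_basis scl x"
    unfolding schauder_basis_def
  proof (intro allI ex1I)
    fix f show "(\<lambda>n. scl (c n f) (x n)) sums f" by fact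
  next
    fix f a assume a: "(\<lambda>n. scl (a n) (x n)) sums f"
    show "a = (\<lambda>n. c n f)"
    proof
      fix n
      have "(\<lambda>m. c n (scl (a m) (x m))) sums c n f"
        by (rule bounded_linear.sums[OF linfun_bounded_linear[OF assms(1)] a])
      also have "(\<lambda>m. c n (scl (a m) (x m))) = (\<lambda>m. if m = n then a m else 0)"
        by (auto simp: assms(2) linfun_scale[OF assms(1)])
      finally show "a n = c n f" using sums_single[of n a] by (rule sums_unique2[symmetric])
    qed
  qed
  show "coord scl x n f = c n f" for n f
    by (rule coord_eqI[OF basis assms(3)])
qed

text \<open>
  The open mapping argument: the sets on which all partial sums are bounded by \<open>k\<close> cover the
  space, so by Baire one of them is dense in a ball; successive approximation then turns density
  into an exact bound, with uniqueness of the expansion identifying the coefficients.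
\<close>

lemma basis_constant:
  assumes B: "schauder_basis scl y"
  obtains K where "K > 0" "\<And>n f. norm (\<Sum>i<n. scl (coord scl y i f) (y i)) \<le> K * norm f"
proof -
  define c where "c = coord scl y"
  define S where "S n f = (\<Sum>i<n. scl (c i f) (y i))" for n f
  have c_add: "c n (f + g) = c n f + c n g" for n f g by (simp add: c_def coord_add[OF B])
  have c_scale: "c n (scl r f) = r * c n f" for n r f by (simp add: c_def coord_scale[OF B])
  have S_add: "S n (f + g) = S n f + S n g" for n f g
    by (simp add: S_def c_add scale_left_distrib sum.distrib)
  have S_scale: "S n (scl r f) = scl r (S n f)" for n r f
    by (simp add: S_def c_scale scale_sum_right)
  have S_scaleR: "S n (r *\<^sub>R f) = r *\<^sub>R S n f" for n r f
    by (simp add: S_scale flip: scale_of_real)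
  have S_diff: "S n (f - g) = S n f - S n g" for n f g
    using S_add[of n "f - g" g] by simp
  have S_lim: "(\<lambda>n. S n f) \<longlonglongrightarrow> f" for f
    using coord_sums[OF B, of f] by (simp add: S_def c_def sums_def)
  define A where "A k = {f. \<forall>n. norm (S n f) \<le> real k}" for k :: nat
  have cover: "(\<Union>k. A k) = UNIV"
  proof (intro equalityI subset_UNIV subsetI)
    fix f :: 'a
    obtain C where C: "\<And>n. norm (S n f) \<le> C"
      using convergent_imp_Bseq[OF convergentI[OF S_lim]] unfolding Bseq_def by blast
    have "f \<in> A (nat \<lceil>C\<rceil>)"
      unfolding A_def using C order_trans[OF C real_nat_ceiling_ge] by blast
    then show "f \<in> (\<Union>k. A k)" by blast
  qed
  have "\<exists>k. interior (closure (A k)) \<noteq> {}"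
  proof (rule ccontr)
    assume "\<not> ?thesis"
    then have "euclidean interior_of \<Union>(range (\<lambda>k. closure (A k))) = {}"
      by (intro Baire_category_alt disjI1 completely_metrizable_space_euclidean) auto
    moreover have "\<Union>(range (\<lambda>k. closure (A k))) = UNIV"
      using cover closure_subset by blast
    ultimately show False by simp
  qed
  then obtain k z where "z \<in> interior (closure (A k))" by blast
  then obtain e where e: "e > 0" "cball z e \<subseteq> closure (A k)" by (meson mem_interior_cball)
  define C where "C = real k / e"
  have C0: "C \<ge> 0" using e by (simp add: C_def)
  have half: "norm ((1/2::real) *\<^sub>R (a - b)) \<le> (norm a + norm b) / 2" for a b :: 'a
    using norm_triangle_ineq4[of a b] by simp
  have approx: "\<exists>p. (\<forall>n. norm (S n p) \<le> C * norm u) \<and> norm (u - p) \<le> norm u / 2" for u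
  proof (cases "u = 0")
    case True
    have "S n 0 = 0" for n using S_scale[of n 0 0] by simp
    then show ?thesis using True by (intro exI[of _ 0]) auto
  next
    case False
    define v where "v = (e / norm u) *\<^sub>R u"
    have nv: "norm v = e" using False e by (simp add: v_def)
    have "z + v \<in> closure (A k)" "z - v \<in> closure (A k)"
      using e nv by (auto simp: dist_norm)
    then obtain p q where p: "p \<in> A k" "norm (p - (z + v)) < e/2"
      and q: "q \<in> A k" "norm (q - (z - v)) < e/2"
      using e unfolding closure_approachable dist_norm by (meson half_gt_zero)
    \<comment> \<open>Half the difference cancels the centre \<open>z\<close> and approximates
      \<open>v\<close>. Its partial sums are still bounded by \<open>k\<close>, since
      \<open>A k\<close> is convex and symmetric.\<close>
    define w where "w = (1/2::real) *\<^sub>R (p - q)"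
    have "v - w = (1/2::real) *\<^sub>R (((z + v) - p) - ((z - v) - q))"
    proof -
      have "v = (1/2::real) *\<^sub>R (v + v)" by (simp flip: scaleR_2)
      then have "v - w = (1/2::real) *\<^sub>R (v + v) - (1/2::real) *\<^sub>R (p - q)" by (simp add: w_def)
      also have "\<dots> = (1/2::real) *\<^sub>R (((z + v) - p) - ((z - v) - q))"
        by (simp only: flip: scaleR_diff_right) (simp add: algebra_simps)
      finally show ?thesis .
    qed
    also have "norm \<dots> \<le> (norm ((z + v) - p) + norm ((z - v) - q)) / 2"
      by (rule half)
    also have "\<dots> \<le> e / 2" using p q by (simp add: norm_minus_commute)
    finally have vw: "norm (v - w) \<le> e / 2" .
    have Sw: "norm (S n w) \<le> k" for n
    proof -
      have "norm (S n w) \<le> (norm (S n p) + norm (S n q)) / 2"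
        unfolding w_def S_scaleR S_diff by (rule half)
      also have "\<dots> \<le> k"
      proof -
        have "norm (S n p) \<le> k" "norm (S n q) \<le> k" using p(1) q(1) by (auto simp: A_def)
        then show ?thesis by (simp add: field_simps)
      qed
      finally show ?thesis .
    qed
    have u: "u = (norm u / e) *\<^sub>R v" using False e by (simp add: v_def)
    show ?thesis
    proof (intro exI[of _ "(norm u / e) *\<^sub>R w"] conjI allI)
      fix n
      have "norm (S n ((norm u / e) *\<^sub>R w)) = (norm u / e) * norm (S n w)"
        using e by (simp add: S_scaleR)
      also have "\<dots> \<le> (norm u / e) * k" using e by (intro mult_left_mono Sw) auto
      finally show "norm (S n ((norm u / e) *\<^sub>R w)) \<le> C * norm u" by (simp add: C_def mult.commute)
    next
      have "u - (norm u / e) *\<^sub>R w = (norm u / e) *\<^sub>R (v - w)"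
        using u by (metis scaleR_diff_right)
      then have "norm (u - (norm u / e) *\<^sub>R w) = (norm u / e) * norm (v - w)" using e by simp
      also have "\<dots> \<le> (norm u / e) * (e / 2)" using e by (intro mult_left_mono vw) auto
      finally show "norm (u - (norm u / e) *\<^sub>R w) \<le> norm u / 2" using e by simp
    qed
  qed
  then obtain P where P1: "\<And>u n. norm (S n (P u)) \<le> C * norm u"
    and P2: "\<And>u. norm (u - P u) \<le> norm u / 2" by metis
  have main: "norm (S n f) \<le> (2 * C + 1) * norm f" for n f
  proof -
    \<comment> \<open>Successive approximation: \<open>u i\<close> is the remainder after
      \<open>i\<close> approximants, and its norm is at least halved each time.\<close>
    define u where "u = rec_nat f (\<lambda>_ v. v - P v)"
    have u0: "u 0 = f" and uS: "\<And>i. u (Suc i) = u i - P (u i)" by (simp_all add: u_def)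
    have un: "norm (u i) \<le> norm f * (1/2)^i" for i
    proof (induction i)
      case (Suc i)
      have "norm (u (Suc i)) \<le> norm (u i) / 2" using P2 uS by simp
      with Suc show ?case by simp
    qed (simp add: u0)
    define p where "p i = P (u i)" for i
    define M where "M = (\<lambda>i::nat. C * norm f * (1/2)^i)"
    have M: "M sums (2 * C * norm f)"
      using sums_mult[OF geometric_sums[of "1/2::real"], of "C * norm f"]
      by (simp add: M_def algebra_simps)
    have Sp: "norm (S n (p i)) \<le> M i" for n i
      using order_trans[OF P1[of n "u i"] mult_left_mono[OF un C0]] by (simp add: p_def M_def mult.assoc)
    have psum: "(\<Sum>i<m. p i) = f - u m" for m
      by (induction m) (simp_all add: u0 uS p_def)
    have "u \<longlonglongrightarrow> 0"
    proof (rule Lim_null_comparison)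
      show "\<forall>\<^sub>F i in sequentially. norm (u i) \<le> norm f * (1/2)^i" using un by simp
      show "(\<lambda>i. norm f * (1/2)^i) \<longlonglongrightarrow> 0" by (intro tendsto_mult_right_zero LIMSEQ_power_zero) simp
    qed
    then have plim: "(\<lambda>m. \<Sum>i<m. p i) \<longlonglongrightarrow> f"
      unfolding psum by (auto intro: tendsto_eq_intros)
    have summ: "summable (\<lambda>i. S n (p i))" for n
      by (rule summable_comparison_test'[OF sums_summable[OF M], of 0]) (use Sp in auto)
    \<comment> \<open>\<open>S n\<close> is not yet known to be continuous, so \<open>F n\<close>
      cannot simply be identified with \<open>S n f\<close>. The identity follows only once the
      \<open>F n\<close> are recognized as the partial sums of an expansion of
      \<open>f\<close>.\<close>
    define F where "F n = (\<Sum>i. S n (p i))" for n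
    have unif: "uniform_limit UNIV (\<lambda>m n. \<Sum>i<m. S n (p i)) F sequentially"
      unfolding F_def by (rule Weierstrass_m_test[where M = M]) (use Sp sums_summable[OF M] in auto)
    have Flim: "F \<longlonglongrightarrow> f"
    proof (rule swap_uniform_limit'[OF _ plim unif])
      show "\<forall>\<^sub>F m in sequentially. (\<lambda>n. \<Sum>i<m. S n (p i)) \<longlonglongrightarrow> (\<Sum>i<m. p i)"
        by (intro always_eventually allI tendsto_sum S_lim)
    qed auto
    define a where "a j = (\<Sum>i. c j (p i))" for j
    \<comment> \<open>One term of an expansion is the difference of two consecutive partial sums;
      this bounds the coefficients of all \<open>p i\<close> without continuity of
      \<open>c j\<close>.\<close>
    have csum: "summable (\<lambda>i. c j (p i))" for j
    proof (rule summable_comparison_test')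
      show "summable (\<lambda>i. 2 * M i / norm (y j))"
        by (intro summable_divide summable_mult sums_summable[OF M])
      fix i :: nat
      have "scl (c j (p i)) (y j) = S (Suc j) (p i) - S j (p i)" by (simp add: S_def)
      then have "norm (c j (p i)) * norm (y j) \<le> 2 * M i"
        using norm_triangle_ineq4[of "S (Suc j) (p i)" "S j (p i)"] Sp[of "Suc j" i] Sp[of j i]
        by (simp flip: norm_scale)
      then show "norm (c j (p i)) \<le> 2 * M i / norm (y j)"
        using basis_nonzero[OF B, of j] by (simp add: field_simps)
    qed
    have Fa: "F n = (\<Sum>j<n. scl (a j) (y j))" for n
    proof -
      have "F n = (\<Sum>j<n. \<Sum>i. scl (c j (p i)) (y j))"
        unfolding F_def S_def
        by (intro suminf_sum bounded_linear.summable[OF bounded_linear_scale] csum)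
      also have "\<dots> = (\<Sum>j<n. scl (a j) (y j))"
        unfolding a_def by (intro sum.cong refl bounded_linear.suminf[OF bounded_linear_scale, symmetric] csum)
      finally show ?thesis .
    qed
    have "(\<lambda>j. scl (a j) (y j)) sums f" using Flim unfolding sums_def Fa[symmetric] .
    then have "c j f = a j" for j unfolding c_def by (rule coord_eqI[OF B])
    then have "S n f = F n" by (simp add: Fa S_def)
    also have "norm (F n) \<le> (\<Sum>i. M i)"
      unfolding F_def by (rule norm_suminf_le[OF Sp sums_summable[OF M]])
    also have "\<dots> = 2 * C * norm f" using M by (simp add: sums_iff)
    \<comment> \<open>The added 1 makes the constant positive, \<open>C\<close> being known only to
      be nonnegative.\<close>
    also have "\<dots> \<le> (2 * C + 1) * norm f" by (simp add: algebra_simps)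
    finally show ?thesis .
  qed
  show ?thesis
    by (rule that[of "2 * C + 1"]) (use C0 main in \<open>auto simp: S_def c_def\<close>)
qed

end

subsection \<open>Splitting off a complemented sequence space\<close>

definition spread :: "(nat \<Rightarrow> nat) \<Rightarrow> (nat \<Rightarrow> 'k::zero) \<Rightarrow> nat \<Rightarrow> 'k" where
  "spread e a = (\<lambda>j. if j \<in> range e then a (inv e j) else 0)"

definition restr :: "nat set \<Rightarrow> (nat \<Rightarrow> 'k::zero) \<Rightarrow> nat \<Rightarrow> 'k" where
  "restr S a = (\<lambda>j. if j \<in> S then a j else 0)"

definition unit_seq :: "nat \<Rightarrow> nat \<Rightarrow> 'k::zero_neq_one" where
  "unit_seq j = (\<lambda>n. if n = j then 1 else 0)"

lemma spread_apply [simp]: "inj e \<Longrightarrow> spread e a (e n) = a n"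
  by (simp add: spread_def)

lemma spread_outside: "j \<notin> range e \<Longrightarrow> spread e a j = 0"
  by (simp add: spread_def)

lemma spread_comp: "inj e \<Longrightarrow> spread e (a \<circ> e) = restr (range e) a"
  by (auto simp: spread_def restr_def f_inv_into_f)

lemma spread_add: "spread e (\<lambda>n. a n + b n) = (\<lambda>n. spread e a n + spread e b n)"
  for a b :: "nat \<Rightarrow> 'k::monoid_add"
  by (auto simp: spread_def)

lemma spread_scale: "spread e (\<lambda>n. c * a n) = (\<lambda>n. c * spread e a n)"
  for a :: "nat \<Rightarrow> 'k::mult_zero"
  by (auto simp: spread_def)

lemma restr_add: "restr S (\<lambda>n. a n + b n) = (\<lambda>n. restr S a n + restr S b n)"
  for a b :: "nat \<Rightarrow> 'k::monoid_add"
  by (auto simp: restr_def)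

lemma restr_scale: "restr S (\<lambda>n. c * a n) = (\<lambda>n. c * restr S a n)"
  for a :: "nat \<Rightarrow> 'k::mult_zero"
  by (auto simp: restr_def)

text \<open>What the proof uses of c0 and lp: erasing coordinates, spreading along an increasing
  sequence and passing to a subsequence are contractions. This replaces the isomorphism of the space
  with its square.\<close>

definition subsymmetric :: "(nat \<Rightarrow> 'k::real_normed_field) set \<Rightarrow> ((nat \<Rightarrow> 'k) \<Rightarrow> real) \<Rightarrow> bool" where
  "subsymmetric V N \<longleftrightarrow>
     (\<forall>j. unit_seq j \<in> V) \<and>
     (\<forall>a\<in>V. \<forall>b\<in>V. (\<lambda>n. a n + b n) \<in> V) \<and>
     (\<forall>c. \<forall>a\<in>V. (\<lambda>n. c * a n) \<in> V) \<and>
     (\<forall>a\<in>V. 0 \<le> N a) \<and>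
     (\<forall>S. \<forall>a\<in>V. restr S a \<in> V \<and> N (restr S a) \<le> N a) \<and>
     (\<forall>e. strict_mono e \<longrightarrow> (\<forall>a\<in>V. spread e a \<in> V \<and> N (spread e a) \<le> N a)) \<and>
     (\<forall>e. strict_mono e \<longrightarrow> (\<forall>a\<in>V. a \<circ> e \<in> V \<and> N (a \<circ> e) \<le> N a))"

lemma lp_spread:
  assumes "strict_mono e"
  shows "(\<lambda>n. norm (spread e a n) powr p) sums s \<longleftrightarrow> (\<lambda>n. norm (a n) powr p) sums s"
proof -
  have inj: "inj e" using assms by (simp add: strict_mono_imp_inj_on)
  show ?thesis
    using sums_mono_reindex[OF assms, of "\<lambda>n. norm (spread e a n) powr p" s]
    by (auto simp: inj spread_outside)
qed

lemma subsymmetric_lp: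
  assumes p: "p > 0"
  shows "subsymmetric (lp_space p :: (nat \<Rightarrow> 'k::real_normed_field) set) (lp_norm p)"
proof -
  let ?V = "lp_space p :: (nat \<Rightarrow> 'k) set"
  have le: "lp_norm p a \<le> lp_norm p b"
    if "a \<in> ?V" "b \<in> ?V" "\<And>n. norm (a n) \<le> norm (b n)" for a b
    unfolding lp_norm_def using that p
    by (intro powr_mono2 suminf_le suminf_nonneg) (auto simp: lp_space_def intro: powr_mono2)
  have mem: "a \<in> ?V" if "b \<in> ?V" "\<And>n. norm (a n) \<le> norm (b n)" for a b
    using that p unfolding lp_space_def
    by (auto intro!: summable_comparison_test'[of _ 0 "\<lambda>n. norm (a n) powr p"] powr_mono2)
  have unit: "unit_seq j \<in> ?V" for j
  proof -
    have "summable (\<lambda>n. norm (unit_seq j n :: 'k) powr p)"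
      by (rule summable_finite[of "{j}"]) (auto simp: unit_seq_def)
    then show ?thesis by (simp add: lp_space_def)
  qed
  have scale: "(\<lambda>n. c * a n) \<in> ?V" if "a \<in> ?V" for c a
    using summable_mult[of "\<lambda>n. norm (a n) powr p" "norm c powr p"] that
    by (simp add: lp_space_def norm_mult powr_mult)
  have add: "(\<lambda>n. a n + b n) \<in> ?V" if "a \<in> ?V" "b \<in> ?V" for a b
  proof -
    \<comment> \<open>Only membership is at stake, so this crude bound replaces Minkowski's
      inequality and covers every \<open>p > 0\<close>.\<close>
    have le: "norm (norm (a n + b n) powr p) \<le> 2 powr p * (norm (a n) powr p + norm (b n) powr p)" for n
    proof -
      have "norm (a n + b n) powr p \<le> (2 * max (norm (a n)) (norm (b n))) powr p"
        using norm_triangle_ineq[of "a n" "b n"] p by (intro powr_mono2) auto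
      also have "\<dots> = 2 powr p * max (norm (a n)) (norm (b n)) powr p"
        by (simp add: powr_mult)
      also have "max (norm (a n)) (norm (b n)) powr p \<le> norm (a n) powr p + norm (b n) powr p"
        by (auto simp: max_def)
      finally show ?thesis by simp
    qed
    have "summable (\<lambda>n. 2 powr p * (norm (a n) powr p + norm (b n) powr p))"
      using that by (intro summable_mult summable_add) (auto simp: lp_space_def)
    then have "summable (\<lambda>n. norm (a n + b n) powr p)"
      by (rule summable_comparison_test'[of _ 0]) (rule le)
    then show ?thesis by (simp add: lp_space_def)
  qed
  have restr: "restr S a \<in> ?V \<and> lp_norm p (restr S a) \<le> lp_norm p a" if "a \<in> ?V" for S a
    using mem[OF that, of "restr S a"] le[OF _ that, of "restr S a"] by (auto simp: restr_def)
  have spread: "spread e a \<in> ?V \<and> lp_norm p (spread e a) = lp_norm p a"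
    if "strict_mono e" "a \<in> ?V" for e a
  proof -
    have "(\<lambda>n. norm (a n) powr p) sums (\<Sum>n. norm (a n) powr p)"
      using that by (auto simp: lp_space_def)
    then have "(\<lambda>n. norm (spread e a n) powr p) sums (\<Sum>n. norm (a n) powr p)"
      by (simp add: lp_spread[OF that(1)])
    then show ?thesis by (auto simp: lp_space_def lp_norm_def sums_iff)
  qed
  have comp: "a \<circ> e \<in> ?V \<and> lp_norm p (a \<circ> e) \<le> lp_norm p a"
    if e: "strict_mono e" and a: "a \<in> ?V" for e a
  proof -
    \<comment> \<open>Spreading the subsequence out again gives a restriction of \<open>a\<close>,
      so summability and norm are controlled by the facts on \<open>spread\<close> and
      \<open>restr\<close>.\<close>
    have sp: "spread e (a \<circ> e) = restr (range e) a"
      using e by (simp add: spread_comp strict_mono_imp_inj_on)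
    have "summable (\<lambda>n. norm (spread e (a \<circ> e) n) powr p)"
      using restr[OF a, of "range e"] unfolding sp by (simp add: lp_space_def)
    then have ae: "a \<circ> e \<in> ?V"
      unfolding summable_def lp_spread[OF e] by (simp add: lp_space_def summable_def)
    moreover have "lp_norm p (a \<circ> e) = lp_norm p (spread e (a \<circ> e))" using spread[OF e ae] by simp
    ultimately show ?thesis using restr[OF a, of "range e"] unfolding sp by simp
  qed
  show ?thesis
    unfolding subsymmetric_def
    by (intro conjI allI ballI impI unit scale add restr[THEN conjunct1] restr[THEN conjunct2] comp[THEN conjunct1]
      comp[THEN conjunct2])
      (simp_all add: spread, simp add: lp_norm_def)
qed

lemma c0_bdd: "a \<in> c0_space \<Longrightarrow> bdd_above (range (\<lambda>n. norm (a n)))"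
  for a :: "nat \<Rightarrow> 'k::real_normed_field"
proof -
  assume "a \<in> c0_space"
  then have "Bseq a" using convergent_imp_Bseq[OF convergentI, of a 0] by (simp add: c0_space_def)
  then obtain K where "\<And>n. norm (a n) \<le> K" unfolding Bseq_def by blast
  then show "bdd_above (range (\<lambda>n. norm (a n)))" by (rule bdd_aboveI2)
qed

lemma norm_le_sup_norm: "a \<in> c0_space \<Longrightarrow> norm (a n) \<le> sup_norm a"
  for a :: "nat \<Rightarrow> 'k::real_normed_field"
  unfolding sup_norm_def by (intro cSUP_upper c0_bdd) auto

lemma sup_norm_le: "(\<And>n. norm (a n) \<le> M) \<Longrightarrow> sup_norm a \<le> M"
  unfolding sup_norm_def by (intro cSUP_least) auto

lemma subsymmetric_c0:
  "subsymmetric (c0_space :: (nat \<Rightarrow> 'k::real_normed_field) set) sup_norm"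
proof -
  let ?V = "c0_space :: (nat \<Rightarrow> 'k) set"
  have unit: "unit_seq j \<in> ?V" for j
    unfolding c0_space_def mem_Collect_eq unit_seq_def
    by (rule tendsto_eventually) (auto intro: eventually_sequentiallyI[of "Suc j"])
  have nonneg: "0 \<le> sup_norm a" if "a \<in> ?V" for a
    using order_trans[OF norm_ge_zero norm_le_sup_norm[OF that, of 0]] .
  have restr: "restr S a \<in> ?V \<and> sup_norm (restr S a) \<le> sup_norm a" if a: "a \<in> ?V" for S a
  proof
    show "restr S a \<in> ?V"
      using a unfolding c0_space_def mem_Collect_eq
      by (rule Lim_null_comparison[rotated, OF tendsto_norm_zero]) (auto simp: restr_def)
    show "sup_norm (restr S a) \<le> sup_norm a"
      using norm_le_sup_norm[OF a] nonneg[OF a] by (intro sup_norm_le) (auto simp: restr_def)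
  qed
  have spread: "spread e a \<in> ?V \<and> sup_norm (spread e a) \<le> sup_norm a"
    if e: "strict_mono e" and a: "a \<in> ?V" for e a
  proof
    have inj: "inj e" using e by (simp add: strict_mono_imp_inj_on)
    show "spread e a \<in> ?V"
      unfolding c0_space_def mem_Collect_eq
    proof (rule LIMSEQ_I)
      fix r :: real assume "r > 0"
      then obtain M where M: "\<And>n. n \<ge> M \<Longrightarrow> norm (a n) < r"
        using a LIMSEQ_D[of a 0 r] unfolding c0_space_def by auto
      have "norm (spread e a j) < r" if "j \<ge> e M" for j
      proof (cases "j \<in> range e")
        case True
        then obtain n where n: "j = e n" by auto
        then have "n \<ge> M" using that e by (simp add: strict_mono_less_eq)
        then show ?thesis using M n by (simp add: inj)
      qed (use \<open>r > 0\<close> in \<open>simp add: spread_outside\<close>)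
      then show "\<exists>no. \<forall>n\<ge>no. norm (spread e a n - 0) < r" by auto
    qed
    show "sup_norm (spread e a) \<le> sup_norm a"
      using norm_le_sup_norm[OF a] nonneg[OF a] by (intro sup_norm_le) (auto simp: spread_def)
  qed
  have comp: "a \<circ> e \<in> ?V \<and> sup_norm (a \<circ> e) \<le> sup_norm a"
    if e: "strict_mono e" and a: "a \<in> ?V" for e a
    using a LIMSEQ_subseq_LIMSEQ[OF _ e, of a 0] norm_le_sup_norm[OF a]
    by (auto simp: c0_space_def intro: sup_norm_le)
  show ?thesis
    unfolding subsymmetric_def
    by (intro conjI allI ballI impI unit nonneg restr[THEN conjunct1] restr[THEN conjunct2]
      comp[THEN conjunct1] comp[THEN conjunct2] spread[THEN conjunct1] spread[THEN conjunct2])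
      (auto simp: c0_space_def intro: tendsto_add_zero tendsto_mult_right_zero)
qed

text \<open>X is the sum of two complemented pieces. The first is a copy of X itself, embedded by
  \<open>U\<close> and recovered by \<open>R\<close>. The second consists of the images under
  \<open>T\<close> of the sequences in \<open>V\<close> that vanish on \<open>range e\<close>, and
  \<open>G\<close> reads off that sequence. The choice of \<open>e\<close> decides which positions
  are free for the new vectors.\<close>

locale split_off = banach_space_over scl
  for scl :: "'k::{real_normed_field,euclidean_space} \<Rightarrow> 'a::banach \<Rightarrow> 'a" +
  fixes V :: "(nat \<Rightarrow> 'k) set" and N :: "(nat \<Rightarrow> 'k) \<Rightarrow> real" and e :: "nat \<Rightarrow> nat"
    and U R :: "'a \<Rightarrow> 'a" and T :: "(nat \<Rightarrow> 'k) \<Rightarrow> 'a" and G :: "'a \<Rightarrow> nat \<Rightarrow> 'k" and C :: real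
  assumes V: "subsymmetric V N"
    and U: "linop U" and R: "linop R" and RU: "R (U f) = f"
    and T_add: "a \<in> V \<Longrightarrow> b \<in> V \<Longrightarrow> T (\<lambda>n. a n + b n) = T a + T b"
    and T_scale: "a \<in> V \<Longrightarrow> T (\<lambda>n. c * a n) = scl c (T a)"
    and C: "C > 0"
    and T_le: "a \<in> V \<Longrightarrow> norm (T a) \<le> C * N a"
    and le_T: "a \<in> V \<Longrightarrow> N a \<le> C * norm (T a)"
    and G_V: "G f \<in> V" and G_le: "N (G f) \<le> C * norm f"
    and G_add: "G (f + g) = (\<lambda>n. G f n + G g n)"
    and G_scale: "G (scl c f) = (\<lambda>n. c * G f n)"
    and decomp: "U (R f) + T (G f) = f"
    and RT: "a \<in> V \<Longrightarrow> (\<And>n. a (e n) = 0) \<Longrightarrow> R (T a) = 0"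
    and GT: "a \<in> V \<Longrightarrow> (\<And>n. a (e n) = 0) \<Longrightarrow> G (T a) = a"
    and G_e: "G f (e n) = 0"
    and GU: "G (U f) = (\<lambda>n. 0)"
begin

lemma
  shows unit_V: "unit_seq j \<in> V"
    and add_V: "a \<in> V \<Longrightarrow> b \<in> V \<Longrightarrow> (\<lambda>n. a n + b n) \<in> V"
    and scale_V: "a \<in> V \<Longrightarrow> (\<lambda>n. c * a n) \<in> V"
    and restr_V: "a \<in> V \<Longrightarrow> restr S a \<in> V"
    and spread_V: "a \<in> V \<Longrightarrow> strict_mono o' \<Longrightarrow> spread o' a \<in> V"
    and comp_V: "a \<in> V \<Longrightarrow> strict_mono o' \<Longrightarrow> a \<circ> o' \<in> V"
    and spread_le: "a \<in> V \<Longrightarrow> strict_mono o' \<Longrightarrow> N (spread o' a) \<le> N a"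
    and comp_le: "a \<in> V \<Longrightarrow> strict_mono o' \<Longrightarrow> N (a \<circ> o') \<le> N a"
  using V unfolding subsymmetric_def by blast+

lemma zero_V: "(\<lambda>n. 0) \<in> V"
  using scale_V[OF unit_V, of 0 0] by simp

lemma T_zero: "T (\<lambda>n. 0) = 0"
  using T_scale[OF unit_V, of 0 0] by simp

lemma sum_V: "finite I \<Longrightarrow> (\<And>i. i \<in> I \<Longrightarrow> a i \<in> V) \<Longrightarrow> (\<lambda>n. \<Sum>i\<in>I. a i n) \<in> V"
  by (induction I rule: finite_induct) (auto intro: add_V zero_V)

lemma T_sum:
  "finite I \<Longrightarrow> (\<And>i. i \<in> I \<Longrightarrow> a i \<in> V) \<Longrightarrow> T (\<lambda>n. \<Sum>i\<in>I. a i n) = (\<Sum>i\<in>I. T (a i))"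
  by (induction I rule: finite_induct) (auto simp: T_zero T_add sum_V)

lemma T_lincomb:
  assumes "finite I" "\<And>i. i \<in> I \<Longrightarrow> a i \<in> V"
  shows "T (\<lambda>n. \<Sum>i\<in>I. c i * a i n) = (\<Sum>i\<in>I. scl (c i) (T (a i)))"
  using T_sum[OF assms(1), of "\<lambda>i n. c i * a i n"] assms by (simp add: scale_V T_scale)

lemma T_diff: "a \<in> V \<Longrightarrow> b \<in> V \<Longrightarrow> T (\<lambda>n. a n - b n) = T a - T b"
  using T_add[of a "\<lambda>n. (-1) * b n"] T_scale[of b "-1"] scale_V[of b "-1"] by simp

lemma T_restr:
  assumes "finite F"
  shows "T (restr F a) = (\<Sum>j\<in>F. scl (a j) (T (unit_seq j)))"
proof -
  have "restr F a = (\<lambda>n. \<Sum>j\<in>F. a j * unit_seq j n)"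
    using assms by (simp add: restr_def unit_seq_def if_distrib cong: if_cong)
  then show ?thesis using T_lincomb[OF assms, of unit_seq a] unit_V by simp
qed

end

text \<open>Nothing happens on the kernel of the projection. On the complemented copy of
  \<open>V\<close>, \<open>U\<close> moves the coordinates along \<open>e\<close>, which frees the
  positions outside \<open>range e\<close>; \<open>R\<close> pulls them back and \<open>G\<close>
  reads the freed positions.\<close>

lemma (in banach_space_over) complemented_split_off:
  assumes iso: "isomorphic_to_complemented scl V N" and V: "subsymmetric V N" and e: "strict_mono e"
  obtains U R T G C where "split_off scl V N e U R T G C"
proof -
  have inj: "inj e" using e by (simp add: strict_mono_imp_inj_on)
  have sc: "(\<lambda>n. c * a n) \<in> V" and ad: "b \<in> V \<Longrightarrow> (\<lambda>n. a n + b n) \<in> V" and re: "restr S a \<in> V"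
    and sp: "spread e a \<in> V" and co: "a \<circ> e \<in> V" and reN: "N (restr S a) \<le> N a"
    and spN: "N (spread e a) \<le> N a" and coN: "N (a \<circ> e) \<le> N a" and N0: "0 \<le> N a"
    if "a \<in> V" for a b c S
    using V that e unfolding subsymmetric_def by blast+
  obtain P T where P: "linop P" and PP: "\<And>f. P (P f) = P f"
    and bij: "bij_betw T V (range P)"
    and Tadd: "\<And>a b. a \<in> V \<Longrightarrow> b \<in> V \<Longrightarrow> T (\<lambda>n. a n + b n) = T a + T b"
    and Tsc: "\<And>c a. a \<in> V \<Longrightarrow> T (\<lambda>n. c * a n) = scl c (T a)"
    and C12: "\<exists>C. \<forall>a\<in>V. norm (T a) \<le> C * N a" "\<exists>C. \<forall>a\<in>V. N a \<le> C * norm (T a)"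
    using iso unfolding isomorphic_to_complemented_def complemented_subspace_def
      seq_space_isomorphic_def linop_def by blast
  obtain C1 C2 where C1: "\<And>a. a \<in> V \<Longrightarrow> norm (T a) \<le> C1 * N a"
    and C2: "\<And>a. a \<in> V \<Longrightarrow> N a \<le> C2 * norm (T a)" using C12 by blast
  obtain K where K: "K > 0" "\<And>f. norm (P f) \<le> K * norm f" using linop_bound[OF P] by metis
  define M where "M = max 1 (max C1 C2)"
  have CM: "C1 \<le> M" "C2 \<le> M" by (auto simp: M_def)
  have M: "M \<ge> 1" "norm (T a) \<le> M * N a" "N a \<le> M * norm (T a)" if "a \<in> V" for a
    using order_trans[OF C1[OF that] mult_right_mono[OF CM(1) N0[OF that]]]
      order_trans[OF C2[OF that] mult_right_mono[OF CM(2) norm_ge_zero]]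
    by (auto simp: M_def)
  have M1: "M \<ge> 1" by (simp add: M_def)
  define I where "I f = inv_into V T (P f)" for f
  have I_V: "I f \<in> V" and TI: "T (I f) = P f" for f
  proof -
    have "P f \<in> T ` V" using bij by (simp add: bij_betw_def)
    then show "I f \<in> V" "T (I f) = P f" unfolding I_def by (rule inv_into_into, rule f_inv_into_f)
  qed
  have inj_T: "a = b" if "T a = T b" "a \<in> V" "b \<in> V" for a b
    using bij that unfolding bij_betw_def inj_on_def by blast
  have PT: "P (T a) = T a" if "a \<in> V" for a
    using bij_betwE[OF bij] that PP by auto
  have IT: "I (T a) = a" if "a \<in> V" for a
    by (rule inj_T) (use that in \<open>simp_all add: I_V TI PT\<close>)
  have I_add: "I (f + g) = (\<lambda>n. I f n + I g n)" for f g
    by (rule inj_T) (simp_all add: I_V TI ad Tadd linop_add[OF P])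
  have I_sc: "I (scl c f) = (\<lambda>n. c * I f n)" for c f
    by (rule inj_T) (simp_all add: I_V TI sc Tsc linop_scale[OF P])
  have NI: "N (I f) \<le> M * K * norm f" for f
  proof -
    have "N (I f) \<le> M * norm (P f)" using M(3)[OF I_V, of f] by (simp add: TI)
    also have "\<dots> \<le> M * (K * norm f)" using M1 K by (intro mult_left_mono) auto
    finally show ?thesis by simp
  qed
  have IP: "I (P f) = I f" for f by (simp add: I_def PP)
  define U where "U f = f - P f + T (spread e (I f))" for f
  define R where "R f = f - P f + T (I f \<circ> e)" for f
  define G where "G f = restr (- range e) (I f)" for f
  have T0: "T (\<lambda>n. 0) = 0" using Tsc[OF I_V, of 0 0] by simp
  have norm_id_P: "norm (f - P f) \<le> (1 + K) * norm f" for f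
    using norm_triangle_ineq4[of f "P f"] K(2)[of f] by (simp add: algebra_simps)
  have bound: "norm (f - P f + T a) \<le> (1 + K + M * (M * K)) * norm f"
    if "a \<in> V" "N a \<le> N (I f)" for a f
  proof -
    have "norm (T a) \<le> M * N (I f)"
      using M(2)[OF that(1)] mult_left_mono[OF that(2), of M] M1 by linarith
    also have "\<dots> \<le> M * (M * K * norm f)" using M1 NI by (intro mult_left_mono) auto
    finally show ?thesis
      using norm_triangle_ineq[of "f - P f" "T a"] norm_id_P[of f] by (simp add: algebra_simps)
  qed
  have P_diff0: "P (f - P f) = 0" for f by (simp add: linop_diff[OF P] PP)
  have PU: "P (U f) = T (spread e (I f))" for f
    unfolding U_def by (simp add: linop_add[OF P] P_diff0 PT sp I_V)
  have IU: "I (U f) = spread e (I f)" for f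
    using IP[of "U f"] by (simp add: PU IT sp I_V)
  have PR: "P (R f) = T (I f \<circ> e)" for f
    unfolding R_def by (simp add: linop_add[OF P] P_diff0 PT co I_V)
  have IR: "I (R f) = I f \<circ> e" for f
    using IP[of "R f"] by (simp add: PR IT co I_V)
  show ?thesis
  proof (rule that[of U R T G "M * (1 + K)"], unfold_locales)
    show "subsymmetric V N" by fact
    show "linop U"
      by (rule linopI[where K = "1 + K + M * (M * K)"])
        (auto simp: U_def I_add I_sc linop_add[OF P] linop_scale[OF P] spread_add spread_scale
          Tadd Tsc sp I_V scale_right_distrib scale_right_diff_distrib intro!: bound spN)
    show "linop R"
      by (rule linopI[where K = "1 + K + M * (M * K)"])
        (auto simp: R_def I_add I_sc linop_add[OF P] linop_scale[OF P] o_def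
          Tadd Tsc co[unfolded o_def] I_V scale_right_distrib scale_right_diff_distrib
          intro!: bound coN[unfolded o_def])
    show "R (U f) = f" for f
    proof -
      have "spread e (I f) \<circ> e = I f" using inj by auto
      then have "R (U f) = U f - T (spread e (I f)) + P f" by (simp add: R_def PU IU TI)
      then show ?thesis by (simp add: U_def)
    qed
    show "T (\<lambda>n. a n + b n) = T a + T b" if "a \<in> V" "b \<in> V" for a b using Tadd that .
    show "T (\<lambda>n. c * a n) = scl c (T a)" if "a \<in> V" for a c using Tsc that .
    show "0 < M * (1 + K)" using M1 K by simp
    have MK: "M \<le> M * (1 + K)" "M * K \<le> M * (1 + K)" using M1 K by (auto simp: algebra_simps)
    show "norm (T a) \<le> M * (1 + K) * N a" if "a \<in> V" for a
      using M(2)[OF that] mult_right_mono[OF MK(1) N0[OF that]] by linarith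
    show "N a \<le> M * (1 + K) * norm (T a)" if "a \<in> V" for a
      using M(3)[OF that] mult_right_mono[OF MK(1) norm_ge_zero[of "T a"]] by linarith
    show "G f \<in> V" for f by (simp add: G_def re I_V)
    show "N (G f) \<le> M * (1 + K) * norm f" for f
      using reN[OF I_V[of f], of "- range e"] NI[of f] mult_right_mono[OF MK(2) norm_ge_zero[of f]]
      unfolding G_def by linarith
    show "G (f + g) = (\<lambda>n. G f n + G g n)" for f g by (simp add: G_def I_add restr_add)
    show "G (scl c f) = (\<lambda>n. c * G f n)" for c f by (simp add: G_def I_sc restr_scale)
    show "U (R f) + T (G f) = f" for f
    proof -
      have "T (restr (range e) (I f)) + T (G f) = T (I f)"
      proof -
        have "I f = (\<lambda>n. restr (range e) (I f) n + G f n)" by (auto simp: G_def restr_def)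
        then show ?thesis using Tadd[of "restr (range e) (I f)" "G f"] re[OF I_V] by (simp add: G_def)
      qed
      then have "U (R f) + T (G f) = R f - T (I f \<circ> e) + T (I f)"
        by (simp add: U_def PR IR spread_comp[OF inj])
      then show ?thesis by (simp add: R_def TI)
    qed
    show "R (T a) = 0" "G (T a) = a" if "a \<in> V" "\<And>n. a (e n) = 0" for a
    proof -
      have "a \<circ> e = (\<lambda>n. 0)" using that(2) by auto
      then show "R (T a) = 0" by (simp add: R_def PT IT that(1) T0)
      show "G (T a) = a" using that(2) by (auto simp: G_def IT[OF that(1)] restr_def fun_eq_iff)
    qed
    show "G f (e n) = 0" for f n by (simp add: G_def restr_def)
    show "G (U f) = (\<lambda>n. 0)" for f by (auto simp: G_def IU restr_def spread_outside)
  qed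
qed

subsection \<open>Conditional bases of the spaces c0 and l1\<close>

text \<open>\<open>V\<close> is not a type, so \<open>schauder_basis\<close> does not apply to it
  and the coordinate functionals \<open>c\<close> are carried along. The last clause demands
  projections of norm of order \<open>k\<close> on the span of \<open>k\<close> vectors; given the
  bounds on \<open>d\<close> and \<open>c\<close>, no faster growth is possible in a normed
  \<open>V\<close>.\<close>

definition conditional_seq_basis ::
  "(nat \<Rightarrow> 'k::real_normed_field) set \<Rightarrow> ((nat \<Rightarrow> 'k) \<Rightarrow> real) \<Rightarrow> (nat \<Rightarrow> nat \<Rightarrow> 'k) \<Rightarrow>
   (nat \<Rightarrow> (nat \<Rightarrow> 'k) \<Rightarrow> 'k) \<Rightarrow> bool" where
  "conditional_seq_basis V N d c \<longleftrightarrow>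
     (\<forall>n. d n \<in> V \<and> N (d n) \<le> 2) \<and>
     (\<forall>n. \<forall>a\<in>V. \<forall>b\<in>V. c n (\<lambda>j. a j + b j) = c n a + c n b) \<and>
     (\<forall>n r. \<forall>a\<in>V. c n (\<lambda>j. r * a j) = r * c n a) \<and>
     (\<forall>n. \<forall>a\<in>V. norm (c n a) \<le> 2 * N a) \<and>
     (\<forall>n m. c n (d m) = (if n = m then 1 else 0)) \<and>
     (\<forall>a\<in>V. (\<lambda>k. N (\<lambda>j. a j - (\<Sum>n<k. c n a * d n j))) \<longlonglongrightarrow> 0) \<and>
     (\<forall>k. \<exists>b E. N (\<lambda>j. \<Sum>n<k. b n * d n j) \<le> 1 \<and>
        real k / 2 \<le> N (\<lambda>j. \<Sum>n\<in>{..<k} \<inter> E. b n * d n j))"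

lemma card_evens: "real k / 2 \<le> real (card ({..<k} \<inter> {n. even n}))"
proof -
  have "card ({..<k} \<inter> {n. even n}) = (k + 1) div 2"
  proof (induction k)
    case (Suc k)
    have "{..<Suc k} \<inter> {n. even n} =
      (if even k then insert k ({..<k} \<inter> {n. even n}) else {..<k} \<inter> {n. even n})"
      by (auto simp: less_Suc_eq)
    then show ?case using Suc by auto
  qed simp
  then show ?thesis by simp
qed

text \<open>This is the summing basis. With alternating signs every coordinate of the sum is a
  cancelling tail, of modulus at most 1; if only the even indices are kept, coordinate 0 counts
  them.\<close>

lemma c0_summing_basis:
  "conditional_seq_basis (c0_space :: (nat \<Rightarrow> 'k::real_normed_field) set) sup_norm
     (\<lambda>n j. if j \<le> n then 1 else 0) (\<lambda>n a. a n - a (Suc n))"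
proof -
  let ?V = "c0_space :: (nat \<Rightarrow> 'k) set"
  define d :: "nat \<Rightarrow> nat \<Rightarrow> 'k" where "d = (\<lambda>n j. if j \<le> n then 1 else 0)"
  have fin: "a \<in> ?V" if "\<And>j. j \<ge> n \<Longrightarrow> a j = 0" for a n
    unfolding c0_space_def mem_Collect_eq
    by (rule tendsto_eventually) (use that in \<open>auto simp: eventually_sequentially\<close>)
  have d_V: "d n \<in> ?V" for n by (rule fin[of "Suc n"]) (auto simp: d_def)
  have d_le: "sup_norm (d n) \<le> 2" for n by (rule sup_norm_le) (auto simp: d_def)
  \<comment> \<open>The sum telescopes: the approximation error is the constant \<open>a k\<close>
    below \<open>k\<close> and equals \<open>a\<close> from \<open>k\<close> on.\<close>
  have sums: "(\<Sum>n<k. (a n - a (Suc n)) * d n j) = (if j < k then a j - a k else 0)" for a :: "nat \<Rightarrow> 'k" and j k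
    by (induction k) (auto simp: d_def less_Suc_eq)
  have conv: "(\<lambda>k. sup_norm (\<lambda>j. a j - (\<Sum>n<k. (a n - a (Suc n)) * d n j))) \<longlonglongrightarrow> 0" if a: "a \<in> ?V" for a
  proof (rule LIMSEQ_I)
    fix r :: real assume r: "r > 0"
    then obtain M where M: "\<And>n. n \<ge> M \<Longrightarrow> norm (a n) < r / 2"
      using a LIMSEQ_D[of a 0 "r/2"] unfolding c0_space_def by auto
    have "norm (sup_norm (\<lambda>j. a j - (\<Sum>n<k. (a n - a (Suc n)) * d n j)) - 0) < r" if "k \<ge> M" for k
    proof -
      let ?x = "\<lambda>j. a j - (\<Sum>n<k. (a n - a (Suc n)) * d n j)"
      have le: "norm (?x j) \<le> r / 2" for j
        using M[of k] M[of j] that by (auto simp: sums)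
      have "bdd_above (range (\<lambda>j. norm (?x j)))" using le by (rule bdd_aboveI2)
      then have "norm (?x 0) \<le> sup_norm ?x"
        unfolding sup_norm_def by (rule cSUP_upper[OF UNIV_I])
      then have "0 \<le> sup_norm ?x" using norm_ge_zero order_trans by blast
      moreover have "sup_norm ?x \<le> r / 2" by (rule sup_norm_le) (rule le)
      ultimately show ?thesis using r by simp
    qed
    then show "\<exists>no. \<forall>k\<ge>no. norm (sup_norm (\<lambda>j. a j - (\<Sum>n<k. (a n - a (Suc n)) * d n j)) - 0) < r"
      by blast
  qed
  have cond: "\<exists>b E. sup_norm (\<lambda>j. \<Sum>n<k. b n * d n j) \<le> 1 \<and>
        real k / 2 \<le> sup_norm (\<lambda>j. \<Sum>n\<in>{..<k} \<inter> E. b n * d n j)" for k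
  proof (intro exI conjI)
    let ?b = "\<lambda>n. (-1::'k) ^ n"
    have "(\<Sum>n<k. ?b n * d n j) =
      (if j < k \<and> odd (k - j) then (-1) ^ j else 0)" for j
    proof (induction k)
      case (Suc k)
      show ?case
      proof (cases "j \<le> k")
        case True
        then obtain i where i: "k = j + i" using le_Suc_ex by blast
        show ?thesis using Suc by (cases "even i") (auto simp: i d_def power_add Suc_diff_le odd_pos)
      next
        case False
        then show ?thesis using Suc by (auto simp: d_def)
      qed
    qed simp
    then show "sup_norm (\<lambda>j. \<Sum>n<k. ?b n * d n j) \<le> 1"
      by (intro sup_norm_le) (simp add: norm_power)
    let ?x = "\<lambda>j. \<Sum>n\<in>{..<k} \<inter> {n. even n}. ?b n * d n j"
    have "?x \<in> ?V" by (rule fin[of k]) (auto simp: d_def intro!: sum.neutral)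
    then have "norm (?x 0) \<le> sup_norm ?x" by (rule norm_le_sup_norm)
    moreover have "?x 0 = (\<Sum>n\<in>{..<k} \<inter> {n. even n}. 1)"
      by (rule sum.cong) (auto simp: d_def)
    ultimately show "real k / 2 \<le> sup_norm ?x" using card_evens[of k] by simp
  qed
  have bd: "norm (a n - a (Suc n)) \<le> 2 * sup_norm a" if "a \<in> ?V" for a n
    using norm_triangle_ineq4[of "a n" "a (Suc n)"] norm_le_sup_norm[OF that, of n]
      norm_le_sup_norm[OF that, of "Suc n"] by linarith
  show ?thesis
    unfolding conditional_seq_basis_def d_def[symmetric]
    by (intro conjI allI ballI d_V d_le bd conv cond) (auto simp: algebra_simps d_def)
qed

text \<open>These are the successive differences of the unit vectors, with tail sums as coordinate
  functionals. The first \<open>k\<close> of them telescope to a single unit vector, whereas those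
  with even index have disjoint supports.\<close>

lemma l1_difference_basis:
  "conditional_seq_basis (lp_space 1 :: (nat \<Rightarrow> 'k::{real_normed_field,banach}) set) (lp_norm 1)
     (\<lambda>n j. (if j = n then 1 else 0) - (if Suc j = n then 1 else 0)) (\<lambda>n a. \<Sum>j. a (j + n))"
proof -
  let ?V = "lp_space 1 :: (nat \<Rightarrow> 'k) set"
  define d :: "nat \<Rightarrow> nat \<Rightarrow> 'k" where
    "d = (\<lambda>n j. (if j = n then 1 else 0) - (if Suc j = n then 1 else 0))"
  define t where "t = (\<lambda>n (a::nat \<Rightarrow> 'k). \<Sum>j. a (j + n))"
  have V: "a \<in> ?V \<longleftrightarrow> summable (\<lambda>n. norm (a n))" for a by (simp add: lp_space_def)
  have N: "lp_norm 1 a = (\<Sum>n. norm (a n))" if "a \<in> ?V" for a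
    using that by (simp add: lp_norm_def V suminf_nonneg)
  have shift: "summable (\<lambda>j. norm (a (j + n)))" "summable (\<lambda>j. a (j + n))" if "a \<in> ?V" for a n
  proof -
    show *: "summable (\<lambda>j. norm (a (j + n)))"
      using that summable_iff_shift[of "\<lambda>j. norm (a j)" n] by (simp add: V)
    show "summable (\<lambda>j. a (j + n))" using * by (rule summable_norm_cancel)
  qed
  have t_le: "norm (t n a) \<le> (\<Sum>j. norm (a (j + n)))" if "a \<in> ?V" for a n
    unfolding t_def by (rule summable_norm) (rule shift[OF that])
  have tail_le: "(\<Sum>j. norm (a (j + n))) \<le> lp_norm 1 a" if "a \<in> ?V" for a n
    using suminf_split_initial_segment[of "\<lambda>j. norm (a j)" n] that N[OF that]
    by (simp add: V sum_nonneg)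
  have t_Suc: "t n a = a n + t (Suc n) a" if "a \<in> ?V" for a n
    unfolding t_def using suminf_split_head[OF shift(2)[OF that, of n]] by simp
  have fin: "a \<in> ?V" "lp_norm 1 a = (\<Sum>j<n. norm (a j))" if "\<And>j. j \<ge> n \<Longrightarrow> a j = 0" for a n
  proof -
    have "(\<lambda>j. norm (a j)) sums (\<Sum>j<n. norm (a j))"
      by (rule sums_finite) (use that in auto)
    then show "a \<in> ?V" "lp_norm 1 a = (\<Sum>j<n. norm (a j))"
      using N[of a] by (auto simp: V sums_iff)
  qed
  have d_V: "d n \<in> ?V" for n by (rule fin[of "Suc n"]) (auto simp: d_def)
  have d_le: "lp_norm 1 (d n) \<le> 2" for n
  proof -
    have "lp_norm 1 (d n) = (\<Sum>j<Suc n. norm (d n j))" by (rule fin(2)) (auto simp: d_def)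
    also have "\<dots> = norm (d n n) + (\<Sum>j<n. norm (d n j))" by simp
    also have "(\<Sum>j<n. norm (d n j)) = (\<Sum>j<n. if Suc j = n then 1 else 0)"
      by (rule sum.cong) (auto simp: d_def)
    also have "\<dots> \<le> (1::real)" by (cases n) auto
    finally show ?thesis by (simp add: d_def)
  qed
  have biorth: "t n (d m) = (if n = m then 1 else 0)" for n m
  proof -
    have "t n (d m) = (\<Sum>j<Suc m. d m (j + n))"
      unfolding t_def by (rule suminf_finite) (auto simp: d_def)
    also have "\<dots> = (\<Sum>j<Suc m. if j + n = m then 1 else 0) - (\<Sum>j<Suc m. if Suc (j + n) = m then 1 else 0)"
      by (simp only: d_def sum_subtractf)
    also have "(\<Sum>j<Suc m. if j + n = m then 1 else 0::'k) = (if n \<le> m then 1 else 0)"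
    proof (cases "n \<le> m")
      case True
      then have "j + n = m \<longleftrightarrow> j = m - n" for j by auto
      then show ?thesis using True by (simp del: sum.lessThan_Suc add: less_Suc_eq_le)
    qed auto
    also have "(\<Sum>j<Suc m. if Suc (j + n) = m then 1 else 0::'k) = (if n < m then 1 else 0)"
    proof (cases "n < m")
      case True
      then have "Suc (j + n) = m \<longleftrightarrow> j = m - Suc n" for j by auto
      then show ?thesis using True by (simp del: sum.lessThan_Suc add: less_Suc_eq_le)
    qed auto
    finally show ?thesis by auto
  qed
  \<comment> \<open>The error is the tail of \<open>a\<close> from \<open>k\<close> on, together
    with one entry at \<open>k - 1\<close> that balances the whole tail sum.\<close>
  have diff: "a j - (\<Sum>n<k. t n a * d n j) =
      (if k \<le> j then a j else if Suc j = k then - t k a else 0)" if a: "a \<in> ?V" for a j k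
  proof (induction k)
    case (Suc k)
    have "a j - (\<Sum>n<Suc k. t n a * d n j) =
       (if k \<le> j then a j else if Suc j = k then - t k a else 0) - t k a * d k j"
      using Suc.IH by (simp add: algebra_simps)
    also have "\<dots> = (if Suc k \<le> j then a j else if Suc j = Suc k then - t (Suc k) a else 0)"
      using t_Suc[OF a, of k] by (auto simp: d_def)
    finally show ?case .
  qed simp
  have conv: "(\<lambda>k. lp_norm 1 (\<lambda>j. a j - (\<Sum>n<k. t n a * d n j))) \<longlonglongrightarrow> 0" if a: "a \<in> ?V" for a
  proof (rule Lim_null_comparison)
    have "(\<lambda>k. \<Sum>j. norm (a (j + k))) \<longlonglongrightarrow> 0"
      using suminf_exist_split2[of "\<lambda>j. norm (a j)"] a by (simp add: V)
    then show "(\<lambda>k. 2 * (\<Sum>j. norm (a (j + k)))) \<longlonglongrightarrow> 0" by (rule tendsto_mult_right_zero)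
    show "\<forall>\<^sub>F k in sequentially. norm (lp_norm 1 (\<lambda>j. a j - (\<Sum>n<k. t n a * d n j)))
        \<le> 2 * (\<Sum>j. norm (a (j + k)))"
    proof (rule always_eventually, rule allI)
      fix k
      let ?x = "\<lambda>j. a j - (\<Sum>n<k. t n a * d n j)"
      have tail: "?x (j + k) = a (j + k)" for j using diff[OF a] by simp
      have xs: "summable (\<lambda>j. norm (?x j))"
        using shift(1)[OF a, of k] summable_iff_shift[of "\<lambda>j. norm (?x j)" k] unfolding tail by blast
      have "lp_norm 1 ?x = (\<Sum>j. norm (?x j))" by (rule N) (simp only: V xs)
      also have "\<dots> = (\<Sum>j. norm (a (j + k))) + (\<Sum>j<k. norm (?x j))"
        using suminf_split_initial_segment[OF xs, of k] unfolding tail .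
      also have "(\<Sum>j<k. norm (?x j)) = (\<Sum>j<k. if Suc j = k then norm (t k a) else 0)"
        by (rule sum.cong) (auto simp: diff[OF a])
      also have "\<dots> \<le> norm (t k a)" by (cases k) auto
      also have "\<dots> \<le> (\<Sum>j. norm (a (j + k)))" by (rule t_le[OF a])
      finally have "lp_norm 1 ?x \<le> 2 * (\<Sum>j. norm (a (j + k)))" by simp
      moreover have "0 \<le> lp_norm 1 ?x" by (simp add: lp_norm_def)
      ultimately show "norm (lp_norm 1 ?x) \<le> 2 * (\<Sum>j. norm (a (j + k)))" by simp
    qed
  qed
  have cond: "\<exists>b E. lp_norm 1 (\<lambda>j. \<Sum>n<k. b n * d n j) \<le> 1 \<and>
        real k / 2 \<le> lp_norm 1 (\<lambda>j. \<Sum>n\<in>{..<k} \<inter> E. b n * d n j)" for k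
  proof (intro exI conjI)
    have sum1: "(\<Sum>n<k. d n j) = (if Suc j = k then 1 else 0)" for j
      by (induction k) (auto simp: d_def)
    have "lp_norm 1 (\<lambda>j. if Suc j = k then 1 else 0 :: 'k) =
        (\<Sum>j<k. norm (if Suc j = k then 1 else 0 :: 'k))"
      by (rule fin(2)) auto
    also have "\<dots> = (\<Sum>j<k. if Suc j = k then 1 else 0)" by (rule sum.cong) auto
    also have "\<dots> \<le> 1" by (cases k) auto
    finally show "lp_norm 1 (\<lambda>j. \<Sum>n<k. (\<lambda>_. 1) n * d n j) \<le> 1" by (simp add: sum1)
    let ?x = "\<lambda>j. \<Sum>n\<in>{..<k} \<inter> {n. even n}. (\<lambda>_. 1) n * d n j"
    have x1: "?x j = 1" if "j < k" "even j" for j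
    proof -
      have "?x j = (\<Sum>n\<in>{..<k} \<inter> {n. even n}. if n = j then 1 else 0)"
        using that by (intro sum.cong) (auto simp: d_def)
      also have "\<dots> = 1" using that by simp
      finally show ?thesis .
    qed
    have "lp_norm 1 ?x = (\<Sum>j<k. norm (?x j))"
      by (rule fin(2)) (auto simp: d_def intro!: sum.neutral)
    also have "\<dots> \<ge> (\<Sum>j\<in>{..<k} \<inter> {n. even n}. norm (?x j))"
      by (rule sum_mono2) auto
    also have "(\<Sum>j\<in>{..<k} \<inter> {n. even n}. norm (?x j)) = (\<Sum>j\<in>{..<k} \<inter> {n. even n}. 1)"
      by (rule sum.cong) (use x1 in auto)
    finally show "real k / 2 \<le> lp_norm 1 ?x" using card_evens[of k] by simp
  qed
  have bd: "norm (t n a) \<le> 2 * lp_norm 1 a" if "a \<in> ?V" for a n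
    using t_le[OF that, of n] tail_le[OF that, of n] norm_ge_zero[of "t n a"] by linarith
  have add: "t n (\<lambda>j. a j + b j) = t n a + t n b" if "a \<in> ?V" "b \<in> ?V" for a b n
    unfolding t_def by (rule suminf_add[symmetric]) (rule shift[OF that(1)], rule shift[OF that(2)])
  have scale: "t n (\<lambda>j. r * a j) = r * t n a" if "a \<in> ?V" for a r n
    unfolding t_def by (rule suminf_mult) (rule shift[OF that])
  show ?thesis
    unfolding conditional_seq_basis_def d_def[symmetric] t_def[symmetric]
    by (intro conjI allI ballI d_V d_le bd conv cond add scale biorth)
qed

subsection \<open>A strongly conditional basis of the whole space\<close>

lemma sums_interleave:
  fixes g :: "nat \<Rightarrow> 'a::real_normed_vector"
  assumes "(\<lambda>n. g (2 * n)) sums s" "(\<lambda>n. g (2 * n + 1)) sums t"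
  shows "g sums (s + t)"
proof -
  have "(\<lambda>n. if even n then g n else 0) sums s"
  proof (subst sums_mono_reindex[symmetric])
    show "strict_mono (\<lambda>n::nat. 2 * n)" by (simp add: strict_mono_def)
    show "(if even n then g n else 0) = 0" if "n \<notin> range (\<lambda>n. 2 * n)" for n
      using that by (auto elim: evenE)
  qed (use assms(1) in simp)
  moreover have "(\<lambda>n. if even n then 0 else g n) sums t"
  proof (subst sums_mono_reindex[symmetric])
    show "strict_mono (\<lambda>n::nat. 2 * n + 1)" by (simp add: strict_mono_def)
    show "(if even n then 0 else g n) = 0" if "n \<notin> range (\<lambda>n. 2 * n + 1)" for n
      using that by (auto elim: oddE)
  qed (use assms(2) in simp)
  ultimately have "(\<lambda>n. (if even n then g n else 0) + (if even n then 0 else g n)) sums (s + t)"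
    by (rule sums_add)
  also have "(\<lambda>n. (if even n then g n else 0) + (if even n then 0 else g n)) = g" by auto
  finally show ?thesis .
qed

context banach_space_over
begin

lemma coord_bound:
  assumes "schauder_basis scl y"
  obtains K where "K > 0" "\<And>n f. norm (coord scl y n f) * norm (y n) \<le> K * norm f"
proof -
  obtain K where K: "K > 0" "\<And>n f. norm (\<Sum>i<n. scl (coord scl y i f) (y i)) \<le> K * norm f"
    using basis_constant[OF assms] by metis
  have "norm (coord scl y n f) * norm (y n) \<le> (2 * K) * norm f" for n f
  proof -
    have "scl (coord scl y n f) (y n) =
       (\<Sum>i<Suc n. scl (coord scl y i f) (y i)) - (\<Sum>i<n. scl (coord scl y i f) (y i))" by simp
    then have "norm (scl (coord scl y n f) (y n)) \<le> K * norm f + K * norm f"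
      using norm_triangle_ineq4 K(2)[where n = "Suc n" and f = f] K(2)[where n = n and f = f]
      by (smt (verit))
    then show ?thesis by (simp add: norm_scale algebra_simps)
  qed
  then show ?thesis using K(1) that[of "2 * K"] by simp
qed

text \<open>Continuity is not part of \<open>schauder_basis\<close>; it is inherited from the basis
  constant.\<close>

lemma linfun_coord:
  assumes "schauder_basis scl y" shows "linfun (coord scl y n)"
proof -
  obtain K where K: "K > 0" "\<And>n f. norm (coord scl y n f) * norm (y n) \<le> K * norm f"
    using coord_bound[OF assms] by metis
  show ?thesis
  proof (rule linfunI[where K = "K / norm (y n)"])
    show "norm (coord scl y n f) \<le> K / norm (y n) * norm f" for f
      using K(2)[where n = n and f = f] basis_nonzero[OF assms, of n] by (simp add: field_simps)
  qed (simp_all add: coord_add coord_scale assms)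
qed

lemma normalized_basis:
  assumes "schauder_basis scl y"
  obtains z where "schauder_basis scl z" "\<And>n. norm (z n) = 1"
proof
  let ?r = "\<lambda>n. of_real (norm (y n)) :: 'k"
  let ?z = "\<lambda>n. scl (inverse (?r n)) (y n)"
  have r: "?r n \<noteq> 0" for n using basis_nonzero[OF assms] by simp
  show "schauder_basis scl ?z"
  proof (rule schauder_basisI(1)[where c = "\<lambda>n f. ?r n * coord scl y n f"])
    show "linfun (\<lambda>f. ?r n * coord scl y n f)" for n
      using linfun_compose[OF linfun_coord[OF assms, of n], of "scl (?r n)"]
      by (simp add: linop_def bounded_linear_scale_right coord_scale[OF assms] scale_left_commute)
    show "?r n * coord scl y n (?z m) = (if n = m then 1 else 0)" for n m
      using r by (simp add: coord_scale[OF assms] coord_basis[OF assms])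
    show "(\<lambda>n. scl (?r n * coord scl y n f) (?z n)) sums f" for f
    proof -
      have "scl (?r n * coord scl y n f) (?z n) = scl (coord scl y n f) (y n)" for n
        using r[of n] by (simp add: field_simps)
      then show ?thesis by (simp only: coord_sums[OF assms])
    qed
  qed
  show "norm (?z n) = 1" for n
    using basis_nonzero[OF assms, of n] by (simp add: norm_scale norm_inverse)
qed

definition seminormalized :: "(nat \<Rightarrow> 'a) \<Rightarrow> bool" where
  "seminormalized w \<longleftrightarrow> (\<exists>K>0. \<forall>n. norm (w n) \<le> K \<and> 1 \<le> K * norm (w n))"

definition strongly_conditional :: "(nat \<Rightarrow> 'a) \<Rightarrow> bool" where
  "strongly_conditional w \<longleftrightarrow>
     (\<exists>K>0. \<forall>k. \<exists>b E. norm (\<Sum>n<k. scl (b n) (w n)) \<le> K \<and>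
        real k \<le> K * norm (\<Sum>n\<in>{..<k} \<inter> E. scl (b n) (w n)))"

text \<open>The new basis interleaves the conditional basis of \<open>V\<close>, placed on the freed
  coordinates, with a copy under \<open>U\<close> of an arbitrary normalized basis of X. Half of the
  first \<open>k\<close> vectors are then conditional ones, so the linear growth survives with a
  worse constant.\<close>

lemma strongly_conditional_basis:
  assumes basis: "schauder_basis scl y"
    and iso: "isomorphic_to_complemented scl V N" and sub: "subsymmetric V N"
    and cond: "conditional_seq_basis V N d c"
  obtains w where "schauder_basis scl w" "seminormalized w" "strongly_conditional w"
proof -
  \<comment> \<open>Normalization makes the copies \<open>U (z n)\<close> bounded above and, through
    \<open>R\<close>, bounded away from 0.\<close>
  obtain z where z: "schauder_basis scl z" "\<And>n. norm (z n) = 1"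
    using normalized_basis[OF basis] by metis
  have mono_e: "strict_mono (\<lambda>n::nat. 2 * n)" by (simp add: strict_mono_def)
  obtain U R T G C where "split_off scl V N (\<lambda>n. 2 * n) U R T G C"
    using complemented_split_off[OF iso sub mono_e] by metis
  then interpret split_off scl V N "\<lambda>n. 2 * n" U R T G C .
  \<comment> \<open>\<open>U\<close> occupies the even coordinates, so the conditional basis goes to
    the odd ones.\<close>
  define odds :: "nat \<Rightarrow> nat" where "odds = (\<lambda>n. 2 * n + 1)"
  have so: "strict_mono odds" by (simp add: strict_mono_def odds_def)
  have io: "inj odds" using so by (simp add: strict_mono_imp_inj_on)
  have even_odds: "2 * n \<notin> range odds" for n unfolding odds_def by (auto simp: image_iff) presburger
  have sp_e: "spread odds a (2 * n) = 0" for a :: "nat \<Rightarrow> 'k" and n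
    by (rule spread_outside) (rule even_odds)
  have cd: "d n \<in> V" "N (d n) \<le> 2" "c n (d m) = (if n = m then 1 else 0)" for n m
    using cond unfolding conditional_seq_basis_def by blast+
  have cc: "c n (\<lambda>j. a j + b j) = c n a + c n b" "c n (\<lambda>j. r * a j) = r * c n a" "norm (c n a) \<le> 2 * N a"
    if "a \<in> V" "b \<in> V" for n a b r
    using cond that unfolding conditional_seq_basis_def by blast+
  have cconv: "(\<lambda>k. N (\<lambda>j. a j - (\<Sum>n<k. c n a * d n j))) \<longlonglongrightarrow> 0" if "a \<in> V" for a
    using cond that unfolding conditional_seq_basis_def by blast
  have ccond: "\<exists>b E. N (\<lambda>j. \<Sum>n<k. b n * d n j) \<le> 1 \<and>
        real k / 2 \<le> N (\<lambda>j. \<Sum>n\<in>{..<k} \<inter> E. b n * d n j)" for k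
    using cond unfolding conditional_seq_basis_def by blast
  have N_spread: "N (spread odds a) = N a" if "a \<in> V" for a
  proof (rule antisym)
    show "N (spread odds a) \<le> N a" by (rule spread_le[OF that so])
    have "spread odds a \<circ> odds = a" using io by auto
    then show "N a \<le> N (spread odds a)" using comp_le[OF spread_V[OF that so] so] by simp
  qed
  define dd where "dd n = T (spread odds (d n))" for n
  define gc where "gc n f = c n (G f \<circ> odds)" for n f
  define w where "w n = (if even n then dd (n div 2) else U (z (n div 2)))" for n
  define cw where "cw n f = (if even n then gc (n div 2) f else coord scl z (n div 2) (R f))" for n f
  have spd_V: "spread odds (d n) \<in> V" for n by (rule spread_V[OF cd(1) so])
  have Go_V: "G f \<circ> odds \<in> V" for f by (rule comp_V[OF G_V so])
  have spread_lin: "spread odds (\<lambda>j. \<Sum>n\<in>I. b n * d n j) = (\<lambda>j. \<Sum>n\<in>I. b n * spread odds (d n) j)" for I b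
    by (auto simp: spread_def)
  have lin_V: "(\<lambda>j. \<Sum>n\<in>I. b n * d n j) \<in> V" if "finite I" for I b
    using that by (intro sum_V scale_V cd(1))
  have T_lin: "T (spread odds (\<lambda>j. \<Sum>n\<in>I. b n * d n j)) = (\<Sum>n\<in>I. scl (b n) (dd n))" if "finite I" for I b
    unfolding spread_lin dd_def using T_lincomb[OF that, of "\<lambda>n. spread odds (d n)" b] spd_V by simp
  have gc_lin: "linfun (gc n)" for n
  proof (rule linfunI[where K = "2 * C"])
    show "gc n (f + g) = gc n f + gc n g" for f g
      using cc(1)[OF Go_V[of f] Go_V[of g], of n] by (simp add: gc_def G_add o_def)
    show "gc n (scl r f) = r * gc n f" for r f
      using cc(2)[OF Go_V[of f] Go_V[of f], of n r] by (simp add: gc_def G_scale o_def)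
    show "norm (gc n f) \<le> 2 * C * norm f" for f
      using cc(3)[OF Go_V[of f] Go_V[of f], of n] comp_le[OF G_V[of f] so] G_le[of f]
      unfolding gc_def by linarith
  qed
  have cw_lin: "linfun (cw n)" for n
    by (cases "even n") (simp_all add: cw_def[abs_def] gc_lin linfun_compose[OF linfun_coord[OF z(1)] R])
  have biorth: "cw n (w m) = (if n = m then 1 else 0)" for n m
  proof -
    have 1: "gc i (dd j) = (if i = j then 1 else 0)" for i j
    proof -
      have "spread odds (d j) \<circ> odds = d j" using io by auto
      then show ?thesis
        unfolding gc_def dd_def by (simp add: GT[OF spd_V sp_e] cd)
    qed
    have 2: "gc i (U f) = 0" for i f
      using cc(2)[OF zero_V zero_V, of i 0] by (simp add: gc_def GU o_def)
    have 3: "coord scl z i (R (dd j)) = 0" for i j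
      by (simp add: dd_def RT[OF spd_V sp_e] linfun_zero[OF linfun_coord[OF z(1)]])
    show ?thesis
      unfolding cw_def w_def by (auto simp: 1 2 3 RU coord_basis[OF z(1)] elim!: evenE oddE)
  qed
  have expansion: "(\<lambda>n. scl (cw n f) (w n)) sums f" for f
  proof -
    have "(\<lambda>n. scl (gc n f) (dd n)) sums T (G f)"
      unfolding sums_def
    proof (rule Lim_transform2[OF tendsto_const], rule Lim_null_comparison)
      let ?a = "G f \<circ> odds"
      let ?p = "\<lambda>k j. \<Sum>n<k. c n ?a * d n j"
      have Gf: "G f = spread odds ?a"
      proof
        fix j
        show "G f j = spread odds ?a j"
        proof (cases "even j")
          case True
          then show ?thesis using G_e sp_e by (auto elim!: evenE)
        next
          case False
          then obtain n where "j = odds n" by (auto simp: odds_def elim!: oddE)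
          then show ?thesis using io by simp
        qed
      qed
      have diff: "norm (T (G f) - (\<Sum>n<k. scl (gc n f) (dd n))) \<le> C * N (\<lambda>j. ?a j - ?p k j)" for k
      proof -
        have pV: "?p k \<in> V" by (rule lin_V) simp
        have dV: "(\<lambda>j. ?a j - ?p k j) \<in> V"
          using add_V[OF Go_V[of f] scale_V[OF pV, of "-1"]] by simp
        have "(\<Sum>n<k. scl (gc n f) (dd n)) = T (spread odds (?p k))"
          using T_lin[of "{..<k}" "\<lambda>n. gc n f"] by (simp add: gc_def)
        then have eq: "T (G f) - (\<Sum>n<k. scl (gc n f) (dd n)) =
            T (\<lambda>j. spread odds ?a j - spread odds (?p k) j)"
          using T_diff[OF spread_V[OF Go_V[of f] so] spread_V[OF pV so]] Gf by simp
        have sp: "(\<lambda>j. spread odds ?a j - spread odds (?p k) j) = spread odds (\<lambda>j. ?a j - ?p k j)"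
          by (auto simp: spread_def)
        show ?thesis
          unfolding eq sp N_spread[OF dV, symmetric] by (rule T_le[OF spread_V[OF dV so]])
      qed
      show "\<forall>\<^sub>F k in sequentially. norm (T (G f) - (\<Sum>n<k. scl (gc n f) (dd n))) \<le> C * N (\<lambda>j. ?a j - ?p k j)"
        using diff by simp
      show "(\<lambda>k. C * N (\<lambda>j. ?a j - ?p k j)) \<longlonglongrightarrow> 0"
        by (rule tendsto_mult_right_zero[OF cconv[OF Go_V]])
    qed
    moreover have "(\<lambda>n. scl (coord scl z n (R f)) (U (z n))) sums U (R f)"
      using bounded_linear.sums[OF linop_bounded_linear[OF U] coord_sums[OF z(1), of "R f"]]
      by (simp add: linop_scale[OF U])
    ultimately have "(\<lambda>n. scl (cw n f) (w n)) sums (T (G f) + U (R f))"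
      by (intro sums_interleave) (simp_all add: cw_def w_def)
    then show ?thesis using decomp[of f] by (simp add: add.commute)
  qed
  have w: "schauder_basis scl w" by (rule schauder_basisI(1)[OF cw_lin biorth expansion])
  obtain KU where KU: "KU > 0" "\<And>f. norm (U f) \<le> KU * norm f" using linop_bound[OF U] by metis
  obtain KR where KR: "KR > 0" "\<And>f. norm (R f) \<le> KR * norm f" using linop_bound[OF R] by metis
  have semi: "seminormalized w"
    unfolding seminormalized_def
  proof (intro exI[of _ "KU + KR + 2 * C"] conjI allI)
    fix n
    let ?K = "KU + KR + 2 * C"
    have "norm (dd i) \<le> 2 * C" for i
    proof -
      have "norm (dd i) \<le> C * N (d i)" using T_le[OF spd_V, of i] by (simp add: dd_def N_spread cd)
      also have "\<dots> \<le> C * 2" using C cd(2) by (intro mult_left_mono) auto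
      finally show ?thesis by simp
    qed
    moreover have "norm (U (z i)) \<le> KU" for i using KU(2)[of "z i"] z(2) by simp
    ultimately show "norm (w n) \<le> ?K"
      using KU(1) KR(1) C unfolding w_def by (smt (verit))
    have "1 \<le> 2 * C * norm (dd i)" for i
      using cc(3)[OF cd(1)[of i] cd(1)[of i], of i] le_T[OF spd_V, of i] by (simp add: dd_def N_spread cd)
    moreover have "1 \<le> KR * norm (U (z i))" for i using KR(2)[of "U (z i)"] z(2) by (simp add: RU)
    ultimately have "1 \<le> 2 * C * norm (w n) \<or> 1 \<le> KR * norm (w n)" by (auto simp: w_def)
    moreover have "2 * C * norm (w n) \<le> ?K * norm (w n)" "KR * norm (w n) \<le> ?K * norm (w n)"
      using KU(1) KR(1) C by (intro mult_right_mono; simp)+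
    ultimately show "1 \<le> ?K * norm (w n)" by linarith
  qed (use KU(1) KR(1) C in simp)
  have "strongly_conditional w"
    unfolding strongly_conditional_def
  proof (intro exI[of _ "4 * C"] conjI allI)
    fix k :: nat
    \<comment> \<open>There are \<open>l\<close> even indices below \<open>k\<close>, and
      \<open>l\<close> is at least \<open>k / 2\<close>. Zero coefficients at odd indices reduce
      sums over \<open>w\<close> to sums over \<open>dd\<close>.\<close>
    define l where "l = (k + 1) div 2"
    obtain b E where b: "N (\<lambda>j. \<Sum>n<l. b n * d n j) \<le> 1"
      "real l / 2 \<le> N (\<lambda>j. \<Sum>n\<in>{..<l} \<inter> E. b n * d n j)" using ccond by blast
    define b' where "b' n = (if even n then b (n div 2) else 0)" for n
    have sum_w: "(\<Sum>n\<in>{..<k} \<inter> {n. n div 2 \<in> F}. scl (b' n) (w n)) = (\<Sum>n\<in>{..<l} \<inter> F. scl (b n) (dd n))" for F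
    proof -
      have "(\<Sum>n\<in>{..<l} \<inter> F. scl (b n) (dd n)) = (\<Sum>n\<in>(\<lambda>n. 2 * n) ` ({..<l} \<inter> F). scl (b' n) (w n))"
        by (subst sum.reindex) (auto simp: inj_on_def b'_def w_def)
      also have "\<dots> = (\<Sum>n\<in>{..<k} \<inter> {n. n div 2 \<in> F}. scl (b' n) (w n))"
      proof (rule sum.mono_neutral_left)
        show "(\<lambda>n. 2 * n) ` ({..<l} \<inter> F) \<subseteq> {..<k} \<inter> {n. n div 2 \<in> F}" by (auto simp: l_def)
        show "\<forall>i\<in>{..<k} \<inter> {n. n div 2 \<in> F} - (\<lambda>n. 2 * n) ` ({..<l} \<inter> F). scl (b' i) (w i) = 0"
        proof
          fix i assume i: "i \<in> {..<k} \<inter> {n. n div 2 \<in> F} - (\<lambda>n. 2 * n) ` ({..<l} \<inter> F)"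
          have "odd i"
          proof
            assume "even i"
            then have "i = 2 * (i div 2)" by simp
            moreover have "i div 2 \<in> {..<l} \<inter> F" using i \<open>even i\<close> by (auto simp: l_def)
            ultimately show False using i by blast
          qed
          then show "scl (b' i) (w i) = 0" by (simp add: b'_def)
        qed
      qed simp
      finally show ?thesis by simp
    qed
    show "\<exists>b E. norm (\<Sum>n<k. scl (b n) (w n)) \<le> 4 * C \<and>
        real k \<le> 4 * C * norm (\<Sum>n\<in>{..<k} \<inter> E. scl (b n) (w n))"
    proof (intro exI[of _ b'] exI[of _ "{n. n div 2 \<in> E}"] conjI)
      have "(\<Sum>n<k. scl (b' n) (w n)) = T (spread odds (\<lambda>j. \<Sum>n<l. b n * d n j))"
        using sum_w[of UNIV] T_lin[of "{..<l}" b] by simp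
      also have "norm \<dots> \<le> C * N (\<lambda>j. \<Sum>n<l. b n * d n j)"
        using T_le[OF spread_V[OF lin_V so], of "{..<l}" b] by (simp add: N_spread lin_V)
      also have "\<dots> \<le> C * 1" using C b(1) by (intro mult_left_mono) auto
      finally show "norm (\<Sum>n<k. scl (b' n) (w n)) \<le> 4 * C" using C by simp
      let ?x = "\<lambda>j. \<Sum>n\<in>{..<l} \<inter> E. b n * d n j"
      have xV: "?x \<in> V" by (rule lin_V) simp
      have "real k / 4 \<le> real l / 2" by (simp add: l_def)
      also have "\<dots> \<le> N (spread odds ?x)" using b(2) by (simp add: N_spread xV)
      also have "\<dots> \<le> C * norm (T (spread odds ?x))" by (rule le_T[OF spread_V[OF xV so]])
      also have "T (spread odds ?x) = (\<Sum>n\<in>{..<k} \<inter> {n. n div 2 \<in> E}. scl (b' n) (w n))"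
        using sum_w[of E] T_lin[of "{..<l} \<inter> E" b] by simp
      finally show "real k \<le> 4 * C * norm (\<Sum>n\<in>{..<k} \<inter> {n. n div 2 \<in> E}. scl (b' n) (w n))"
        by simp
    qed
  qed (use C in simp)
  then show ?thesis using that w semi by blast
qed

end

subsection \<open>Exponentially growing blocks and their reflections\<close>

definition block_start :: "nat \<Rightarrow> nat" where
  "block_start n = (\<Sum>k<n. 4 ^ k)"

definition block :: "nat \<Rightarrow> nat set" where
  "block n = {block_start n..<block_start (Suc n)}"

definition block_of :: "nat \<Rightarrow> nat" where
  "block_of j = (LEAST n. j < block_start (Suc n))"

lemma block_start_0 [simp]: "block_start 0 = 0" by (simp add: block_start_def)

lemma block_start_Suc: "block_start (Suc n) = block_start n + 4 ^ n"
  by (simp add: block_start_def)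

lemma three_block_start: "3 * block_start n + 1 = 4 ^ n"
  by (induction n) (simp_all add: block_start_Suc)

lemma block_start_Suc_le: "block_start (Suc n) \<le> 2 * 4 ^ n"
  using three_block_start[of n] by (simp add: block_start_Suc)

lemma strict_mono_block_start: "strict_mono block_start"
  by (rule strict_monoI_Suc) (simp add: block_start_Suc)

lemma block_start_le_iff: "block_start m \<le> block_start n \<longleftrightarrow> m \<le> n"
  by (rule strict_mono_less_eq[OF strict_mono_block_start])

lemma inj_block_start: "block_start m = block_start n \<longleftrightarrow> m = n"
  by (rule strict_mono_eq[OF strict_mono_block_start])

lemma le_block_start: "n \<le> block_start n"
  by (rule strict_mono_imp_increasing[OF strict_mono_block_start])

lemma block_of:
  shows "block_start (block_of j) \<le> j" and "j < block_start (Suc (block_of j))"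
proof -
  have ex: "j < block_start (Suc j)" using le_block_start[of "Suc j"] by simp
  show "j < block_start (Suc (block_of j))" unfolding block_of_def by (rule LeastI[of _ j]) (rule ex)
  show "block_start (block_of j) \<le> j"
  proof (cases "block_of j")
    case (Suc n)
    then have "\<not> j < block_start (Suc n)"
      unfolding block_of_def using not_less_Least[of n "\<lambda>n. j < block_start (Suc n)"] by simp
    then show ?thesis by (simp add: Suc)
  qed simp
qed

lemma block_of_less_iff: "block_of j < k \<longleftrightarrow> j < block_start k"
proof
  assume "block_of j < k"
  then have "block_start (Suc (block_of j)) \<le> block_start k" by (simp add: block_start_le_iff)
  then show "j < block_start k" using block_of(2)[of j] by linarith
next
  assume "j < block_start k"
  then have "block_start (block_of j) < block_start k" using block_of(1)[of j] by linarith
  then show "block_of j < k" using strict_mono_less[OF strict_mono_block_start] by blast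
qed

lemma in_block_iff: "j \<in> block n \<longleftrightarrow> block_of j = n"
  using block_of_less_iff[of j n] block_of_less_iff[of j "Suc n"] by (auto simp: block_def)

lemma block_of_start [simp]: "block_of (block_start n) = n"
  using in_block_iff[of "block_start n" n] by (simp add: block_def block_start_Suc)

lemma card_block: "card (block n) = 4 ^ n"
  by (simp add: block_def block_start_Suc)

lemma lessThan_block_start_Suc: "{..<block_start (Suc k)} = {..<block_start k} \<union> block k"
  "{..<block_start k} \<inter> block k = {}"
  by (auto simp: block_def block_start_Suc)

lemma finite_block [simp]: "finite (block n)" by (simp add: block_def)

lemma block_subset: "n < k \<Longrightarrow> block n \<subseteq> {..<block_start k}"
  by (auto simp: in_block_iff block_of_less_iff)

text \<open>The square root of the length of the block containing \<open>j\<close>, hence comparable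
  with the square root of \<open>j + 1\<close>. Its inverse is the entry of the normalized constant
  vector of that block.\<close>

definition block_root :: "nat \<Rightarrow> real" where
  "block_root j = 2 ^ block_of j"

lemma block_root_pos [simp]: "block_root j > 0" by (simp add: block_root_def)

lemma Suc_le_block_root: "real (Suc j) \<le> 2 * block_root j ^ 2"
proof -
  have "Suc j \<le> 2 * 4 ^ block_of j"
    using block_of(2)[of j] block_start_Suc_le[of "block_of j"] by linarith
  then have "real (Suc j) \<le> real (2 * 4 ^ block_of j)" by (rule of_nat_mono)
  also have "\<dots> = 2 * block_root j ^ 2"
    by (simp add: block_root_def flip: power_mult_distrib power_mult) (simp add: power_mult mult.commute[of _ 2])
  finally show ?thesis .
qed

text \<open>Each term is at most twice the increment of the square root, by the inequality between
  arithmetic and geometric mean.\<close>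

lemma sum_inverse_sqrt: "(\<Sum>j<k. 1 / sqrt (real (Suc j))) \<le> 2 * sqrt (real k)"
proof (induction k)
  case (Suc k)
  let ?a = "sqrt (real k)" and ?b = "sqrt (real (Suc k))"
  have b: "?b > 0" by simp
  have "2 * ?a * ?b \<le> ?a\<^sup>2 + ?b\<^sup>2" by (rule sum_squares_bound)
  also have "\<dots> = 2 * real k + 1" by simp
  also have "\<dots> = 2 * (?b * ?b) - 1" by simp
  also have "2 * (?b * ?b) = (2 * ?b) * ?b" by (simp only: mult.assoc)
  finally have "2 * ?a * ?b + 1 \<le> (2 * ?b) * ?b" by linarith
  moreover have "(2 * ?a + 1 / ?b) * ?b = 2 * ?a * ?b + 1" using b by (simp add: distrib_right)
  ultimately have "(2 * ?a + 1 / ?b) * ?b \<le> (2 * ?b) * ?b" by linarith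
  then have "2 * ?a + 1 / ?b \<le> 2 * ?b" using b by (rule mult_right_le_imp_le)
  then show ?case using Suc by simp
qed simp

text \<open>The weights are dominated by a decreasing sequence, so an initial segment is the worst
  case: indices below \<open>card E\<close> contribute at most its sum, and each other index at most
  \<open>1 / sqrt (card E)\<close>. This gives 2 + 1, doubled when \<open>block_root j\<close> is
  replaced by \<open>sqrt (j + 1)\<close>.\<close>

lemma sum_inverse_block_root:
  assumes "finite E"
  shows "(\<Sum>j\<in>E. 1 / block_root j) \<le> 6 * sqrt (real (card E))"
proof -
  have le: "1 / block_root j \<le> 2 / sqrt (real (Suc j))" for j
  proof -
    have "real (Suc j) \<le> (2 * block_root j)\<^sup>2"
      using Suc_le_block_root[of j] by (simp add: power_mult_distrib)
    then have "sqrt (real (Suc j)) \<le> 2 * block_root j"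
      using less_imp_le[OF block_root_pos[of j]] by (intro real_le_lsqrt) simp_all
    then show ?thesis by (simp add: field_simps)
  qed
  let ?k = "card E"
  have "(\<Sum>j\<in>E. 1 / sqrt (real (Suc j))) =
      (\<Sum>j\<in>E \<inter> {..<?k}. 1 / sqrt (real (Suc j))) + (\<Sum>j\<in>E - {..<?k}. 1 / sqrt (real (Suc j)))"
    using assms by (subst sum.Int_Diff[of _ _ "{..<?k}"]) auto
  also have "(\<Sum>j\<in>E \<inter> {..<?k}. 1 / sqrt (real (Suc j))) \<le> (\<Sum>j<?k. 1 / sqrt (real (Suc j)))"
    by (rule sum_mono2) auto
  also have "\<dots> \<le> 2 * sqrt (real ?k)" by (rule sum_inverse_sqrt)
  also have "(\<Sum>j\<in>E - {..<?k}. 1 / sqrt (real (Suc j))) \<le> (\<Sum>j\<in>E - {..<?k}. 1 / sqrt (real ?k))"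
  proof (rule sum_mono)
    fix j assume j: "j \<in> E - {..<?k}"
    then have "?k > 0" using assms card_gt_0_iff by fastforce
    then show "1 / sqrt (real (Suc j)) \<le> 1 / sqrt (real ?k)"
      using j by (intro divide_left_mono) auto
  qed
  also have "\<dots> \<le> (\<Sum>j\<in>E. 1 / sqrt (real ?k))" by (rule sum_mono2) (use assms in auto)
  also have "\<dots> = sqrt (real ?k)" by (simp add: real_div_sqrt)
  finally have *: "(\<Sum>j\<in>E. 1 / sqrt (real (Suc j))) \<le> 3 * sqrt (real ?k)" by simp
  have "(\<Sum>j\<in>E. 1 / block_root j) \<le> (\<Sum>j\<in>E. 2 * (1 / sqrt (real (Suc j))))"
    by (intro sum_mono) (use le in simp)
  also have "\<dots> = 2 * (\<Sum>j\<in>E. 1 / sqrt (real (Suc j)))" by (simp add: sum_distrib_left)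
  finally show ?thesis using * by simp
qed

lemma exists_block_bound: "\<exists>k. F \<subseteq> {..<block_start k}" if F: "finite F" for F :: "nat set"
proof -
  obtain m where "F \<subseteq> {..<m}" using finite_nat_iff_bounded F by blast
  then show ?thesis using le_block_start[of m] by (intro exI[of _ m]) auto
qed

text \<open>Block \<open>n\<close> has \<open>4 ^ n\<close> elements of weight
  \<open>1 / 2 ^ n\<close>, so over the whole block the weights form a unit vector.\<close>

lemma L2_set_block_root_le:
  assumes "F \<subseteq> block n"
  shows "L2_set (\<lambda>j. c / block_root j) F \<le> \<bar>c\<bar>"
proof -
  have "(\<Sum>j\<in>F. (c / block_root j)\<^sup>2) = (\<Sum>j\<in>F. c\<^sup>2 / 4 ^ n)"
  proof (rule sum.cong[OF refl])
    fix j assume "j \<in> F"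
    then have "block_of j = n" using assms by (auto simp: in_block_iff)
    moreover have "(2 ^ n)\<^sup>2 = (4::real) ^ n" by (simp add: power2_eq_square flip: power_mult_distrib)
    ultimately show "(c / block_root j)\<^sup>2 = c\<^sup>2 / 4 ^ n"
      by (simp add: block_root_def power_divide)
  qed
  also have "\<dots> = real (card F) * (c\<^sup>2 / 4 ^ n)" by simp
  also have "\<dots> \<le> 4 ^ n * (c\<^sup>2 / 4 ^ n)"
  proof (rule mult_right_mono)
    have "card F \<le> 4 ^ n" using card_mono[OF finite_block assms] by (simp add: card_block)
    then have "real (card F) \<le> real (4 ^ n)" by (rule of_nat_mono)
    then show "real (card F) \<le> 4 ^ n" by simp
  qed simp
  finally have "(\<Sum>j\<in>F. (c / block_root j)\<^sup>2) \<le> c\<^sup>2" by simp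
  then show ?thesis unfolding L2_set_def using real_sqrt_le_mono by fastforce
qed

text \<open>Cauchy-Schwarz against that unit vector: inside one block the weighted sum costs no more
  than the Euclidean norm. Losses can therefore come only from the number of blocks.\<close>

lemma sum_block_root_le:
  assumes "F \<subseteq> block n"
  shows "(\<Sum>j\<in>F. norm (a j) / block_root j) \<le> L2_set (\<lambda>j. norm (a j)) F"
proof -
  have "(\<Sum>j\<in>F. norm (a j) / block_root j) = (\<Sum>j\<in>F. \<bar>norm (a j)\<bar> * \<bar>1 / block_root j\<bar>)"
    by (intro sum.cong refl) (simp add: less_imp_le)
  also have "\<dots> \<le> L2_set (\<lambda>j. norm (a j)) F * L2_set (\<lambda>j. 1 / block_root j) F"
    by (rule L2_set_mult_ineq)
  also have "\<dots> \<le> L2_set (\<lambda>j. norm (a j)) F * \<bar>1\<bar>" by (intro mult_left_mono L2_set_block_root_le[OF assms] L2_set_nonneg)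
  finally show "(\<Sum>j\<in>F. norm (a j) / block_root j) \<le> L2_set (\<lambda>j. norm (a j)) F" by simp
qed

lemma L2_mono_set: "finite B \<Longrightarrow> A \<subseteq> B \<Longrightarrow> L2_set h A \<le> L2_set h B"
  unfolding L2_set_def by (intro real_sqrt_le_mono sum_mono2) auto

text \<open>From \<open>4 ^ b <= 3 * m <= m ^ 3\<close> and \<open>ln 4 >= 1\<close> one gets
  \<open>b <= 3 * ln m\<close>; the successor is absorbed by \<open>1 <= 2 * ln m\<close>.\<close>

lemma block_of_le_ln:
  assumes "m \<ge> 2" shows "real (Suc (block_of (m - 1))) \<le> 5 * ln (real m)"
proof -
  let ?b = "block_of (m - 1)"
  have "4 ^ ?b \<le> 3 * (m - 1) + 1"
    using three_block_start[of ?b] block_of(1)[of "m - 1"] by linarith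
  also have "\<dots> \<le> 3 * m" using assms by simp
  also have "\<dots> \<le> m ^ 2 * m"
  proof (rule mult_right_mono)
    have "2 ^ 2 \<le> m ^ 2" using assms by (rule power_mono) simp
    then show "3 \<le> m ^ 2" by simp
  qed simp
  finally have "4 ^ ?b \<le> m ^ 3" by (simp add: power3_eq_cube power2_eq_square)
  then have "real (4 ^ ?b) \<le> real (m ^ 3)" by (rule of_nat_mono)
  then have "ln (4 ^ ?b) \<le> ln (real m ^ 3)" using assms by simp
  then have "real ?b * ln 4 \<le> 3 * ln (real m)" using assms by (simp add: ln_realpow)
  moreover have ln4: "1 \<le> ln (4::real)"
    using exp_le ln_ge_iff[of 4 1] by simp
  then have "real ?b * 1 \<le> real ?b * ln 4" by (rule mult_left_mono) simp
  moreover have "1 \<le> 2 * ln (real m)"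
  proof -
    have "ln (4::real) = 2 * ln 2" using ln_realpow[of "2::real" 2] by simp
    moreover have "ln 2 \<le> ln (real m)" using assms by simp
    ultimately show ?thesis using ln4 by linarith
  qed
  ultimately show ?thesis by simp
qed

text \<open>
  The Householder reflection of each block that maps the first unit vector to the normalized
  constant vector \<open>1 / 2 ^ n\<close>. On the one-element block \<open>0\<close> the reflecting vector vanishes, and
  division by \<open>0\<close> makes the matrix the identity, as it should.
\<close>

definition reflect_vec :: "nat \<Rightarrow> real" where
  "reflect_vec i = (if i = block_start (block_of i) then 1 else 0) - 1 / block_root i"

definition householder :: "nat \<Rightarrow> nat \<Rightarrow> real" where
  "householder i j = (if block_of i = block_of j
     then (if i = j then 1 else 0) - reflect_vec i * reflect_vec j / (1 - 1 / block_root i) else 0)"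

lemma householder_sym: "householder i j = householder j i"
  by (simp add: householder_def block_root_def mult.commute)

text \<open>This row is the purpose of the reflection: every new vector of a block contains the
  conditional vector of that block with the same small coefficient.\<close>

lemma householder_start:
  assumes "block_of j = n" shows "householder (block_start n) j = 1 / block_root j"
proof (cases n)
  case 0
  then have "j \<in> block 0" using assms by (simp add: in_block_iff)
  then have "j = 0" by (simp add: block_def block_start_Suc)
  then show ?thesis using 0 assms by (simp add: householder_def block_root_def)
next
  case (Suc m)
  moreover have "1 < (2::real) ^ Suc m" by (rule one_less_power) auto
  ultimately have "1 < block_root j" using assms by (simp add: block_root_def)
  then show ?thesis using assms
    by (auto simp: householder_def reflect_vec_def block_root_def)
qed

text \<open>Thus the denominator \<open>1 - 1 / block_root i\<close> in \<open>householder\<close>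
  is half the squared norm of the reflecting vector, as a reflection requires.\<close>

lemma sum_reflect_vec: "(\<Sum>l\<in>block n. (reflect_vec l)\<^sup>2) = 2 - 2 / 2 ^ n"
proof -
  let ?r = "2 ^ n :: real"
  have sn: "block_start n \<in> block n" by (simp add: in_block_iff)
  have fin: "finite (block n)" by (simp add: block_def)
  have "(\<Sum>l\<in>block n. (reflect_vec l)\<^sup>2) =
      (\<Sum>l\<in>block n. (if l = block_start n then 1 - 2 / ?r else 0) + 1 / ?r\<^sup>2)"
    by (rule sum.cong)
      (auto simp: reflect_vec_def in_block_iff block_root_def power2_eq_square field_simps)
  also have "\<dots> = 1 - 2 / ?r + real (card (block n)) / ?r\<^sup>2"
    using sn fin by (simp add: sum.distrib)
  also have "real (card (block n)) / ?r\<^sup>2 = 1"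
    by (simp add: card_block flip: power_mult_distrib power_mult) (simp add: power_mult mult.commute[of _ 2])
  finally show ?thesis by simp
qed

lemma householder_orthogonal:
  assumes "i < block_start k" "j < block_start k"
  shows "(\<Sum>l<block_start k. householder l i * householder l j) = (if i = j then 1 else 0)"
proof (cases "block_of i = block_of j")
  case False
  then show ?thesis by (auto simp: householder_def intro!: sum.neutral)
next
  case True
  define n where "n = block_of i"
  define c where "c = 1 / (1 - 1 / (2::real) ^ n)"
  let ?v = reflect_vec
  have ij: "i \<in> block n" "j \<in> block n" using True by (auto simp: in_block_iff n_def)
  have fin: "finite (block n)" by (simp add: block_def)
  have H: "householder l i = (if l = i then 1 else 0) - c * ?v l * ?v i"
    "householder l j = (if l = j then 1 else 0) - c * ?v l * ?v j" if "l \<in> block n" for l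
    using that ij by (auto simp: householder_def in_block_iff c_def block_root_def)
  \<comment> \<open>This says that \<open>c\<close> times the squared norm of the reflecting vector
    is 2, multiplied by \<open>c\<close> so that it also holds for \<open>n = 0\<close>, where
    \<open>c = 0\<close>. It makes the quadratic term cancel the two linear ones.\<close>
  have cc: "c\<^sup>2 * (2 - 2 / 2 ^ n) = 2 * c"
  proof (cases "(2::real) ^ n = 1")
    case False
    then have "c * (1 - 1 / 2 ^ n) = 1" by (simp add: c_def)
    moreover have "c\<^sup>2 * (2 - 2 / 2 ^ n) = 2 * c * (c * (1 - 1 / 2 ^ n))"
      by (simp add: power2_eq_square algebra_simps)
    ultimately show ?thesis by simp
  qed (simp add: c_def)
  have "(\<Sum>l<block_start k. householder l i * householder l j) =
      (\<Sum>l\<in>block n. householder l i * householder l j)"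
  proof (rule sum.mono_neutral_right)
    show "block n \<subseteq> {..<block_start k}"
      using assms(1) by (intro block_subset) (simp add: n_def block_of_less_iff)
  qed (auto simp: householder_def in_block_iff n_def True)
  also have "\<dots> = (\<Sum>l\<in>block n. (if l = i then (if i = j then 1 else 0) else 0)
      - (if l = i then c * ?v i * ?v j else 0) - (if l = j then c * ?v i * ?v j else 0)
      + c\<^sup>2 * ?v i * ?v j * (?v l)\<^sup>2)"
    by (rule sum.cong) (auto simp: H power2_eq_square algebra_simps)
  also have "\<dots> = (if i = j then 1 else 0) - c * ?v i * ?v j - c * ?v i * ?v j
      + c\<^sup>2 * ?v i * ?v j * (2 - 2 / 2 ^ n)"
    using ij fin by (simp add: sum.distrib sum_subtractf sum_reflect_vec flip: sum_distrib_left)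
  also have "c\<^sup>2 * ?v i * ?v j * (2 - 2 / 2 ^ n) = 2 * c * ?v i * ?v j"
  proof -
    have "c\<^sup>2 * ?v i * ?v j * (2 - 2 / 2 ^ n) = (c\<^sup>2 * (2 - 2 / 2 ^ n)) * ?v i * ?v j"
      by (simp only: mult_ac)
    then show ?thesis by (simp only: cc)
  qed
  finally show ?thesis by simp
qed

text \<open>The matrix is real, so the real inner product of the scalars suffices even for complex
  coordinates; expanding the squares reduces the claim to orthogonality.\<close>

lemma householder_isometry:
  fixes z :: "nat \<Rightarrow> 'k::real_inner"
  shows "L2_set (\<lambda>j. norm (\<Sum>i<block_start k. householder i j *\<^sub>R z i)) {..<block_start k} =
    L2_set (\<lambda>i. norm (z i)) {..<block_start k}"
proof -
  let ?I = "{..<block_start k}"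
  have "(\<Sum>j\<in>?I. (norm (\<Sum>i\<in>?I. householder i j *\<^sub>R z i))\<^sup>2) =
      (\<Sum>j\<in>?I. \<Sum>i\<in>?I. \<Sum>l\<in>?I. householder j i * householder j l * (z i \<bullet> z l))"
    by (simp add: power2_norm_eq_inner inner_sum_left inner_sum_right mult_ac householder_sym
      sum_distrib_left inner_commute)
  also have "\<dots> = (\<Sum>i\<in>?I. \<Sum>j\<in>?I. \<Sum>l\<in>?I. householder j i * householder j l * (z i \<bullet> z l))"
    by (rule sum.swap)
  also have "\<dots> = (\<Sum>i\<in>?I. \<Sum>l\<in>?I. \<Sum>j\<in>?I. householder j i * householder j l * (z i \<bullet> z l))"
    by (intro sum.cong refl sum.swap)
  also have "\<dots> = (\<Sum>i\<in>?I. \<Sum>l\<in>?I. (if i = l then 1 else 0) * (z i \<bullet> z l))"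
    by (intro sum.cong refl) (simp add: householder_orthogonal flip: sum_distrib_right)
  also have "\<dots> = (\<Sum>i\<in>?I. (norm (z i))\<^sup>2)"
    by (intro sum.cong refl) (simp add: power2_norm_eq_inner if_distrib[of "\<lambda>x. x * _"] cong: if_cong)
  finally show ?thesis by (simp add: L2_set_def)
qed

subsection \<open>The block construction\<close>

lemma (in banach_space_over) scaleR_scale: "scl (r *\<^sub>R c) f = r *\<^sub>R scl c f"
  by (rule linear_scale[OF bounded_linear.linear[OF bounded_linear_scale]])

lemma (in banach_space_over) linfun_scaleR: "linfun \<phi> \<Longrightarrow> \<phi> (r *\<^sub>R f) = r *\<^sub>R \<phi> f"
  by (rule linear_scale[OF bounded_linear.linear[OF linfun_bounded_linear]])

text \<open>
  The ambient space is decomposed into a part with basis \<open>(g (block_start n))\<^sub>n\<close> and a Hilbertian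
  part with basis the remaining \<open>g j\<close>; \<open>\<gamma> j\<close> are the coordinate functionals.
\<close>

locale block_system = banach_space_over scl
  for scl :: "'k::{real_normed_field,euclidean_space} \<Rightarrow> 'a::banach \<Rightarrow> 'a" +
  fixes g :: "nat \<Rightarrow> 'a" and \<gamma> :: "nat \<Rightarrow> 'a \<Rightarrow> 'k" and K :: real
  assumes K: "K \<ge> 1"
    and linfun_\<gamma>: "linfun (\<gamma> j)"
    and biorth: "\<gamma> i (g j) = (if i = j then 1 else 0)"
    and norm_g_start: "norm (g (block_start n)) \<le> K"
    and \<gamma>_start_le: "norm (\<gamma> (block_start n) f) \<le> K * norm f"
    and \<gamma>_start_lim: "(\<lambda>n. \<gamma> (block_start n) f) \<longlonglongrightarrow> 0"
    and partial_sum_le: "norm (\<Sum>n<k. scl (\<gamma> (block_start n) f) (g (block_start n))) \<le> K * norm f"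
    and hilbert_lower: "finite F \<Longrightarrow> F \<inter> range block_start = {} \<Longrightarrow>
          L2_set (\<lambda>j. norm (\<gamma> j f)) F \<le> K * norm f"
    and hilbert_upper: "finite F \<Longrightarrow> F \<inter> range block_start = {} \<Longrightarrow>
          norm (\<Sum>j\<in>F. scl (c j) (g j)) \<le> K * L2_set (\<lambda>j. norm (c j)) F"
    and expansion: "(\<lambda>k. \<Sum>j<block_start k. scl (\<gamma> j f) (g j)) \<longlonglongrightarrow> f"
    and conditional: "\<exists>b E. norm (\<Sum>n<k. scl (b n) (g (block_start n))) \<le> K \<and>
          real k \<le> K * norm (\<Sum>n\<in>{..<k} \<inter> E. scl (b n) (g (block_start n)))"
begin

definition x :: "nat \<Rightarrow> 'a" where
  "x j = (\<Sum>i\<in>block (block_of j). householder i j *\<^sub>R g i)"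

text \<open>The matrix is the one used for \<open>x\<close>: being real and orthogonal, it equals
  its own inverse transpose, by which dual bases transform.\<close>

definition \<xi> :: "nat \<Rightarrow> 'a \<Rightarrow> 'k" where
  "\<xi> j f = (\<Sum>i\<in>block (block_of j). householder i j *\<^sub>R \<gamma> i f)"

text \<open>The subtracted constant is the average of \<open>\<xi>\<close> over the block, because
  the reflection exchanges the first unit vector with the normalized constant vector.\<close>

definition q :: "nat \<Rightarrow> 'a \<Rightarrow> 'k" where
  "q j f = \<xi> j f - (1 / block_root j) *\<^sub>R \<gamma> (block_start (block_of j)) f"

abbreviation rest :: "nat \<Rightarrow> nat set" where
  "rest k \<equiv> {..<block_start k} - range block_start"

section \<open>Algebra of the change of basis\<close>

lemma K_pos: "K > 0" using K by simp

text \<open>Entries between different blocks vanish, so finitely many indices can share one finite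
  matrix over an initial range.\<close>

lemma sum_block:
  fixes h :: "nat \<Rightarrow> 'c::real_vector"
  assumes "j < block_start k"
  shows "(\<Sum>i\<in>block (block_of j). householder i j *\<^sub>R h i) = (\<Sum>i<block_start k. householder i j *\<^sub>R h i)"
proof (rule sum.mono_neutral_left)
  show "block (block_of j) \<subseteq> {..<block_start k}"
    using assms by (intro block_subset) (simp add: block_of_less_iff)
qed (auto simp: in_block_iff householder_def)

lemma sum_block_split:
  fixes h :: "nat \<Rightarrow> 'c::real_vector"
  assumes "j < block_start k"
  shows "(\<Sum>i\<in>block (block_of j). householder i j *\<^sub>R h i) =
    (1 / block_root j) *\<^sub>R h (block_start (block_of j)) + (\<Sum>i\<in>rest k. householder i j *\<^sub>R h i)"
proof -
  let ?n = "block_of j"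
  have "(\<Sum>i<block_start k. householder i j *\<^sub>R h i) =
      (\<Sum>i\<in>{..<block_start k} \<inter> range block_start. householder i j *\<^sub>R h i) + (\<Sum>i\<in>rest k. householder i j *\<^sub>R h i)"
    by (rule sum.Int_Diff) simp
  also have "(\<Sum>i\<in>{..<block_start k} \<inter> range block_start. householder i j *\<^sub>R h i) =
      (\<Sum>i\<in>{block_start ?n}. householder i j *\<^sub>R h i)"
  proof (rule sum.mono_neutral_right)
    show "{block_start ?n} \<subseteq> {..<block_start k} \<inter> range block_start"
      using assms block_of(1)[of j] by auto
  qed (auto simp: householder_def)
  also have "\<dots> = (1 / block_root j) *\<^sub>R h (block_start ?n)"
    by (simp add: householder_start)
  finally show ?thesis by (simp add: sum_block[OF assms])
qed

lemma x_eq: "j < block_start k \<Longrightarrow> x j = (\<Sum>i<block_start k. householder i j *\<^sub>R g i)"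
  unfolding x_def by (rule sum_block)

lemma \<xi>_eq: "j < block_start k \<Longrightarrow> \<xi> j f = (\<Sum>i<block_start k. householder i j *\<^sub>R \<gamma> i f)"
  unfolding \<xi>_def by (rule sum_block)

lemma q_eq: "j < block_start k \<Longrightarrow> q j f = (\<Sum>i\<in>rest k. householder i j *\<^sub>R \<gamma> i f)"
  unfolding q_def \<xi>_def by (subst sum_block_split) auto

lemma linfun_\<xi>: "linfun (\<xi> j)"
  unfolding linfun_def
proof (intro conjI allI)
  show "bounded_linear (\<xi> j)"
    unfolding \<xi>_def[abs_def]
    by (intro bounded_linear_sum bounded_linear_const_scaleR linfun_bounded_linear[OF linfun_\<gamma>])
  show "\<xi> j (scl c f) = c * \<xi> j f" for c f
    by (simp add: \<xi>_def linfun_scale[OF linfun_\<gamma>] sum_distrib_left)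
qed

lemma \<xi>_x: "\<xi> j (x l) = (if j = l then 1 else 0)"
proof -
  obtain k where k: "{j, l} \<subseteq> {..<block_start k}" using exists_block_bound[of "{j,l}"] by auto
  let ?I = "{..<block_start k}"
  have "\<gamma> i (x l) = (if i \<in> ?I then of_real (householder i l) else 0)" for i
  proof -
    have "\<gamma> i (x l) = (\<Sum>m\<in>?I. householder m l *\<^sub>R \<gamma> i (g m))"
      using k by (simp add: x_eq[of l k] linfun_sum[OF linfun_\<gamma>] linfun_scaleR[OF linfun_\<gamma>])
    also have "\<dots> = (\<Sum>m\<in>?I. if m = i then of_real (householder i l) else 0)"
      by (rule sum.cong) (auto simp: biorth scaleR_conv_of_real)
    also have "\<dots> = (if i \<in> ?I then of_real (householder i l) else 0)" by simp
    finally show ?thesis .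
  qed
  then have "\<xi> j (x l) = (\<Sum>i\<in>?I. of_real (householder i j * householder i l))"
    using k by (simp add: \<xi>_eq[of j k] scaleR_conv_of_real)
  also have "\<dots> = of_real (\<Sum>i\<in>?I. householder i j * householder i l)" by simp
  also have "\<dots> = (if j = l then 1 else 0)" using k by (simp add: householder_orthogonal)
  finally show ?thesis .
qed

text \<open>Over complete blocks the change of basis is orthogonal, so the partial sums with respect
  to \<open>x\<close> and to \<open>g\<close> coincide.\<close>

lemma full_blocks:
  "(\<Sum>j<block_start k. scl (\<xi> j f) (x j)) = (\<Sum>j<block_start k. scl (\<gamma> j f) (g j))"
proof -
  let ?I = "{..<block_start k}"
  have "(\<Sum>j\<in>?I. scl (\<xi> j f) (x j)) =
      (\<Sum>j\<in>?I. \<Sum>l\<in>?I. \<Sum>i\<in>?I. (householder j l * householder j i) *\<^sub>R scl (\<gamma> i f) (g l))"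
    by (intro sum.cong refl)
      (simp add: x_eq[of _ k] \<xi>_eq[of _ k] scale_sum_left scale_sum_right scaleR_scale scale_scaleR
        scaleR_sum_right householder_sym)
  also have "\<dots> = (\<Sum>l\<in>?I. \<Sum>j\<in>?I. \<Sum>i\<in>?I. (householder j l * householder j i) *\<^sub>R scl (\<gamma> i f) (g l))"
    by (rule sum.swap)
  also have "\<dots> = (\<Sum>l\<in>?I. \<Sum>i\<in>?I. \<Sum>j\<in>?I. (householder j l * householder j i) *\<^sub>R scl (\<gamma> i f) (g l))"
    by (intro sum.cong refl sum.swap)
  also have "\<dots> = (\<Sum>l\<in>?I. \<Sum>i\<in>?I. (if l = i then 1 else 0 :: real) *\<^sub>R scl (\<gamma> i f) (g l))"
    by (intro sum.cong refl) (simp add: householder_orthogonal flip: scaleR_sum_left)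
  also have "\<dots> = (\<Sum>l\<in>?I. scl (\<gamma> l f) (g l))"
    by (intro sum.cong refl) (simp add: if_distrib[of "\<lambda>x. x *\<^sub>R _"] cong: if_cong)
  finally show ?thesis .
qed

lemma sum_starts_rest:
  fixes h :: "nat \<Rightarrow> 'c::ab_group_add"
  shows "(\<Sum>j<block_start k. h j) = (\<Sum>n<k. h (block_start n)) + (\<Sum>j\<in>rest k. h j)"
proof -
  have "{..<block_start k} \<inter> range block_start = block_start ` {..<k}"
    using strict_mono_less[OF strict_mono_block_start] by auto
  moreover have "(\<Sum>j\<in>block_start ` {..<k}. h j) = (\<Sum>n<k. h (block_start n))"
    by (subst sum.reindex) (auto simp: inj_on_def inj_block_start)
  ultimately show ?thesis
    using sum.Int_Diff[of "{..<block_start k}" h "range block_start"] by simp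
qed

text \<open>Conditionality does no harm here, since only initial segments of the conditional vectors
  occur and \<open>partial_sum_le\<close> controls them.\<close>

lemma full_blocks_le: "norm (\<Sum>j<block_start k. scl (\<xi> j f) (x j)) \<le> 2 * K\<^sup>2 * norm f"
proof -
  have "norm (\<Sum>j\<in>rest k. scl (\<gamma> j f) (g j)) \<le> K * L2_set (\<lambda>j. norm (\<gamma> j f)) (rest k)"
    by (rule hilbert_upper) auto
  also have "\<dots> \<le> K * (K * norm f)" using K_pos by (intro mult_left_mono hilbert_lower) auto
  finally have "norm (\<Sum>j\<in>rest k. scl (\<gamma> j f) (g j)) \<le> K\<^sup>2 * norm f"
    by (simp add: power2_eq_square mult.assoc)
  moreover have "K * norm f \<le> K\<^sup>2 * norm f"
    using K by (intro mult_right_mono) (auto simp: power2_eq_square)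
  ultimately show ?thesis
    unfolding full_blocks sum_starts_rest
    using norm_triangle_ineq[of "\<Sum>n<k. scl (\<gamma> (block_start n) f) (g (block_start n))"
        "\<Sum>j\<in>rest k. scl (\<gamma> j f) (g j)"] partial_sum_le[of f k] by linarith
qed

text \<open>\<open>q\<close> is the reflected image of the sequence of Hilbertian coordinates with 0
  inserted at the block starts, and reflection preserves the Euclidean norm.\<close>

lemma L2_q: assumes "finite F" shows "L2_set (\<lambda>j. norm (q j f)) F \<le> K * norm f"
proof -
  obtain k where k: "F \<subseteq> {..<block_start k}" using exists_block_bound[OF assms] by blast
  let ?z = "\<lambda>i. if i \<in> range block_start then 0 else \<gamma> i f"
  have qz: "q j f = (\<Sum>i<block_start k. householder i j *\<^sub>R ?z i)" if "j < block_start k" for j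
    unfolding q_eq[OF that] by (rule sum.mono_neutral_cong_left) auto
  have "L2_set (\<lambda>j. norm (q j f)) F \<le> L2_set (\<lambda>j. norm (q j f)) {..<block_start k}"
    unfolding L2_set_def by (intro real_sqrt_le_mono sum_mono2) (use k in auto)
  also have "\<dots> = L2_set (\<lambda>i. norm (?z i)) {..<block_start k}"
    unfolding householder_isometry[where z = ?z, symmetric] by (rule L2_set_cong) (auto simp: qz)
  also have "\<dots> = L2_set (\<lambda>j. norm (\<gamma> j f)) (rest k)"
    unfolding L2_set_def by (rule arg_cong[of _ _ sqrt], rule sum.mono_neutral_cong_right) auto
  also have "\<dots> \<le> K * norm f" by (rule hilbert_lower) auto
  finally show ?thesis .
qed

section \<open>Upper estimates of Lorentz type and the weak-type lower estimate\<close>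

lemma L2_householder_le:
  fixes a :: "nat \<Rightarrow> 'k"
  assumes "E \<subseteq> {..<block_start k}"
  shows "L2_set (\<lambda>i. norm (\<Sum>j\<in>E. householder i j *\<^sub>R a j)) (rest k) \<le> L2_set (\<lambda>j. norm (a j)) E"
proof -
  let ?a = "\<lambda>j. if j \<in> E then a j else 0"
  have eq: "(\<Sum>j\<in>E. householder i j *\<^sub>R a j) = (\<Sum>j<block_start k. householder j i *\<^sub>R ?a j)" for i
    by (rule sum.mono_neutral_cong_left) (use assms in \<open>auto simp: householder_sym\<close>)
  have "L2_set (\<lambda>i. norm (\<Sum>j\<in>E. householder i j *\<^sub>R a j)) (rest k) \<le>
      L2_set (\<lambda>i. norm (\<Sum>j<block_start k. householder j i *\<^sub>R ?a j)) {..<block_start k}"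
    unfolding eq L2_set_def by (intro real_sqrt_le_mono sum_mono2) auto
  also have "\<dots> = L2_set (\<lambda>j. norm (?a j)) {..<block_start k}" by (rule householder_isometry)
  also have "\<dots> = L2_set (\<lambda>j. norm (a j)) E"
    unfolding L2_set_def
    by (rule arg_cong[of _ _ sqrt], rule sum.mono_neutral_cong_right) (use assms in auto)
  finally show ?thesis .
qed

text \<open>Each \<open>x j\<close> splits into a multiple of the conditional vector of its block
  and a Hilbertian part. The former are summed by the triangle inequality, the latter through the
  isometry.\<close>

lemma upper_estimate:
  assumes "finite E"
  shows "norm (\<Sum>j\<in>E. scl (a j) (x j)) \<le>
    K * ((\<Sum>j\<in>E. norm (a j) / block_root j) + L2_set (\<lambda>j. norm (a j)) E)"
proof -
  obtain k where k: "E \<subseteq> {..<block_start k}" using exists_block_bound[OF assms] by blast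
  let ?b = "\<lambda>j. scl (a j) ((1 / block_root j) *\<^sub>R g (block_start (block_of j)))"
  let ?y = "\<lambda>i. \<Sum>j\<in>E. householder i j *\<^sub>R a j"
  have xj: "x j = (1 / block_root j) *\<^sub>R g (block_start (block_of j)) + (\<Sum>i\<in>rest k. householder i j *\<^sub>R g i)"
    if "j \<in> E" for j
    unfolding x_def using that k by (intro sum_block_split) auto
  have "(\<Sum>j\<in>E. scl (a j) (x j)) = (\<Sum>j\<in>E. ?b j + (\<Sum>i\<in>rest k. scl (householder i j *\<^sub>R a j) (g i)))"
    by (rule sum.cong)
      (simp_all add: xj scale_right_distrib scale_sum_right scale_scaleR scaleR_scale)
  also have "\<dots> = (\<Sum>j\<in>E. ?b j) + (\<Sum>j\<in>E. \<Sum>i\<in>rest k. scl (householder i j *\<^sub>R a j) (g i))"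
    by (rule sum.distrib)
  also have "(\<Sum>j\<in>E. \<Sum>i\<in>rest k. scl (householder i j *\<^sub>R a j) (g i)) = (\<Sum>i\<in>rest k. scl (?y i) (g i))"
    by (subst sum.swap) (simp add: scale_sum_left)
  finally have eq: "(\<Sum>j\<in>E. scl (a j) (x j)) = (\<Sum>j\<in>E. ?b j) + (\<Sum>i\<in>rest k. scl (?y i) (g i))" .
  have "norm (?b j) \<le> K * (norm (a j) / block_root j)" for j
    using mult_left_mono[OF norm_g_start[of "block_of j"], of "norm (a j) / block_root j"]
      less_imp_le[OF block_root_pos[of j]]
    by (simp add: norm_scale mult.commute)
  then have 1: "norm (\<Sum>j\<in>E. ?b j) \<le> K * (\<Sum>j\<in>E. norm (a j) / block_root j)"
    unfolding sum_distrib_left by (intro sum_norm_le) auto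
  have "norm (\<Sum>i\<in>rest k. scl (?y i) (g i)) \<le> K * L2_set (\<lambda>i. norm (?y i)) (rest k)"
    by (rule hilbert_upper) auto
  also have "\<dots> \<le> K * L2_set (\<lambda>j. norm (a j)) E"
    using K_pos by (intro mult_left_mono L2_householder_le k) auto
  finally have 2: "norm (\<Sum>i\<in>rest k. scl (?y i) (g i)) \<le> K * L2_set (\<lambda>j. norm (a j)) E" .
  show ?thesis
    unfolding eq using norm_triangle_ineq[of "\<Sum>j\<in>E. ?b j" "\<Sum>i\<in>rest k. scl (?y i) (g i)"] 1 2
    by (simp add: distrib_left)
qed

text \<open>In the constant 7, the share 6 comes from \<open>sum_inverse_block_root\<close> and 1
  from the Euclidean norm.\<close>

lemma flat_upper_estimate:
  assumes "finite E" "\<And>j. j \<in> E \<Longrightarrow> norm (a j) \<le> t" "t \<ge> 0"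
  shows "norm (\<Sum>j\<in>E. scl (a j) (x j)) \<le> 7 * K * t * sqrt (real (card E))"
proof -
  have "(\<Sum>j\<in>E. norm (a j) / block_root j) \<le> (\<Sum>j\<in>E. t * (1 / block_root j))"
    using assms by (intro sum_mono) (simp add: divide_right_mono less_imp_le)
  also have "\<dots> = t * (\<Sum>j\<in>E. 1 / block_root j)" by (simp add: sum_distrib_left)
  also have "\<dots> \<le> t * (6 * sqrt (real (card E)))"
    using assms by (intro mult_left_mono sum_inverse_block_root)
  finally have 1: "(\<Sum>j\<in>E. norm (a j) / block_root j) \<le> 6 * t * sqrt (real (card E))" by simp
  have "L2_set (\<lambda>j. norm (a j)) E \<le> L2_set (\<lambda>j. t) E"
    using assms by (intro L2_set_mono) auto
  also have "\<dots> = t * sqrt (real (card E))"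
    using assms(3) by (simp add: L2_set_def real_sqrt_mult)
  finally have 2: "L2_set (\<lambda>j. norm (a j)) E \<le> t * sqrt (real (card E))" .
  have "norm (\<Sum>j\<in>E. scl (a j) (x j)) \<le>
    K * ((\<Sum>j\<in>E. norm (a j) / block_root j) + L2_set (\<lambda>j. norm (a j)) E)"
    by (rule upper_estimate[OF assms(1)])
  also have "\<dots> \<le> K * (6 * t * sqrt (real (card E)) + t * sqrt (real (card E)))"
    using K_pos 1 2 by (intro mult_left_mono add_mono) auto
  finally show ?thesis by (simp add: algebra_simps)
qed

lemma \<xi>_le_q: "norm (\<xi> j f) \<le> norm (q j f) + norm (\<gamma> (block_start (block_of j)) f) / block_root j"
proof -
  have "\<xi> j f = q j f + (1 / block_root j) *\<^sub>R \<gamma> (block_start (block_of j)) f" by (simp add: q_def)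
  then show ?thesis
    using norm_triangle_ineq[of "q j f" "(1 / block_root j) *\<^sub>R \<gamma> (block_start (block_of j)) f"]
      less_imp_le[OF block_root_pos[of j]] by simp
qed

text \<open>Where \<open>\<xi>\<close> is at least \<open>t\<close>, either the block average or
  \<open>q\<close> is at least \<open>t / 2\<close>. The average can be that large only while
  \<open>block_root j <= 2 * K * norm f / t\<close>, so these indices are counted by the largest of
  them. The others are counted by Chebyshev's inequality and \<open>L2_q\<close>.\<close>

lemma lower_estimate:
  assumes F: "finite F" and t: "t > 0" and le: "\<And>j. j \<in> F \<Longrightarrow> t \<le> norm (\<xi> j f)"
  shows "t * sqrt (real (card F)) \<le> 4 * K * norm f"
proof -
  define F1 where "F1 = {j\<in>F. t / 2 \<le> norm (\<gamma> (block_start (block_of j)) f) / block_root j}"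
  have F1: "finite F1" "F1 \<subseteq> F" using F by (auto simp: F1_def)
  have c1: "t\<^sup>2 * real (card F1) \<le> 8 * K\<^sup>2 * (norm f)\<^sup>2"
  proof (cases "F1 = {}")
    case False
    define M where "M = Max F1"
    have M: "M \<in> F1" using F1 False by (simp add: M_def)
    have "F1 \<subseteq> {..<Suc M}" using F1 by (auto simp: M_def less_Suc_eq_le)
    then have "card F1 \<le> Suc M" using card_mono[of "{..<Suc M}" F1] by simp
    then have "real (card F1) \<le> 2 * block_root M ^ 2" using Suc_le_block_root[of M] by linarith
    then have "t\<^sup>2 * real (card F1) \<le> t\<^sup>2 * (2 * block_root M ^ 2)" by (rule mult_left_mono) simp
    also have "\<dots> = 2 * (t * block_root M)\<^sup>2" by (simp add: power_mult_distrib)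
    also have "t * block_root M \<le> 2 * (K * norm f)"
    proof -
      have "t / 2 * block_root M \<le> norm (\<gamma> (block_start (block_of M)) f)"
        using M by (simp add: F1_def pos_le_divide_eq)
      then show ?thesis using \<gamma>_start_le[of "block_of M" f] by linarith
    qed
    then have "(t * block_root M)\<^sup>2 \<le> (2 * (K * norm f))\<^sup>2"
      using t by (intro power_mono) (auto intro!: mult_nonneg_nonneg less_imp_le)
    finally show ?thesis by (simp add: power_mult_distrib)
  qed simp
  have c2: "t\<^sup>2 * real (card (F - F1)) \<le> 4 * K\<^sup>2 * (norm f)\<^sup>2"
  proof -
    have "(t / 2)\<^sup>2 \<le> (norm (q j f))\<^sup>2" if "j \<in> F - F1" for j
    proof (rule power_mono)
      have "\<not> t / 2 \<le> norm (\<gamma> (block_start (block_of j)) f) / block_root j"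
        using that unfolding F1_def by blast
      moreover have "t \<le> norm (\<xi> j f)" using that le by blast
      ultimately show "t / 2 \<le> norm (q j f)" using \<xi>_le_q[of j f] by linarith
    qed (use t in simp)
    then have "real (card (F - F1)) * (t / 2)\<^sup>2 \<le> (\<Sum>j\<in>F - F1. (norm (q j f))\<^sup>2)"
      by (rule sum_bounded_below)
    also have "\<dots> = (L2_set (\<lambda>j. norm (q j f)) (F - F1))\<^sup>2"
      by (simp add: L2_set_def sum_nonneg)
    also have "\<dots> \<le> (K * norm f)\<^sup>2" using F by (intro power_mono L2_q L2_set_nonneg) auto
    finally show ?thesis by (simp add: power_mult_distrib power_divide algebra_simps)
  qed
  have "real (card F) = real (card F1) + real (card (F - F1))"
    using card_Diff_subset[OF F1] card_mono[OF F F1(2)] by simp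
  then have "(t * sqrt (real (card F)))\<^sup>2 \<le> 12 * K\<^sup>2 * (norm f)\<^sup>2"
    using c1 c2 by (simp add: power_mult_distrib distrib_left)
  also have "\<dots> \<le> (4 * K * norm f)\<^sup>2" by (simp add: power_mult_distrib mult_right_mono)
  finally show ?thesis by (rule power2_le_imp_le) (use K_pos in simp)
qed

text \<open>
  Coordinates in blocks with \<open>2 ^ n \<le> 2 * K * norm f / t\<close> are kept up to an error carried by small
  coordinates; in the later blocks the averages are below \<open>t / 2\<close>, so that the large coordinates
  of \<open>f\<close> are controlled by the Hilbertian part \<open>q\<close>.
\<close>

lemma greedy_projection_le:
  assumes A: "finite A" and t: "t > 0" and ge: "\<And>j. j \<in> A \<Longrightarrow> t \<le> norm (\<xi> j f)"
    and le: "\<And>j. j \<notin> A \<Longrightarrow> norm (\<xi> j f) \<le> t"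
  shows "norm (\<Sum>j\<in>A. scl (\<xi> j f) (x j)) \<le> 34 * K\<^sup>2 * norm f"
proof (cases "f = 0")
  case True
  then have "A = {}" using ge t by (fastforce simp: linfun_zero[OF linfun_\<xi>])
  then show ?thesis using True by simp
next
  case False
  define \<rho> where "\<rho> = 2 * K * norm f / t"
  have \<rho>: "\<rho> > 0" and t\<rho>: "t * \<rho> = 2 * K * norm f" using False K_pos t by (auto simp: \<rho>_def)
  define k where "k = (LEAST n. \<rho> < 2 ^ n)"
  have "\<exists>n. \<rho> < 2 ^ n" using real_arch_pow[of 2 \<rho>] by simp
  then have k1: "\<rho> < 2 ^ k" unfolding k_def by (rule LeastI_ex)
  have k2: "2 ^ n \<le> \<rho>" if "n < k" for n using not_less_Least[of n "\<lambda>n. \<rho> < 2 ^ n"] that by (auto simp: k_def)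
  let ?I = "{..<block_start k}"
  let ?S = "\<lambda>F. \<Sum>j\<in>F. scl (\<xi> j f) (x j)"
  have "?S A = ?S (A \<inter> ?I) + ?S (A - ?I)" by (rule sum.Int_Diff[OF A])
  moreover have "?S ?I = ?S (?I \<inter> A) + ?S (?I - A)" by (rule sum.Int_Diff) simp
  ultimately have split: "?S A = ?S ?I - ?S (?I - A) + ?S (A - ?I)" by (simp add: Int_commute)
  have KK: "K * norm f \<le> K\<^sup>2 * norm f"
    using K by (intro mult_right_mono) (auto simp: power2_eq_square)
  have 1: "norm (?S (?I - A)) \<le> 28 * K\<^sup>2 * norm f"
  proof -
    have "norm (?S (?I - A)) \<le> 7 * K * t * sqrt (real (card (?I - A)))"
      using le t by (intro flat_upper_estimate) auto
    also have "sqrt (real (card (?I - A))) \<le> 2 * \<rho>"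
    proof -
      have "card (?I - A) \<le> block_start k" using card_mono[of ?I "?I - A"] by auto
      \<comment> \<open>If \<open>k = Suc n\<close>, minimality of \<open>k\<close> gives
        \<open>2 ^ n <= \<rho>\<close>; if \<open>k = 0\<close>, there are no early blocks.\<close>
      moreover have "real (block_start k) \<le> (2 * \<rho>)\<^sup>2"
      proof (cases k)
        case (Suc n)
        have "block_start k \<le> 2 * 4 ^ n" using block_start_Suc_le Suc by simp
        then have "real (block_start k) \<le> real (2 * 4 ^ n)" by (rule of_nat_mono)
        also have "\<dots> = 2 * (2 ^ n)\<^sup>2" by (simp add: power2_eq_square flip: power_mult_distrib)
        also have "\<dots> \<le> 2 * \<rho>\<^sup>2" using k2[of n] Suc by (intro mult_left_mono power_mono) auto
        also have "\<dots> \<le> (2 * \<rho>)\<^sup>2" by (simp add: power_mult_distrib)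
        finally show ?thesis .
      qed simp
      ultimately show ?thesis using \<rho> by (intro real_le_lsqrt) auto
    qed
    then have "7 * K * t * sqrt (real (card (?I - A))) \<le> 7 * K * t * (2 * \<rho>)"
      using K_pos t by (intro mult_left_mono) auto
    also have "\<dots> = 14 * K * (t * \<rho>)" by simp
    also have "\<dots> = 28 * K\<^sup>2 * norm f" unfolding t\<rho> by (simp add: power2_eq_square)
    finally show ?thesis .
  qed
  have 2: "norm (?S (A - ?I)) \<le> 4 * K\<^sup>2 * norm f"
  proof -
    have r: "\<rho> < block_root j" and qt: "t / 2 \<le> norm (q j f)" and \<xi>q: "norm (\<xi> j f) \<le> 2 * norm (q j f)"
      if "j \<in> A - ?I" for j
    proof -
      have "k \<le> block_of j" using that block_of_less_iff[of j k] by auto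
      then have "(2::real) ^ k \<le> block_root j" unfolding block_root_def by (intro power_increasing) auto
      then show r: "\<rho> < block_root j" using k1 by linarith
      have "norm (\<gamma> (block_start (block_of j)) f) / block_root j \<le> K * norm f / \<rho>"
        using r \<rho> K_pos by (intro frac_le \<gamma>_start_le) auto
      also have "\<dots> = t / 2" using False K_pos t by (simp add: \<rho>_def)
      finally have "norm (\<gamma> (block_start (block_of j)) f) / block_root j \<le> t / 2" .
      moreover have "t \<le> norm (\<xi> j f)" using ge that by blast
      ultimately show "t / 2 \<le> norm (q j f)" "norm (\<xi> j f) \<le> 2 * norm (q j f)"
        using \<xi>_le_q[of j f] by linarith+
    qed
    have "L2_set (\<lambda>j. norm (\<xi> j f)) (A - ?I) \<le> L2_set (\<lambda>j. 2 * norm (q j f)) (A - ?I)"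
      using \<xi>q by (intro L2_set_mono) auto
    also have "\<dots> = 2 * L2_set (\<lambda>j. norm (q j f)) (A - ?I)" by (rule L2_set_right_distrib[symmetric]) simp
    also have "\<dots> \<le> 2 * (K * norm f)" using A by (intro mult_left_mono L2_q) auto
    finally have 3: "L2_set (\<lambda>j. norm (\<xi> j f)) (A - ?I) \<le> 2 * (K * norm f)" .
    have "norm (\<xi> j f) / block_root j \<le> 4 / (t * \<rho>) * (norm (q j f))\<^sup>2" if j: "j \<in> A - ?I" for j
    proof -
      have "norm (\<xi> j f) / block_root j \<le> 2 * norm (q j f) / \<rho>"
        using \<xi>q[OF j] r[OF j] \<rho> by (intro frac_le) auto
      \<comment> \<open>Since \<open>q\<close> is at least \<open>t / 2\<close> here, a factor of at
        least 1 may be inserted. It turns a linear expression in \<open>q\<close>, whose sum is not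
        controlled, into a square, whose sum is.\<close>
      also have "\<dots> \<le> 2 * norm (q j f) / \<rho> * (norm (q j f) / (t / 2))"
      proof -
        have "1 \<le> norm (q j f) / (t / 2)" using qt[OF j] t by (subst pos_le_divide_eq) auto
        moreover have "0 \<le> 2 * norm (q j f) / \<rho>" using \<rho> by simp
        ultimately show ?thesis using mult_left_mono by fastforce
      qed
      also have "\<dots> = 4 / (t * \<rho>) * (norm (q j f))\<^sup>2" using \<rho> t by (simp add: power2_eq_square field_simps)
      finally show ?thesis .
    qed
    then have "(\<Sum>j\<in>A - ?I. norm (\<xi> j f) / block_root j) \<le> 4 / (t * \<rho>) * (\<Sum>j\<in>A - ?I. (norm (q j f))\<^sup>2)"
      unfolding sum_distrib_left by (intro sum_mono)
    also have "(\<Sum>j\<in>A - ?I. (norm (q j f))\<^sup>2) = (L2_set (\<lambda>j. norm (q j f)) (A - ?I))\<^sup>2"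
      by (simp add: L2_set_def sum_nonneg)
    also have "4 / (t * \<rho>) * \<dots> \<le> 4 / (t * \<rho>) * (K * norm f)\<^sup>2"
      using A t \<rho> by (intro mult_left_mono power_mono L2_q L2_set_nonneg) auto
    also have "\<dots> = 2 * (K * norm f)" using False K_pos unfolding t\<rho> by (simp add: power2_eq_square field_simps)
    finally have 4: "(\<Sum>j\<in>A - ?I. norm (\<xi> j f) / block_root j) \<le> 2 * (K * norm f)" .
    have "norm (?S (A - ?I)) \<le> K * ((\<Sum>j\<in>A - ?I. norm (\<xi> j f) / block_root j) + L2_set (\<lambda>j. norm (\<xi> j f)) (A - ?I))"
      using A by (intro upper_estimate) auto
    also have "\<dots> \<le> K * (2 * (K * norm f) + 2 * (K * norm f))"
      using K_pos 3 4 by (intro mult_left_mono add_mono) auto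
    finally show ?thesis by (simp add: power2_eq_square)
  qed
  have "norm (?S A) \<le> norm (?S ?I) + norm (?S (?I - A)) + norm (?S (A - ?I))"
    unfolding split using norm_triangle_ineq[of "?S ?I - ?S (?I - A)" "?S (A - ?I)"]
      norm_triangle_ineq4[of "?S ?I" "?S (?I - A)"] by linarith
  \<comment> \<open>34 = 2 + 28 + 4, from the complete blocks, the subtracted small coordinates and
    the late blocks.\<close>
  then show ?thesis using 1 2 full_blocks_le[of f k] by simp
qed

section \<open>Convergence of the expansion\<close>

lemma L2_\<xi>_block_le:
  assumes "F \<subseteq> block n"
  shows "L2_set (\<lambda>j. norm (\<xi> j f)) F \<le> L2_set (\<lambda>j. norm (q j f)) (block n) + norm (\<gamma> (block_start n) f)"
proof -
  have "L2_set (\<lambda>j. norm (\<xi> j f)) F \<le> L2_set (\<lambda>j. norm (q j f) + norm (\<gamma> (block_start n) f) / block_root j) F"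
  proof (rule L2_set_mono)
    fix j assume "j \<in> F"
    then have "block_of j = n" using assms by (auto simp: in_block_iff)
    then show "norm (\<xi> j f) \<le> norm (q j f) + norm (\<gamma> (block_start n) f) / block_root j"
      using \<xi>_le_q[of j f] by simp
  qed simp
  also have "\<dots> \<le> L2_set (\<lambda>j. norm (q j f)) F + L2_set (\<lambda>j. norm (\<gamma> (block_start n) f) / block_root j) F"
    by (rule L2_set_triangle_ineq)
  also have "L2_set (\<lambda>j. norm (q j f)) F \<le> L2_set (\<lambda>j. norm (q j f)) (block n)"
    using assms by (intro L2_mono_set) auto
  also have "L2_set (\<lambda>j. norm (\<gamma> (block_start n) f) / block_root j) F \<le> \<bar>norm (\<gamma> (block_start n) f)\<bar>"
    by (rule L2_set_block_root_le[OF assms])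
  finally show ?thesis by simp
qed

lemma block_q_lim: "(\<lambda>n. L2_set (\<lambda>j. norm (q j f)) (block n)) \<longlonglongrightarrow> 0"
proof -
  define P where "P = (\<lambda>m. \<Sum>j<m. (norm (q j f))\<^sup>2)"
  have P_le: "P m \<le> (K * norm f)\<^sup>2" for m
  proof -
    have "P m = (L2_set (\<lambda>j. norm (q j f)) {..<m})\<^sup>2" by (simp add: P_def L2_set_def sum_nonneg)
    also have "\<dots> \<le> (K * norm f)\<^sup>2" by (intro power_mono L2_q L2_set_nonneg) auto
    finally show ?thesis .
  qed
  have "summable (\<lambda>j. (norm (q j f))\<^sup>2)"
  proof (rule bounded_imp_summable)
    show "(\<Sum>j\<le>m. (norm (q j f))\<^sup>2) \<le> (K * norm f)\<^sup>2" for m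
      using P_le[of "Suc m"] unfolding P_def lessThan_Suc_atMost .
  qed simp
  then obtain S where S: "P \<longlonglongrightarrow> S" unfolding summable_def sums_def P_def by blast
  have "(\<lambda>n. P (block_start n)) \<longlonglongrightarrow> S"
    using LIMSEQ_subseq_LIMSEQ[OF S strict_mono_block_start] by (simp add: o_def)
  from tendsto_diff[OF LIMSEQ_Suc[OF this] this]
  have "(\<lambda>n. P (block_start (Suc n)) - P (block_start n)) \<longlonglongrightarrow> 0" by simp
  moreover have "P (block_start (Suc n)) - P (block_start n) = (\<Sum>j\<in>block n. (norm (q j f))\<^sup>2)" for n
    unfolding P_def lessThan_block_start_Suc
    by (subst sum.union_disjoint) (auto simp: lessThan_block_start_Suc)
  ultimately have "(\<lambda>n. sqrt (\<Sum>j\<in>block n. (norm (q j f))\<^sup>2)) \<longlonglongrightarrow> sqrt 0"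
    by (intro tendsto_real_sqrt) simp
  then show ?thesis by (simp add: L2_set_def)
qed

text \<open>At the ends of blocks the partial sums are those of \<open>g\<close>. Inside a block the
  excess is bounded by the Euclidean norm of its coordinates, which tends to 0 because
  \<open>q\<close> is square summable and the start coordinates tend to 0.\<close>

lemma \<xi>_sums: "(\<lambda>j. scl (\<xi> j f) (x j)) sums f"
proof -
  define e where "e n = 2 * K * (L2_set (\<lambda>j. norm (q j f)) (block n) + norm (\<gamma> (block_start n) f))" for n
  define P where "P = (\<lambda>m. \<Sum>j<m. scl (\<xi> j f) (x j))"
  have "e \<longlonglongrightarrow> 2 * K * (0 + 0)"
    unfolding e_def[abs_def]
    by (intro tendsto_mult tendsto_const tendsto_add block_q_lim tendsto_norm_zero \<gamma>_start_lim)
  then have e0: "e \<longlonglongrightarrow> 0" by simp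
  have P_block: "(\<lambda>k. P (block_start k)) \<longlonglongrightarrow> f"
    using expansion by (simp add: P_def full_blocks)
  have bo: "filterlim block_of at_top at_top"
    unfolding filterlim_at_top eventually_sequentially
  proof (intro allI)
    fix k show "\<exists>M. \<forall>m\<ge>M. k \<le> block_of m"
      using block_of_less_iff[of _ k] by (intro exI[of _ "block_start k"]) (metis not_le)
  qed
  have diff: "norm (P m - P (block_start (block_of m))) \<le> e (block_of m)" for m
  proof -
    let ?n = "block_of m"
    let ?F = "{block_start ?n..<m}"
    have F: "?F \<subseteq> block ?n" using block_of(2)[of m] by (auto simp: block_def)
    have "P m - P (block_start ?n) = (\<Sum>j\<in>?F. scl (\<xi> j f) (x j))"
      unfolding P_def lessThan_atLeast0 using block_of(1)[of m] by (subst sum_diff_nat_ivl) auto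
    also have "norm \<dots> \<le> K * ((\<Sum>j\<in>?F. norm (\<xi> j f) / block_root j) + L2_set (\<lambda>j. norm (\<xi> j f)) ?F)"
      by (rule upper_estimate) simp
    also have "\<dots> \<le> K * (2 * L2_set (\<lambda>j. norm (\<xi> j f)) ?F)"
      using sum_block_root_le[OF F, of "\<lambda>j. \<xi> j f"] K_pos by (intro mult_left_mono) auto
    also have "\<dots> \<le> K * (2 * (L2_set (\<lambda>j. norm (q j f)) (block ?n) + norm (\<gamma> (block_start ?n) f)))"
      using L2_\<xi>_block_le[OF F, of f] K_pos by (intro mult_left_mono) auto
    finally show ?thesis by (simp add: e_def algebra_simps)
  qed
  have "(\<lambda>m. P m - P (block_start (block_of m))) \<longlonglongrightarrow> 0"
  proof (rule Lim_null_comparison)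
    show "\<forall>\<^sub>F m in sequentially. norm (P m - P (block_start (block_of m))) \<le> e (block_of m)"
      using diff by simp
    show "(\<lambda>m. e (block_of m)) \<longlonglongrightarrow> 0" by (rule filterlim_compose[OF e0 bo])
  qed
  from tendsto_add[OF this filterlim_compose[OF P_block bo]]
  have "P \<longlonglongrightarrow> f" by simp
  then show ?thesis by (simp add: P_def sums_def)
qed

lemma basis_x: "schauder_basis scl x"
  by (rule schauder_basisI(1)[OF linfun_\<xi> \<xi>_x \<xi>_sums])

lemma coord_x: "coord scl x j f = \<xi> j f"
  by (rule schauder_basisI(2)[OF linfun_\<xi> \<xi>_x \<xi>_sums])

section \<open>Almost greediness and the fundamental function\<close>

lemma coord_proj_finite: "finite A \<Longrightarrow> coord_proj scl x A f = (\<Sum>j\<in>A. scl (\<xi> j f) (x j))"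
  by (simp add: coord_proj_def coord_x)

lemma coord_proj_finite_supp:
  assumes "supp scl x f \<subseteq> {..<m}"
  shows "coord_proj scl x A f = (\<Sum>j\<in>A \<inter> {..<m}. scl (\<xi> j f) (x j))"
proof -
  have "coord_proj scl x A f = (\<Sum>\<^sub>\<infinity>j\<in>A \<inter> {..<m}. scl (\<xi> j f) (x j))"
    unfolding coord_proj_def coord_x
    by (rule infsum_cong_neutral) (use assms in \<open>auto simp: supp_def coord_x\<close>)
  then show ?thesis by simp
qed

lemma \<xi>_sum: "finite A \<Longrightarrow> \<xi> j (\<Sum>i\<in>A. scl (c i) (x i)) = (if j \<in> A then c j else 0)"
  by (simp add: linfun_sum[OF linfun_\<xi>] linfun_scale[OF linfun_\<xi>] \<xi>_x if_distrib[of "(*) _"]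
    cong: if_cong)

text \<open>
  With \<open>g = f - S\<^sub>B f\<close> one has \<open>f - S\<^sub>A f = g - S\<^bsub>A - B\<^esub> g + S\<^bsub>B - A\<^esub> f\<close>, where \<open>A - B\<close> is a greedy set
  of \<open>g\<close> and the coordinates in \<open>B - A\<close> are not larger than those in \<open>A - B\<close>.
\<close>

lemma almost_greedy_estimate:
  assumes A: "finite A" and B: "finite B" and card: "card B \<le> card A"
    and greedy: "\<And>j k. j \<notin> A \<Longrightarrow> k \<in> A \<Longrightarrow> norm (\<xi> j f) \<le> norm (\<xi> k f)"
  shows "norm (f - (\<Sum>j\<in>A. scl (\<xi> j f) (x j))) \<le> 63 * K\<^sup>2 * norm (f - (\<Sum>j\<in>B. scl (\<xi> j f) (x j)))"
proof -
  let ?S = "\<lambda>F. \<Sum>j\<in>F. scl (\<xi> j f) (x j)"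
  define g where "g = f - ?S B"
  have K1: "1 \<le> K\<^sup>2" using K by simp
  have g\<xi>: "\<xi> j g = (if j \<in> B then 0 else \<xi> j f)" for j
    by (simp add: g_def linfun_diff[OF linfun_\<xi>] \<xi>_sum[OF B])
  have nonneg: "0 \<le> K\<^sup>2 * norm g" by simp
  have "norm (f - ?S A) \<le> 63 * K\<^sup>2 * norm g"
  proof (cases "A - B = {}")
    case True
    then have "A = B" using card_seteq[OF B, of A] card by auto
    then have "f - ?S A = g" by (simp add: g_def)
    moreover have "1 * norm g \<le> 63 * K\<^sup>2 * norm g" using K1 by (intro mult_right_mono) auto
    ultimately show ?thesis by simp
  next
    case False
    define t where "t = Min ((\<lambda>j. norm (\<xi> j f)) ` (A - B))"
    have fin: "finite (A - B)" using A by simp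
    have t_le: "t \<le> norm (\<xi> j f)" if "j \<in> A - B" for j
      unfolding t_def using that fin by (intro Min_le) auto
    obtain l where l: "l \<in> A - B" "t = norm (\<xi> l f)"
      using Min_in[of "(\<lambda>j. norm (\<xi> j f)) ` (A - B)"] fin False unfolding t_def by blast
    show ?thesis
    \<comment> \<open>\<open>greedy_projection_le\<close> needs a positive threshold. If the
      smallest coordinate on \<open>A - B\<close> is 0, greediness annihilates all coordinates
      outside \<open>A\<close>, and \<open>f\<close> equals its projection.\<close>
    proof (cases "t = 0")
      case True
      then have "\<xi> j f = 0" if "j \<notin> A" for j using greedy[OF that, of l] l by simp
      then have "(\<lambda>j. scl (\<xi> j f) (x j)) sums ?S A" by (intro sums_finite A) auto
      then have "f = ?S A" using \<xi>_sums sums_unique2 by blast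
      then show ?thesis using nonneg by simp
    next
      case False
      then have t: "t > 0" using l by simp
      have 1: "norm (\<Sum>j\<in>A - B. scl (\<xi> j g) (x j)) \<le> 34 * K\<^sup>2 * norm g"
      proof (rule greedy_projection_le[OF fin t])
        show "t \<le> norm (\<xi> j g)" if "j \<in> A - B" for j using that t_le by (simp add: g\<xi>)
        show "norm (\<xi> j g) \<le> t" if "j \<notin> A - B" for j
          using that greedy[of j l] l t by (auto simp: g\<xi>)
      qed
      have "card (B - A) \<le> card (A - B)"
        using card A B by (metis card_le_sym_Diff)
      then have "sqrt (real (card (B - A))) \<le> sqrt (real (card (A - B)))" by simp
      then have "7 * K * t * sqrt (real (card (B - A))) \<le> 7 * K * (t * sqrt (real (card (A - B))))"
        using K_pos t by (simp add: mult_left_mono)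
      also have "\<dots> \<le> 7 * K * (4 * K * norm g)"
      proof -
        have "t * sqrt (real (card (A - B))) \<le> 4 * K * norm g"
          by (rule lower_estimate[OF fin t]) (use t_le g\<xi> in auto)
        then show ?thesis using K_pos by (intro mult_left_mono) auto
      qed
      finally have "7 * K * t * sqrt (real (card (B - A))) \<le> 28 * K\<^sup>2 * norm g"
        by (simp add: power2_eq_square)
      moreover have "norm (?S (B - A)) \<le> 7 * K * t * sqrt (real (card (B - A)))"
        using greedy[of _ l] l t B by (intro flat_upper_estimate) auto
      ultimately have 2: "norm (?S (B - A)) \<le> 28 * K\<^sup>2 * norm g" by linarith
      have "?S A = ?S (A \<inter> B) + ?S (A - B)" "?S B = ?S (B \<inter> A) + ?S (B - A)"
        by (rule sum.Int_Diff[OF A], rule sum.Int_Diff[OF B])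
      moreover have "?S (A - B) = (\<Sum>j\<in>A - B. scl (\<xi> j g) (x j))"
        by (intro sum.cong refl) (simp add: g\<xi>)
      ultimately have "f - ?S A = g - (\<Sum>j\<in>A - B. scl (\<xi> j g) (x j)) + ?S (B - A)"
        by (simp add: g_def Int_commute)
      then have "norm (f - ?S A) \<le> norm g + norm (\<Sum>j\<in>A - B. scl (\<xi> j g) (x j)) + norm (?S (B - A))"
        using norm_triangle_ineq[of "g - (\<Sum>j\<in>A - B. scl (\<xi> j g) (x j))" "?S (B - A)"]
          norm_triangle_ineq4[of g "\<Sum>j\<in>A - B. scl (\<xi> j g) (x j)"] by simp
      \<comment> \<open>63 = 1 + 34 + 28, where 28 is the product of the constants 7 and 4 in the
        upper and lower estimates.\<close>
      also have "\<dots> \<le> K\<^sup>2 * norm g + 34 * K\<^sup>2 * norm g + 28 * K\<^sup>2 * norm g"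
        using 1 2 mult_right_mono[OF K1 norm_ge_zero[of g]] by (intro add_mono) simp_all
      finally show ?thesis by (simp add: mult_ac)
    qed
  qed
  then show ?thesis by (simp add: g_def)
qed

lemma almost_greedy_x: "almost_greedy scl x"
  unfolding almost_greedy_def coord_x
proof (intro exI[of _ "63 * K\<^sup>2"] allI impI)
  fix f and A B :: "nat set"
  assume *: "finite A \<and> finite B \<and> card B \<le> card A \<and>
    (\<forall>j\<in>-A. \<forall>k\<in>A. norm (\<xi> j f) \<le> norm (\<xi> k f))"
  then show "norm (f - coord_proj scl x A f) \<le> 63 * K\<^sup>2 * norm (f - coord_proj scl x B f)"
    using almost_greedy_estimate[of A B f] by (simp add: coord_proj_finite)
qed

lemma fundamental_function_x:
  "approx_on {1..} (fundamental_function x) (\<lambda>m. ennreal (sqrt (real m)))"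
proof -
  have upper: "norm (\<Sum>j\<in>A. x j) \<le> 7 * K * sqrt (real m)" if "finite A" "card A \<le> m" for A m
  proof -
    have "norm (\<Sum>j\<in>A. scl 1 (x j)) \<le> 7 * K * 1 * sqrt (real (card A))"
      using that by (intro flat_upper_estimate) auto
    also have "\<dots> \<le> 7 * K * 1 * sqrt (real m)" using that K_pos by (intro mult_left_mono) auto
    finally show ?thesis by simp
  qed
  have lower: "sqrt (real m) \<le> 4 * K * norm (\<Sum>j<m. x j)" for m
  proof -
    have "\<xi> j (\<Sum>i<m. x i) = 1" if "j < m" for j
      using \<xi>_sum[of "{..<m}" j "\<lambda>_. 1"] that by simp
    then show ?thesis using lower_estimate[of "{..<m}" 1 "\<Sum>j<m. x j"] by simp
  qed
  show ?thesis
    unfolding approx_on_def lesssim_on_def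
  proof (intro conjI exI ballI)
    fix m
    show "fundamental_function x m \<le> ennreal (7 * K) * ennreal (sqrt (real m))"
      unfolding fundamental_function_def using upper K_pos
      by (intro SUP_least) (simp flip: ennreal_mult)
    have "ennreal (sqrt (real m)) \<le> ennreal (4 * K * norm (\<Sum>j<m. x j))"
      by (intro ennreal_leI lower)
    also have "\<dots> = ennreal (4 * K) * ennreal (norm (\<Sum>j<m. x j))"
      using K_pos by (intro ennreal_mult) auto
    also have "ennreal (norm (\<Sum>j<m. x j)) \<le> fundamental_function x m"
      unfolding fundamental_function_def by (rule SUP_upper) simp
    finally show "ennreal (sqrt (real m)) \<le> ennreal (4 * K) * fundamental_function x m"
      by (simp add: mult_left_mono)
  qed
qed

section \<open>Conditionality constants\<close>

lemma block_sums_le: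
  "(\<Sum>j<block_start k. norm (\<xi> j f) / block_root j) + L2_set (\<lambda>j. norm (\<xi> j f)) {..<block_start k}
    \<le> 4 * K * real k * norm f"
proof (induction k)
  case (Suc k)
  let ?L = "L2_set (\<lambda>j. norm (\<xi> j f))"
  have "?L (block k) \<le> L2_set (\<lambda>j. norm (q j f)) (block k) + norm (\<gamma> (block_start k) f)"
    by (rule L2_\<xi>_block_le) simp
  also have "\<dots> \<le> K * norm f + K * norm f" by (intro add_mono L2_q \<gamma>_start_le) simp
  \<comment> \<open>Each of the two summands grows by at most this amount per block, which accounts
    for the constant 4 and the linear dependence on \<open>k\<close>.\<close>
  finally have b: "?L (block k) \<le> 2 * K * norm f" by simp
  have "(\<Sum>j<block_start (Suc k). norm (\<xi> j f) / block_root j) =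
      (\<Sum>j<block_start k. norm (\<xi> j f) / block_root j) + (\<Sum>j\<in>block k. norm (\<xi> j f) / block_root j)"
    unfolding lessThan_block_start_Suc by (rule sum.union_disjoint) (auto simp: lessThan_block_start_Suc)
  moreover have "(\<Sum>j\<in>block k. norm (\<xi> j f) / block_root j) \<le> ?L (block k)"
    by (rule sum_block_root_le[OF subset_refl])
  moreover have "?L {..<block_start (Suc k)} \<le> ?L {..<block_start k} + ?L (block k)"
  proof -
    have "(\<Sum>j<block_start (Suc k). (norm (\<xi> j f))\<^sup>2) =
        (\<Sum>j<block_start k. (norm (\<xi> j f))\<^sup>2) + (\<Sum>j\<in>block k. (norm (\<xi> j f))\<^sup>2)"
      unfolding lessThan_block_start_Suc by (rule sum.union_disjoint) (auto simp: lessThan_block_start_Suc)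
    then show ?thesis unfolding L2_set_def by (simp add: sqrt_add_le_add_sqrt sum_nonneg)
  qed
  ultimately have "(\<Sum>j<block_start (Suc k). norm (\<xi> j f) / block_root j) + ?L {..<block_start (Suc k)}
      \<le> 4 * K * real k * norm f + 2 * (2 * K * norm f)"
    using Suc b by linarith
  then show ?case by (simp add: algebra_simps)
qed simp

lemma projection_le_ln:
  assumes m: "m \<ge> 2" and f: "supp scl x f \<subseteq> {..<m}"
  shows "norm (coord_proj scl x A f) \<le> 20 * K\<^sup>2 * ln (real m) * norm f"
proof -
  \<comment> \<open>The number of blocks met by the indices below \<open>m\<close>, the last of
    which is \<open>m - 1\<close>.\<close>
  define k where "k = Suc (block_of (m - 1))"
  have "m \<le> block_start k" using block_of(2)[of "m - 1"] m by (simp add: k_def)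
  then have sub: "A \<inter> {..<m} \<subseteq> {..<block_start k}" by auto
  have "norm (coord_proj scl x A f) \<le> K * ((\<Sum>j\<in>A \<inter> {..<m}. norm (\<xi> j f) / block_root j)
      + L2_set (\<lambda>j. norm (\<xi> j f)) (A \<inter> {..<m}))"
    unfolding coord_proj_finite_supp[OF f] by (rule upper_estimate) simp
  also have "\<dots> \<le> K * ((\<Sum>j<block_start k. norm (\<xi> j f) / block_root j)
      + L2_set (\<lambda>j. norm (\<xi> j f)) {..<block_start k})"
    using K_pos sub by (intro mult_left_mono add_mono sum_mono2 L2_mono_set) (auto simp: less_imp_le)
  also have "\<dots> \<le> K * (4 * K * real k * norm f)"
    using K_pos by (intro mult_left_mono block_sums_le) auto
  also have "\<dots> = 4 * K\<^sup>2 * norm f * real k" by (simp add: power2_eq_square)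
  also have "\<dots> \<le> 4 * K\<^sup>2 * norm f * (5 * ln (real m))"
    using block_of_le_ln[OF m] unfolding k_def by (intro mult_left_mono) auto
  finally show ?thesis by (simp add: mult_ac)
qed

text \<open>A combination of conditional vectors has constant coordinates on each block. Projecting
  it onto a union of blocks therefore just selects conditional vectors, so the growth assumed in
  \<open>conditional\<close> reappears with as many vectors as there are complete blocks below
  \<open>m\<close>.\<close>

lemma ln_le_projection:
  assumes m: "m \<ge> 2"
  obtains f A where "f \<noteq> 0" "supp scl x f \<subseteq> {..<m}"
    "ln (real m) \<le> 3 * K\<^sup>2 * (norm (coord_proj scl x A f) / norm f)"
proof -
  \<comment> \<open>All blocks before the one containing the zero-based index \<open>m\<close> lie
    in \<open>{..<m}\<close>, and \<open>m >= 2\<close> guarantees at least one.\<close>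
  define k where "k = block_of m"
  have k1: "k \<ge> 1"
    using block_of_less_iff[of m 1] m by (auto simp: k_def block_start_Suc)
  have km: "block_start k \<le> m" unfolding k_def by (rule block_of(1))
  obtain b E where b: "norm (\<Sum>n<k. scl (b n) (g (block_start n))) \<le> K"
    "real k \<le> K * norm (\<Sum>n\<in>{..<k} \<inter> E. scl (b n) (g (block_start n)))"
    using conditional by blast
  define f where "f = (\<Sum>n<k. scl (b n) (g (block_start n)))"
  define h where "h = (\<Sum>n\<in>{..<k} \<inter> E. scl (b n) (g (block_start n)))"
  have \<gamma>_sum: "\<gamma> i (\<Sum>n\<in>F. scl (b n) (g (block_start n))) =
      (if i \<in> block_start ` F then b (block_of i) else 0)" if "finite F" for i F
  proof -
    have "\<gamma> i (\<Sum>n\<in>F. scl (b n) (g (block_start n))) = (\<Sum>n\<in>F. if i = block_start n then b n else 0)"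
      by (simp add: linfun_sum[OF linfun_\<gamma>] linfun_scale[OF linfun_\<gamma>] biorth if_distrib[of "(*) _"] cong: if_cong)
    also have "\<dots> = (\<Sum>n\<in>F. if n = block_of i then (if i \<in> block_start ` F then b (block_of i) else 0) else 0)"
      by (rule sum.cong) (auto simp: inj_block_start)
    also have "\<dots> = (if i \<in> block_start ` F then b (block_of i) else 0)"
      using that by auto
    finally show ?thesis .
  qed
  have \<xi>_lin: "\<xi> j (\<Sum>n\<in>F. scl (b n) (g (block_start n))) =
      (if block_of j \<in> F then (1 / block_root j) *\<^sub>R b (block_of j) else 0)" if F: "finite F" for j F
  proof -
    have "\<xi> j (\<Sum>n\<in>F. scl (b n) (g (block_start n))) =
        (\<Sum>i\<in>block (block_of j). if i = block_start (block_of j) then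
          (if block_of j \<in> F then (1 / block_root j) *\<^sub>R b (block_of j) else 0) else 0)"
      unfolding \<xi>_def
      by (rule sum.cong) (auto simp: \<gamma>_sum[OF F] in_block_iff householder_start inj_block_start)
    also have "\<dots> = (if block_of j \<in> F then (1 / block_root j) *\<^sub>R b (block_of j) else 0)"
      by (simp add: in_block_iff)
    finally show ?thesis .
  qed
  have f\<xi>: "\<xi> j f = (if block_of j < k then (1 / block_root j) *\<^sub>R b (block_of j) else 0)" for j
    unfolding f_def by (simp add: \<xi>_lin)
  have h\<xi>: "\<xi> j h = (if block_of j \<in> E then \<xi> j f else 0)" for j
    unfolding h_def f\<xi> by (simp add: \<xi>_lin)
  have supp: "supp scl x f \<subseteq> {..<block_start k}"
    by (auto simp: supp_def coord_x f\<xi> block_of_less_iff split: if_splits)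
  have "coord_proj scl x {j. block_of j \<in> E} f = (\<Sum>j<block_start k. scl (\<xi> j h) (x j))"
    unfolding coord_proj_finite_supp[OF supp] by (rule sum.mono_neutral_cong_left) (auto simp: h\<xi>)
  also have "\<dots> = h"
  proof (rule sums_unique2[OF _ \<xi>_sums[of h]])
    show "(\<lambda>j. scl (\<xi> j h) (x j)) sums (\<Sum>j<block_start k. scl (\<xi> j h) (x j))"
      by (rule sums_finite) (auto simp: h\<xi> f\<xi> block_of_less_iff)
  qed
  finally have proj: "coord_proj scl x {j. block_of j \<in> E} f = h" .
  have h_pos: "norm h > 0"
  proof (rule ccontr)
    assume "\<not> ?thesis"
    then show False using b(2) k1 by (simp add: h_def)
  qed
  have f0: "f \<noteq> 0"
  proof
    assume "f = 0"
    then have "h = 0" using proj by (simp add: coord_proj_def coord_x linfun_zero[OF linfun_\<xi>])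
    then show False using h_pos by simp
  qed
  \<comment> \<open>Since \<open>k >= 1\<close>, the bound \<open>2 * 4 ^ k\<close> is at most
    \<open>8 ^ k\<close>, whence \<open>ln m <= 3 * k\<close> because
    \<open>ln 2 < 1\<close>.\<close>
  have "m < block_start (Suc k)" unfolding k_def by (rule block_of(2))
  also have "\<dots> \<le> 2 * 4 ^ k" by (rule block_start_Suc_le)
  also have "\<dots> \<le> 2 ^ k * 4 ^ k"
  proof (rule mult_right_mono)
    show "(2::nat) \<le> 2 ^ k" using power_increasing[OF k1, of "2::nat"] by simp
  qed simp
  also have "\<dots> = 8 ^ k" by (simp flip: power_mult_distrib)
  finally have "real m \<le> real (8 ^ k)" by (intro of_nat_mono) simp
  then have "ln (real m) \<le> ln (8 ^ k)" using m by simp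
  also have "\<dots> = real k * (3 * ln 2)"
    using ln_realpow[of "2::real" 3] by (simp add: ln_realpow)
  also have "\<dots> \<le> real k * (3 * 1)" using ln_2_less_1 by (intro mult_left_mono) auto
  also have "\<dots> \<le> 3 * (K * norm h)" using b(2) by (simp add: h_def)
  also have "\<dots> \<le> 3 * (K * (K * (norm h / norm f)))"
  proof -
    have "norm h * norm f \<le> K * norm h" using mult_right_mono[OF b(1) norm_ge_zero[of h]]
      by (simp add: f_def mult.commute)
    then have "norm h \<le> K * (norm h / norm f)" using f0 by (simp add: field_simps)
    then show ?thesis using K_pos by (intro mult_left_mono) auto
  qed
  finally have "ln (real m) \<le> 3 * K\<^sup>2 * (norm (coord_proj scl x {j. block_of j \<in> E} f) / norm f)"
    by (simp add: proj power2_eq_square)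
  moreover have "supp scl x f \<subseteq> {..<m}" using supp km by auto
  ultimately show ?thesis using that f0 by blast
qed

lemma conditionality_const_x:
  "approx_on {2..} (conditionality_const scl x) (\<lambda>m. ennreal (ln (real m)))"
  unfolding approx_on_def lesssim_on_def
proof (intro conjI exI ballI)
  fix m :: nat assume "m \<in> {2..}"
  then have m: "m \<ge> 2" by simp
  show "conditionality_const scl x m \<le> ennreal (20 * K\<^sup>2) * ennreal (ln (real m))"
    unfolding conditionality_const_def
  proof (rule SUP_least, clarify)
    fix f :: 'a and A :: "nat set"
    assume f: "f \<noteq> 0" "supp scl x f \<subseteq> {..<m}"
    have "norm (coord_proj scl x A f) / norm f \<le> 20 * K\<^sup>2 * ln (real m)"
      using projection_le_ln[OF m f(2), of A] f(1) by (simp add: divide_le_eq)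
    then show "ennreal (norm (coord_proj scl x A f) / norm f) \<le> ennreal (20 * K\<^sup>2) * ennreal (ln (real m))"
      using m by (subst ennreal_mult[symmetric]) (auto intro: ennreal_leI)
  qed
  obtain f A where fA: "f \<noteq> 0" "supp scl x f \<subseteq> {..<m}"
    "ln (real m) \<le> 3 * K\<^sup>2 * (norm (coord_proj scl x A f) / norm f)"
    using ln_le_projection[OF m] by blast
  have "ennreal (ln (real m)) \<le> ennreal (3 * K\<^sup>2 * (norm (coord_proj scl x A f) / norm f))"
    by (rule ennreal_leI) (rule fA(3))
  also have "\<dots> = ennreal (3 * K\<^sup>2) * ennreal (norm (coord_proj scl x A f) / norm f)"
    by (rule ennreal_mult) auto
  also have "ennreal (norm (coord_proj scl x A f) / norm f) \<le> conditionality_const scl x m"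
    unfolding conditionality_const_def using fA by (intro SUP_upper2[of "(f, A)"]) auto
  finally show "ennreal (ln (real m)) \<le> ennreal (3 * K\<^sup>2) * conditionality_const scl x m"
    by (simp add: mult_left_mono)
qed

end

subsection \<open>Construction of a block system\<close>

lemma lp_space_2: "a \<in> lp_space 2 \<longleftrightarrow> summable (\<lambda>n. (norm (a n))\<^sup>2)"
  by (simp add: lp_space_def)

lemma lp_norm_2: "a \<in> lp_space 2 \<Longrightarrow> lp_norm 2 a = sqrt (\<Sum>n. (norm (a n))\<^sup>2)"
  by (simp add: lp_norm_def lp_space_2 powr_half_sqrt suminf_nonneg)

lemma L2_set_le_lp_norm_2:
  assumes "a \<in> lp_space 2" "finite F"
  shows "L2_set (\<lambda>j. norm (a j)) F \<le> lp_norm 2 a"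
  unfolding L2_set_def lp_norm_2[OF assms(1)]
  using assms by (intro real_sqrt_le_mono sum_le_suminf) (auto simp: lp_space_2)

lemma lp_norm_2_restr_finite:
  assumes "finite F"
  shows "restr F a \<in> lp_space 2" "lp_norm 2 (restr F a) = L2_set (\<lambda>j. norm (a j)) F"
proof -
  have "(\<lambda>n. (norm (restr F a n))\<^sup>2) sums (\<Sum>n\<in>F. (norm (restr F a n))\<^sup>2)"
    by (rule sums_finite[OF assms]) (simp add: restr_def)
  moreover have "(\<Sum>n\<in>F. (norm (restr F a n))\<^sup>2) = (\<Sum>n\<in>F. (norm (a n))\<^sup>2)"
    by (rule sum.cong) (auto simp: restr_def)
  ultimately have *: "(\<lambda>n. (norm (restr F a n))\<^sup>2) sums (\<Sum>n\<in>F. (norm (a n))\<^sup>2)" by simp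
  then show V: "restr F a \<in> lp_space 2" by (auto simp: lp_space_2 sums_iff)
  show "lp_norm 2 (restr F a) = L2_set (\<lambda>j. norm (a j)) F"
    using * by (simp add: lp_norm_2[OF V] L2_set_def sums_iff)
qed

lemma lp_norm_2_tail:
  assumes "a \<in> lp_space 2"
  shows "(\<lambda>m. lp_norm 2 (restr (- {..<m}) a)) \<longlonglongrightarrow> 0"
proof -
  let ?h = "\<lambda>n. (norm (a n))\<^sup>2"
  have h: "summable ?h" using assms by (simp add: lp_space_2)
  have V: "restr S a \<in> lp_space 2" for S
    using subsymmetric_lp[of 2] assms unfolding subsymmetric_def by auto
  have "lp_norm 2 (restr (- {..<m}) a) = sqrt ((\<Sum>n. ?h n) - (\<Sum>n<m. ?h n))" for m
  proof -
    have "(\<lambda>n. if n \<in> {..<m} then ?h n else 0) sums (\<Sum>n<m. ?h n)"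
      by (rule sums_If_finite_set) simp
    from sums_diff[OF summable_sums[OF h] this]
    have "(\<lambda>n. ?h n - (if n \<in> {..<m} then ?h n else 0)) sums ((\<Sum>n. ?h n) - (\<Sum>n<m. ?h n))" .
    also have "(\<lambda>n. ?h n - (if n \<in> {..<m} then ?h n else 0)) = (\<lambda>n. (norm (restr (- {..<m}) a n))\<^sup>2)"
      by (auto simp: restr_def)
    finally show ?thesis by (simp add: lp_norm_2[OF V] sums_iff)
  qed
  moreover have "(\<lambda>m. sqrt ((\<Sum>n. ?h n) - (\<Sum>n<m. ?h n))) \<longlonglongrightarrow> sqrt ((\<Sum>n. ?h n) - (\<Sum>n. ?h n))"
    by (intro tendsto_real_sqrt tendsto_diff tendsto_const summable_LIMSEQ h)
  ultimately show ?thesis by simp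
qed

text \<open>Splitting with \<open>e = block_start\<close> puts the copy of X that carries
  \<open>w\<close> in place of the unit vectors at the block starts. The remaining unit vectors of
  l2 then already have the indices that the blocks require.\<close>

lemma (in banach_space_over) block_system_exists:
  assumes iso: "isomorphic_to_complemented scl (lp_space 2) (lp_norm 2)"
    and w: "schauder_basis scl w" "seminormalized w" "strongly_conditional w"
  obtains g \<gamma> K where "block_system scl g \<gamma> K"
proof -
  have sub: "subsymmetric (lp_space 2 :: (nat \<Rightarrow> 'k) set) (lp_norm 2)" by (rule subsymmetric_lp) simp
  obtain U R T G C where "split_off scl (lp_space 2) (lp_norm 2) block_start U R T G C"
    using complemented_split_off[OF iso sub strict_mono_block_start] by metis
  then interpret split_off scl "lp_space 2" "lp_norm 2" block_start U R T G C .
  obtain KU where KU: "KU > 0" "\<And>f. norm (U f) \<le> KU * norm f" using linop_bound[OF U] by metis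
  obtain KR where KR: "KR > 0" "\<And>f. norm (R f) \<le> KR * norm f" using linop_bound[OF R] by metis
  obtain Kw where Kw: "Kw > 0" "\<And>n. norm (w n) \<le> Kw" "\<And>n. 1 \<le> Kw * norm (w n)"
    using w(2) unfolding seminormalized_def by blast
  obtain Kb where Kb: "Kb > 0"
    "\<And>n f. norm (\<Sum>i<n. scl (coord scl w i f) (w i)) \<le> Kb * norm f"
    using basis_constant[OF w(1)] by metis
  obtain Kc where Kc: "Kc > 0" "\<And>n f. norm (coord scl w n f) * norm (w n) \<le> Kc * norm f"
    using coord_bound[OF w(1)] by metis
  obtain Ks where Ks: "Ks > 0" "\<And>k. \<exists>b E. norm (\<Sum>n<k. scl (b n) (w n)) \<le> Ks \<and>
        real k \<le> Ks * norm (\<Sum>n\<in>{..<k} \<inter> E. scl (b n) (w n))"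
    using w(3) unfolding strongly_conditional_def by blast
  \<comment> \<open>Every summand serves some bound required by \<open>block_system\<close>; the 1
    secures \<open>1 <= K\<close>.\<close>
  define K where "K = 1 + KU * Kw + Kw * Kc * KR + KU * Kb * KR + C + KU * Ks + Ks * KR"
  have K_ge: "1 \<le> K" "KU * Kw \<le> K" "Kw * Kc * KR \<le> K" "KU * Kb * KR \<le> K" "C \<le> K"
    "KU * Ks \<le> K" "Ks * KR \<le> K"
    using KU(1) KR(1) Kw(1) Kb(1) Kc(1) Ks(1) C unfolding K_def by (simp_all add: add_nonneg_nonneg)
  define g where "g j = (if j \<in> range block_start then U (w (block_of j)) else T (unit_seq j))" for j
  define \<gamma> where "\<gamma> j f = (if j \<in> range block_start then coord scl w (block_of j) (R f) else G f j)" for j f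
  have g_start: "g (block_start n) = U (w n)" and \<gamma>_start: "\<gamma> (block_start n) f = coord scl w n (R f)" for n f
    by (simp_all add: g_def \<gamma>_def)
  have g_rest: "g j = T (unit_seq j)" and \<gamma>_rest: "\<gamma> j f = G f j" if "j \<notin> range block_start" for j f
    using that by (simp_all add: g_def \<gamma>_def)
  have unit0: "unit_seq j (block_start n) = (0::'k)" if "j \<notin> range block_start" for j n
    using that by (auto simp: unit_seq_def)
  have coord_le: "norm (coord scl w n f) \<le> Kw * norm (scl (coord scl w n f) (w n))" for n f
    using mult_left_mono[OF Kw(3)[of n] norm_ge_zero[of "coord scl w n f"]] by (simp add: norm_scale mult_ac)
  have scaled: "c * z \<le> K * z" if "c \<le> K" "0 \<le> z" for c z :: real
    using that by (rule mult_right_mono)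
  have Usum: "(\<Sum>n\<in>I. scl (b n) (U (w n))) = U (\<Sum>n\<in>I. scl (b n) (w n))" for I :: "nat set" and b
    by (simp add: linop_sum[OF U] linop_scale[OF U])
  have Tsum: "(\<Sum>j\<in>F. scl (c j) (g j)) = T (restr F c)" if "finite F" "F \<inter> range block_start = {}" for F c
  proof -
    have "g j = T (unit_seq j)" if "j \<in> F" for j
      using that \<open>F \<inter> range block_start = {}\<close> by (intro g_rest) blast
    then show ?thesis unfolding T_restr[OF that(1)] by (intro sum.cong refl) simp
  qed
  have "block_system scl g \<gamma> K"
  proof unfold_locales
    show "1 \<le> K" by (rule K_ge)
    show "linfun (\<gamma> j)" for j
    proof (cases "j \<in> range block_start")
      case True
      then show ?thesis using linfun_compose[OF linfun_coord[OF w(1)] R] by (simp add: \<gamma>_def[abs_def])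
    next
      case False
      have "linfun (\<lambda>f. G f j)"
      proof (rule linfunI[where K = C])
        show "norm (G f j) \<le> C * norm f" for f
          using L2_set_le_lp_norm_2[OF G_V, of "{j}" f] G_le[of f] by simp
      qed (simp_all add: G_add G_scale)
      then show ?thesis using False by (simp add: \<gamma>_def[abs_def])
    qed
    show "\<gamma> i (g j) = (if i = j then 1 else 0)" for i j
    proof (cases "j \<in> range block_start")
      case True
      then obtain m where j: "j = block_start m" by auto
      show ?thesis
      proof (cases "i \<in> range block_start")
        case True
        then obtain n where "i = block_start n" by auto
        then show ?thesis by (simp add: j g_start \<gamma>_start RU coord_basis[OF w(1)] inj_block_start)
      qed (auto simp: j g_start \<gamma>_rest GU)
    next
      case False
      have "G (T (unit_seq j)) = unit_seq j" "R (T (unit_seq j)) = 0"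
        using unit0[OF False] by (auto intro: GT RT unit_V)
      then show ?thesis
        using False
        by (cases "i \<in> range block_start")
          (auto simp: g_rest \<gamma>_rest \<gamma>_start unit_seq_def linfun_zero[OF linfun_coord[OF w(1)]])
    qed
    show "norm (g (block_start n)) \<le> K" for n
    proof -
      have "norm (U (w n)) \<le> KU * norm (w n)" by (rule KU(2))
      also have "\<dots> \<le> KU * Kw" using Kw(2) KU(1) by (intro mult_left_mono) auto
      finally show ?thesis using K_ge(2) by (simp add: g_start)
    qed
    show "norm (\<gamma> (block_start n) f) \<le> K * norm f" for n f
    proof -
      have "norm (coord scl w n (R f)) \<le> Kw * (norm (coord scl w n (R f)) * norm (w n))"
        using coord_le[of n "R f"] by (simp add: norm_scale)
      also have "\<dots> \<le> Kw * (Kc * (KR * norm f))"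
        using Kw(1) Kc KR(2)[of f] order_trans[OF Kc(2)[where n = n and f = "R f"] mult_left_mono[OF KR(2)[of f], of Kc]]
        by (intro mult_left_mono) auto
      also have "\<dots> = (Kw * Kc * KR) * norm f" by simp
      also have "\<dots> \<le> K * norm f" by (intro scaled K_ge) simp
      finally show ?thesis by (simp add: \<gamma>_start)
    qed
    show "(\<lambda>n. \<gamma> (block_start n) f) \<longlonglongrightarrow> 0" for f
      unfolding \<gamma>_start
    proof (rule Lim_null_comparison)
      show "\<forall>\<^sub>F n in sequentially. norm (coord scl w n (R f)) \<le> Kw * norm (scl (coord scl w n (R f)) (w n))"
        using coord_le by simp
      show "(\<lambda>n. Kw * norm (scl (coord scl w n (R f)) (w n))) \<longlonglongrightarrow> 0"
        using coord_sums[OF w(1), of "R f"]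
        by (intro tendsto_mult_right_zero tendsto_norm_zero summable_LIMSEQ_zero sums_summable)
    qed
    show "norm (\<Sum>n<k. scl (\<gamma> (block_start n) f) (g (block_start n))) \<le> K * norm f" for k f
    proof -
      let ?s = "\<Sum>n<k. scl (coord scl w n (R f)) (w n)"
      have "norm (U ?s) \<le> KU * norm ?s" by (rule KU(2))
      also have "\<dots> \<le> KU * (Kb * (KR * norm f))"
        using KU(1) Kb(1) order_trans[OF Kb(2)[where n = k and f = "R f"] mult_left_mono[OF KR(2)[of f], of Kb]]
        by (intro mult_left_mono) auto
      also have "\<dots> = (KU * Kb * KR) * norm f" by simp
      also have "\<dots> \<le> K * norm f" by (intro scaled K_ge) simp
      finally show ?thesis by (simp only: \<gamma>_start g_start Usum)
    qed
    show "L2_set (\<lambda>j. norm (\<gamma> j f)) F \<le> K * norm f" if F: "finite F" "F \<inter> range block_start = {}" for F f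
    proof -
      have "L2_set (\<lambda>j. norm (\<gamma> j f)) F = L2_set (\<lambda>j. norm (G f j)) F"
      proof (rule L2_set_cong[OF refl])
        fix j assume "j \<in> F"
        then have "j \<notin> range block_start" using F(2) by blast
        from \<gamma>_rest[OF this] show "norm (\<gamma> j f) = norm (G f j)" by simp
      qed
      also have "\<dots> \<le> lp_norm 2 (G f)" by (rule L2_set_le_lp_norm_2[OF G_V F(1)])
      also have "\<dots> \<le> C * norm f" by (rule G_le)
      also have "\<dots> \<le> K * norm f" by (intro scaled K_ge) simp
      finally show ?thesis .
    qed
    show "norm (\<Sum>j\<in>F. scl (c j) (g j)) \<le> K * L2_set (\<lambda>j. norm (c j)) F"
      if F: "finite F" "F \<inter> range block_start = {}" for F c
    proof -
      have "norm (T (restr F c)) \<le> C * L2_set (\<lambda>j. norm (c j)) F"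
        using T_le[OF lp_norm_2_restr_finite(1)[OF F(1)], of c] by (simp add: lp_norm_2_restr_finite(2)[OF F(1)])
      also have "\<dots> \<le> K * L2_set (\<lambda>j. norm (c j)) F" by (intro scaled K_ge L2_set_nonneg)
      finally show ?thesis by (simp only: Tsum[OF F])
    qed
    show "(\<lambda>k. \<Sum>j<block_start k. scl (\<gamma> j f) (g j)) \<longlonglongrightarrow> f" for f
    proof -
      have split: "{..<block_start k} \<inter> range block_start = block_start ` {..<k}" for k
        using strict_mono_less[OF strict_mono_block_start] by auto
      have eq: "(\<Sum>j<block_start k. scl (\<gamma> j f) (g j)) =
          U (\<Sum>n<k. scl (coord scl w n (R f)) (w n)) + T (restr {..<block_start k} (G f))" for k
      proof -
        let ?r = "{..<block_start k} - range block_start"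
        have "(\<Sum>j\<in>block_start ` {..<k}. scl (\<gamma> j f) (g j)) = (\<Sum>n<k. scl (coord scl w n (R f)) (U (w n)))"
          by (subst sum.reindex) (auto simp: inj_on_def inj_block_start \<gamma>_start g_start)
        moreover have "(\<Sum>j\<in>?r. scl (\<gamma> j f) (g j)) = T (restr {..<block_start k} (G f))"
        proof -
          have "(\<Sum>j\<in>?r. scl (\<gamma> j f) (g j)) = (\<Sum>j\<in>?r. scl (G f j) (g j))"
            using \<gamma>_rest[of _ f] by (intro sum.cong refl) (metis DiffD2)
          also have "\<dots> = T (restr ?r (G f))" by (rule Tsum) auto
          \<comment> \<open>\<open>G f\<close> vanishes at the block starts, so they may be added to
            the range without changing the restriction.\<close>
          also have "restr ?r (G f) = restr {..<block_start k} (G f)" using G_e by (auto simp: restr_def fun_eq_iff)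
          finally show ?thesis .
        qed
        ultimately show ?thesis
          using sum.Int_Diff[of "{..<block_start k}" "\<lambda>j. scl (\<gamma> j f) (g j)" "range block_start"]
          by (simp add: split Usum)
      qed
      have lim1: "(\<lambda>k. U (\<Sum>n<k. scl (coord scl w n (R f)) (w n))) \<longlonglongrightarrow> U (R f)"
        using bounded_linear.tendsto[OF linop_bounded_linear[OF U]] coord_sums[OF w(1), of "R f"]
        unfolding sums_def by blast
      have "(\<lambda>m. T (G f) - T (restr {..<m} (G f))) \<longlonglongrightarrow> 0"
      proof (rule Lim_null_comparison)
        have "T (G f) - T (restr {..<m} (G f)) = T (restr (- {..<m}) (G f))" for m
        proof -
          have "(\<lambda>n. G f n - restr {..<m} (G f) n) = restr (- {..<m}) (G f)" by (auto simp: restr_def)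
          then show ?thesis using T_diff[OF G_V restr_V[OF G_V], of f "{..<m}" f] by simp
        qed
        then show "\<forall>\<^sub>F m in sequentially. norm (T (G f) - T (restr {..<m} (G f)))
            \<le> C * lp_norm 2 (restr (- {..<m}) (G f))"
          using T_le[OF restr_V[OF G_V]] by simp
        show "(\<lambda>m. C * lp_norm 2 (restr (- {..<m}) (G f))) \<longlonglongrightarrow> 0"
          by (rule tendsto_mult_right_zero[OF lp_norm_2_tail[OF G_V]])
      qed
      from tendsto_diff[OF tendsto_const[of "T (G f)"] this]
      have "(\<lambda>m. T (restr {..<m} (G f))) \<longlonglongrightarrow> T (G f)" by simp
      from LIMSEQ_subseq_LIMSEQ[OF this strict_mono_block_start]
      have lim2: "(\<lambda>k. T (restr {..<block_start k} (G f))) \<longlonglongrightarrow> T (G f)" by (simp add: o_def)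
      show ?thesis unfolding eq using tendsto_add[OF lim1 lim2] by (simp add: decomp)
    qed
    show "\<exists>b E. norm (\<Sum>n<k. scl (b n) (g (block_start n))) \<le> K \<and>
        real k \<le> K * norm (\<Sum>n\<in>{..<k} \<inter> E. scl (b n) (g (block_start n)))" for k
    proof -
      obtain b E where b: "norm (\<Sum>n<k. scl (b n) (w n)) \<le> Ks"
        "real k \<le> Ks * norm (\<Sum>n\<in>{..<k} \<inter> E. scl (b n) (w n))" using Ks(2) by blast
      let ?s = "\<lambda>F. \<Sum>n\<in>F. scl (b n) (w n)"
      have "norm (U (?s {..<k})) \<le> KU * Ks"
        using order_trans[OF KU(2) mult_left_mono[OF b(1), of KU]] KU(1) by simp
      then have 1: "norm (U (?s {..<k})) \<le> K" using K_ge(6) by linarith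
      have "real k \<le> Ks * norm (?s ({..<k} \<inter> E))" by (rule b(2))
      also have "norm (?s ({..<k} \<inter> E)) \<le> KR * norm (U (?s ({..<k} \<inter> E)))"
        using KR(2)[of "U (?s ({..<k} \<inter> E))"] by (simp only: RU)
      also have "Ks * (KR * norm (U (?s ({..<k} \<inter> E)))) = (Ks * KR) * norm (U (?s ({..<k} \<inter> E)))"
        by simp
      also have "\<dots> \<le> K * norm (U (?s ({..<k} \<inter> E)))" by (intro scaled K_ge) simp
      finally have 2: "real k \<le> K * norm (U (?s ({..<k} \<inter> E)))" using Ks(1) by simp
      show ?thesis unfolding g_start Usum using 1 2 by blast
    qed
  qed
  then show ?thesis by (rule that)
qed

theorem theorem3p6:
  fixes scl :: "'k::{real_normed_field,euclidean_space} \<Rightarrow> 'a::banach \<Rightarrow> 'a"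
  assumes "banach_space_over scl"
    and "\<exists>y. schauder_basis scl y"
    and "isomorphic_to_complemented scl (lp_space 2) (lp_norm 2)"
    and "isomorphic_to_complemented scl c0_space sup_norm \<or>
         isomorphic_to_complemented scl (lp_space 1) (lp_norm 1)"
  shows "\<exists>x. schauder_basis scl x \<and> almost_greedy scl x \<and>
           approx_on {1..} (fundamental_function x) (\<lambda>m. ennreal (sqrt (real m))) \<and>
           approx_on {2..} (conditionality_const scl x) (\<lambda>m. ennreal (ln (real m)))"
proof -
  interpret banach_space_over scl by fact
  obtain y where y: "schauder_basis scl y" using assms(2) by blast
  obtain w where w: "schauder_basis scl w" "seminormalized w" "strongly_conditional w"
    using assms(4)
  proof
    assume "isomorphic_to_complemented scl c0_space sup_norm"
    then show ?thesis
      using strongly_conditional_basis[OF y _ subsymmetric_c0 c0_summing_basis] that by blast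
  next
    assume "isomorphic_to_complemented scl (lp_space 1) (lp_norm 1)"
    then show ?thesis
      using strongly_conditional_basis[OF y _ subsymmetric_lp[OF zero_less_one] l1_difference_basis] that
      by blast
  qed
  obtain g \<gamma> K where "block_system scl g \<gamma> K"
    using block_system_exists[OF assms(3) w] by blast
  then interpret B: block_system scl g \<gamma> K .
  show ?thesis
    using B.basis_x B.almost_greedy_x B.fundamental_function_x B.conditionality_const_x by blast
qed

end
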